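(* Let $(N,\Pi)$ be a generalized number system with zeta function $\zeta$. Then the following four statements are equivalent: (i) For some $a>0$, the generalized integer distribution function $N$ satisfies $$N(x)=ax+O\!\left(\frac{x}{\log^n x}\right)\quad(\mathrm{C}),\quad\text{for all } n\in\mathbb{N}.$$ (ii) For some $a>0$, the function $G(s)=\zeta(s)-\frac{a}{s-1}$ has a $C^\infty$-extension to $\Re e\, s\ge 1$ and the function $t\mapsto G(1+it)$ belongs to $\mathcal{O}_M(\mathbb{R})$. (iii) For some $a>0$, there is a positive sequence $\{\beta_n\}_{n=0}^\infty$ such that the function $G(s)=\zeta(s)-\frac{a}{s-1}$ satisfies $$G^{(n)}(s)=O((1+|s|)^{\beta_n}),\quad\text{for all } n\in\mathbb{N},$$ on $\Re e\, s>1$ with global $O_n$-constants (i.e., for each $n$ there is $C_n$ with $|G^{(n)}(s)|\le C_n(1+|s|)^{\beta_n}$ for all $s$ with $\Re e\, s>1$). (iv) The Riemann prime distribution function $\Pi$ satisfies $$\Pi(x)=\operatorname{Li}(x)+O\!\left(\frac{x}{\log^n x}\right)\quad(\mathrm{C}),\quad\text{for all } n\in\mathbb{N}.$$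
   Context: A (Beurling) generalized number system is a pair of non-decreasing right-continuous functions $N$ and $\Pi$ with $N(1)=1$, $\Pi(1)=0$, both with support in $[1,\infty)$, linked via $$\zeta(s):=\int_{1^-}^\infty x^{-s}\,dN(x)=\exp\left(\int_1^\infty x^{-s}\,d\Pi(x)\right).$$ Standing assumption: these integrals converge (and the identity holds) at least on the half-plane $\Re e\, s>1$. The lower limit $1^-$ means that the point mass at $1$ is included. $N$ is the generalized integer distribution function and $\Pi$ the Riemann prime distribution function. Cesàro asymptotics: for a locally integrable function $E$ with support in $[0,\infty)$ and $\alpha\in\mathbb{R}$, one writes $E(x)=O\left(\frac{x}{\log^\alpha x}\right)$ $(\mathrm{C})$ (as $x\to\infty$) if there is some (possibly large) $m\in\mathbb{N}$, which may depend on $\alpha$, such that $$\int_0^x\frac{E(u)}{u}\left(1-\frac{u}{x}\right)^m du=O\left(\frac{x}{\log^\alpha x}\right)\quad (x\to\infty).$$ An expression $f(x)=g(x)+O(x/\log^\alpha x)$ $(\mathrm{C})$ means that the function $E$ equal to $f-g$ on $[1,\infty)$ and to $0$ on $[0,1)$ satisfies this estimate. $\mathcal{O}_M(\mathbb{R})$ is the space of all $g\in C^\infty(\mathbb{R})$ such that for each $n\in\mathbb{N}$ there is $\beta_n\in\mathbb{R}$ with $g^{(n)}(t)=O_n(|t|^{\beta_n})$ as $|t|\to\infty$. $\operatorname{Li}$ is the logarithmic integral, e.g. $\operatorname{Li}(x)=\int_2^x\frac{du}{\log u}$. "$G$ has a $C^\infty$-extension to $\Re e\, s\ge1$" means that $G$,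 analytic on $\Re e\, s>1$, and all its derivatives extend continuously to $\Re e\, s\ge 1$. $\mathbb{N}$ includes $0$ (with $G^{(0)}=G$). *)

theory Defs
  imports "HOL-Complex_Analysis.Complex_Analysis" "HOL-Library.Landau_Symbols"
begin

text \<open>Functions supported in \<open>[1,\<infinity>)\<close> are total functions on \<open>real\<close> vanishing on \<open>(-\<infinity>,1)\<close>, and
  \<open>dN\<close>, \<open>dP\<close> are the Lebesgue--Stieltjes measures \<open>interval_measure N\<close>, \<open>interval_measure P\<close>.
  The jump of \<open>N\<close> from \<open>0\<close> to \<open>N 1 = 1\<close> is thus a unit point mass at \<open>1\<close>; it is included
  in the integral over \<open>{1..}\<close>, which renders the lower limit \<open>1\<close> from the left.\<close>

definition beurling_zeta :: "(real \<Rightarrow> real) \<Rightarrow> complex \<Rightarrow> complex" where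
  "beurling_zeta N s = (LINT x:{1..}|interval_measure N. complex_of_real x powr (- s))"

text \<open>As the measures are non-negative, convergence of the two improper integrals throughout
  the half-plane \<open>Re s > 1\<close> is the same as absolute convergence there.\<close>

definition generalized_number_system :: "(real \<Rightarrow> real) \<Rightarrow> (real \<Rightarrow> real) \<Rightarrow> bool" where
  "generalized_number_system N P \<longleftrightarrow>
     mono N \<and> mono P \<and>
     (\<forall>x. continuous (at_right x) N) \<and> (\<forall>x. continuous (at_right x) P) \<and>
     (\<forall>x<1. N x = 0) \<and> (\<forall>x<1. P x = 0) \<and>
     N 1 = 1 \<and> P 1 = 0 \<and>
     (\<forall>s. Re s > 1 \<longrightarrow>
        set_integrable (interval_measure N) {1..} (\<lambda>x. complex_of_real x powr (- s)) \<and>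
        set_integrable (interval_measure P) {1<..} (\<lambda>x. complex_of_real x powr (- s)) \<and>
        beurling_zeta N s =
          exp (LINT x:{1<..}|interval_measure P. complex_of_real x powr (- s)))"

text \<open>\<open>cesaro_bigo \<alpha> E\<close> is \<open>E(x) = O(x / log\<^sup>\<alpha> x) (C)\<close>, which includes the local integrability
  of \<open>E\<close> on \<open>[0,\<infinity>)\<close>. It is only used for \<open>E\<close> vanishing on \<open>[0,1)\<close>, so that \<open>E u / u\<close> is
  integrable near \<open>0\<close> as well.\<close>

definition cesaro_bigo :: "real \<Rightarrow> (real \<Rightarrow> real) \<Rightarrow> bool" where
  "cesaro_bigo \<alpha> E \<longleftrightarrow>
     (\<forall>x. set_integrable lborel {0..x} E) \<and>
     (\<exists>m::nat. (\<lambda>x. LBINT u:{0..x}. E u / u * (1 - u / x) ^ m)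
                 \<in> O[at_top](\<lambda>x. x / ln x powr \<alpha>))"

text \<open>\<open>cesaro_approx \<alpha> f g\<close> is \<open>f(x) = g(x) + O(x / log\<^sup>\<alpha> x) (C)\<close>.\<close>

definition cesaro_approx :: "real \<Rightarrow> (real \<Rightarrow> real) \<Rightarrow> (real \<Rightarrow> real) \<Rightarrow> bool" where
  "cesaro_approx \<alpha> f g \<longleftrightarrow> cesaro_bigo \<alpha> (\<lambda>x. if x \<ge> 1 then f x - g x else 0)"

text \<open>The interval integral is oriented, so \<open>Li x\<close> is negative for \<open>1 < x < 2\<close>. At \<open>x = 1\<close> the
  integral diverges and \<open>Li 1 = 0\<close> by convention; a single point does not affect the integrals
  in \<open>cesaro_bigo\<close>.\<close>

definition Li :: "real \<Rightarrow> real" where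
  "Li x = (LBINT u=2..x. 1 / ln u)"

definition nth_vector_derivative :: "nat \<Rightarrow> (real \<Rightarrow> complex) \<Rightarrow> real \<Rightarrow> complex" where
  "nth_vector_derivative n g = ((\<lambda>f t. vector_derivative f (at t)) ^^ n) g"

definition O_M :: "(real \<Rightarrow> complex) set" where
  "O_M = {g. (\<forall>n t. nth_vector_derivative n g differentiable (at t)) \<and>
             (\<forall>n. \<exists>\<beta>::real. (\<lambda>t. norm (nth_vector_derivative n g t))
                                \<in> O[at_infinity](\<lambda>t. \<bar>t\<bar> powr \<beta>))}"

text \<open>\<open>H\<close> is a \<open>C\<^sup>\<infinity>\<close>-extension of \<open>G\<close> to \<open>Re s \<ge> 1\<close>: the analytic function \<open>G\<close> and all its
  derivatives on \<open>Re s > 1\<close> extend continuously to the closed half-plane, the extension \<open>F 0\<close>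
  of \<open>G\<close> itself being \<open>H\<close>.\<close>

definition smooth_extension :: "(complex \<Rightarrow> complex) \<Rightarrow> (complex \<Rightarrow> complex) \<Rightarrow> bool" where
  "smooth_extension G H \<longleftrightarrow>
     G holomorphic_on {s. Re s > 1} \<and>
     (\<exists>F :: nat \<Rightarrow> complex \<Rightarrow> complex. F 0 = H \<and>
        (\<forall>n. continuous_on {s. Re s \<ge> 1} (F n) \<and>
             (\<forall>s. Re s > 1 \<longrightarrow> F n s = (deriv ^^ n) G s)))"

definition zeta_remainder :: "(real \<Rightarrow> real) \<Rightarrow> real \<Rightarrow> complex \<Rightarrow> complex" where
  "zeta_remainder N a s = beurling_zeta N s - complex_of_real a / (s - 1)"

end

theory Submission
  imports Defs "HOL-Probability.Sinc_Integral" "HOL-Real_Asymp.Real_Asymp"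
begin

text \<open>Put \<open>e(v) = E(exp v)\<close>. In the variable \<open>v = log u\<close> the Cesaro mean of order \<open>m\<close> of \<open>E\<close> becomes the
convolution of \<open>e\<close> with the kernel \<open>(1 - exp (-z))\<^sup>m\<close> on \<open>z \<ge> 0\<close>, and the Laplace transform of this
kernel is \<open>m! / (s (s + 1) \<dots> (s + m))\<close>. A larger \<open>m\<close> therefore buys decay of the transform on
vertical lines, and it can be undone by multiplying with a polynomial. This makes the Cesaro
estimate for all powers of the logarithm equivalent to polynomial growth, on \<open>Re s > 1\<close>, of the
Laplace transform of \<open>e\<close> and of each of its derivatives (\<open>cesaro_bigo_iff_tempered\<close>); such functions
are called tempered below. In one direction every derivative costs a factor \<open>v\<close>, which the estimate
\<open>exp v / v\<^sup>n\<close> pays for. In the other direction \<open>v\<^sup>n\<close> times the Cesaro mean has, up to sign, the \<open>n\<close>-th derivative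
of the transform of the mean as its transform, so Fourier inversion on \<open>Re s = \<sigma>\<close> bounds it; the bound does not
depend on \<open>\<sigma> > 1\<close>, and \<open>\<sigma>\<close> tends to \<open>1\<close> only at the very end. No boundary values are involved.

For \<open>E = N - a x\<close> and \<open>E = \<Pi> - Li\<close> the transforms are, up to a factor \<open>1/s\<close> and an additive constant,
\<open>G = \<zeta> - a / (s - 1)\<close> and \<open>J = log ((s - 1) \<zeta>)\<close>. So (i) says that \<open>G\<close> is tempered for some \<open>a > 0\<close>,
(iii) says the same in other words, and (iv) says that \<open>J\<close> is tempered. (The function \<open>\<Pi>\<close> is \<open>P\<close> in the
formal text.)

To compare \<open>G\<close> and \<open>J\<close>, use that tempered functions form an algebra and that
\<open>exp J = (s - 1) \<zeta> = (s - 1) G + a\<close>. What is missing are polynomial bounds for \<open>exp J\<close> in terms of \<open>J\<close>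
(\<open>exp_log_zeta_poly_bound\<close>) and for \<open>1 / exp J\<close> in terms of \<open>G\<close>
(\<open>inverse_exp_log_zeta_poly_bound\<close>). Both rest on the positivity of \<open>d\<Pi>\<close>: the inequalities
\<open>|\<zeta>(s)| \<le> \<zeta>(Re s)\<close> and \<open>\<zeta>(\<sigma>)\<^sup>3 |\<zeta>(\<sigma> + it)|\<^sup>4 |\<zeta>(\<sigma> + 2it)| \<ge> 1\<close> give what is needed at a distance from
the line \<open>Re s = 1\<close> that is a negative power of \<open>1 + |s|\<close>, and the bound on the derivative bridges the
remaining gap. Going back from \<open>exp J\<close> to \<open>G\<close> also requires dividing by \<open>s - 1\<close> without losing
temperedness at the point \<open>1\<close> (\<open>tempered_divide_by_zero_at_1\<close>).

Finally, a tempered function is locally Lipschitz together with its derivatives, hence extends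
smoothly to \<open>Re s \<ge> 1\<close>; this yields (ii) from (iii). Conversely, \<open>|G(s)| = O(1 / (Re s - 1))\<close> since
\<open>|\<zeta>(s)| \<le> \<zeta>(Re s)\<close>, and Cauchy's inequality gives a similar bound for the derivatives. Between this
and the polynomial bound on \<open>Re s = 1\<close> the maximum modulus principle on rectangles interpolates,
after multiplication by a factor that vanishes at the corners on \<open>Re s = 1\<close>
(\<open>tempered_of_smooth_extension\<close>).\<close>

section \<open>Fourier inversion by Abel summation\<close>

lemma lborel_integral_FTC_half_line:
  fixes F f :: "real \<Rightarrow> complex"
  assumes F: "\<And>x. x > 0 \<Longrightarrow> (F has_vector_derivative f x) (at x)"
    and f: "\<And>x. x > 0 \<Longrightarrow> isCont f x"
    and int: "integrable lborel (\<lambda>x. indicator {0..} x *\<^sub>R f x)"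
    and A: "(F \<longlongrightarrow> A) (at_right 0)" and B: "(F \<longlongrightarrow> B) at_top"
  shows "(\<integral>x. indicator {0..} x *\<^sub>R f x \<partial>lborel) = B - A"
proof -
  have eq: "einterval 0 \<infinity> = {0<..}" by (auto simp: einterval_def)
  have si: "set_integrable lborel {0..} f" using int by (simp add: set_integrable_def)
  have "(LBINT x=0..\<infinity>. f x) = B - A"
  proof (rule interval_integral_FTC_integrable)
    show "set_integrable lborel (einterval 0 \<infinity>) f"
      unfolding eq by (rule set_integrable_subset[OF si]) auto
    show "((F \<circ> real_of_ereal) \<longlongrightarrow> A) (at_right 0)"
      using A by (auto simp: zero_ereal_def ereal_tendsto_simps)
    show "((F \<circ> real_of_ereal) \<longlongrightarrow> B) (at_left \<infinity>)"
      using B by (auto simp: ereal_tendsto_simps)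
  qed (use F f in auto)
  moreover have "(LBINT x=0..\<infinity>. f x) = (LBINT x:{0<..}. f x)"
    by (simp add: interval_lebesgue_integral_def eq)
  moreover have "(LBINT x:{0<..}. f x) = (LBINT x:{0..}. f x)"
    unfolding set_lebesgue_integral_def
    by (rule integral_discrete_difference[where X="{0}"]) (auto simp: indicator_def)
  ultimately show ?thesis by (simp add: set_lebesgue_integral_def)
qed

lemma integrable_exp_half_line:
  assumes "\<sigma> > 0"
  shows "integrable lborel (\<lambda>x. indicator {0..} x * exp (- \<sigma> * x :: real))"
proof -
  have eq: "einterval 0 \<infinity> = {0<..}" by (auto simp: einterval_def)
  have "set_integrable lborel (einterval 0 \<infinity>) (\<lambda>x. exp (- \<sigma> * x))"
  proof (rule interval_integral_FTC_nonneg)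
    show "\<And>x. ((\<lambda>x. - exp (- \<sigma> * x) / \<sigma>) has_real_derivative exp (- \<sigma> * x)) (at x)"
      using assms by (auto intro!: derivative_eq_intros)
    show "(((\<lambda>x. - exp (- \<sigma> * x) / \<sigma>) \<circ> real_of_ereal) \<longlongrightarrow> - 1 / \<sigma>) (at_right 0)"
      using assms by (auto simp: zero_ereal_def ereal_tendsto_simps intro!: tendsto_eq_intros)
    show "(((\<lambda>x. - exp (- \<sigma> * x) / \<sigma>) \<circ> real_of_ereal) \<longlongrightarrow> 0) (at_left \<infinity>)"
      unfolding ereal_tendsto_simps using assms by real_asymp
  qed auto
  hence "integrable lborel (\<lambda>x. indicator {0<..} x * exp (- \<sigma> * x :: real))"
    by (simp add: eq set_integrable_def)
  thus ?thesis
    by (subst integrable_discrete_difference[where X="{0}" and g = "\<lambda>x. indicator {0<..} x * exp (- \<sigma> * x :: real)"])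
       (auto simp: indicator_def)
qed

lemma integrable_cexp_half_line:
  assumes "Re s > 0"
  shows "integrable lborel (\<lambda>x. indicator {0..} x *\<^sub>R exp (- s * complex_of_real x))"
  by (rule Bochner_Integration.integrable_bound[OF integrable_exp_half_line[OF assms]])
     (auto simp: indicator_def)

lemma integral_cexp_half_line:
  assumes "Re s > 0"
  shows "(\<integral>x. indicator {0..} x *\<^sub>R exp (- s * complex_of_real x) \<partial>lborel) = 1 / s"
proof -
  have s: "s \<noteq> 0" using assms by auto
  have "(\<integral>x. indicator {0..} x *\<^sub>R exp (- s * complex_of_real x) \<partial>lborel) = 0 - (- 1 / s)"
  proof (rule lborel_integral_FTC_half_line[where F = "\<lambda>x. - exp (- s * complex_of_real x) / s"])
    show "((\<lambda>x. - exp (- s * complex_of_real x) / s) has_vector_derivative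
             exp (- s * complex_of_real x)) (at x)" for x
      by (rule has_vector_derivative_real_field) (auto intro!: derivative_eq_intros simp: s)
    show "((\<lambda>x. - exp (- s * complex_of_real x) / s) \<longlongrightarrow> - 1 / s) (at_right 0)"
      by (auto intro!: tendsto_eq_intros simp: s)
    have "((\<lambda>x. exp (- s * complex_of_real x)) \<longlongrightarrow> 0) at_top"
    proof (rule tendsto_norm_zero_cancel)
      have "((\<lambda>x. exp (- Re s * x)) \<longlongrightarrow> 0) at_top" using assms by real_asymp
      thus "((\<lambda>x. norm (exp (- s * complex_of_real x))) \<longlongrightarrow> 0) at_top" by simp
    qed
    from tendsto_divide[OF tendsto_minus[OF this] tendsto_const[of s] s]
    show "((\<lambda>x. - exp (- s * complex_of_real x) / s) \<longlongrightarrow> 0) at_top" by simp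
  qed (use integrable_cexp_half_line[OF assms] in \<open>auto intro!: continuous_intros\<close>)
  thus ?thesis by simp
qed

lemma integrable_inverse_1_plus_sq: "integrable lborel (\<lambda>x::real. 1 / (1 + x\<^sup>2))"
  using integrable_inverse_1_plus_square
  by (simp add: set_integrable_def einterval_def inverse_eq_divide)

lemma integral_inverse_1_plus_sq: "(LBINT x. 1 / (1 + x\<^sup>2)) = pi"
  using LBINT_inverse_1_plus_square
  by (simp add: interval_lebesgue_integral_def set_lebesgue_integral_def einterval_def inverse_eq_divide)

lemma integrable_exp_abs:
  assumes "\<epsilon> > 0"
  shows "integrable lborel (\<lambda>t::real. exp (- \<epsilon> * \<bar>t\<bar>))"
proof -
  note i = integrable_exp_half_line[OF assms]
  have "integrable lborel (\<lambda>t. indicator {0..} t * exp (- \<epsilon> * t) + indicator {0..} (0 + (-1) * t) * exp (- \<epsilon> * (0 + (-1) * t)))"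
    by (intro Bochner_Integration.integrable_add i lborel_integrable_real_affine[OF i]) auto
  thus ?thesis
    by (rule Bochner_Integration.integrable_bound) (auto simp: indicator_def abs_if)
qed

text \<open>The Fourier transform of \<open>exp (- \<epsilon> |t|)\<close> is (a multiple of) the Poisson kernel of the half-plane; the two
half-lines contribute \<open>1 / (\<epsilon> - i x)\<close> and \<open>1 / (\<epsilon> + i x)\<close>.\<close>
lemma poisson_kernel_integral:
  assumes "\<epsilon> > 0"
  shows "(\<integral>t. exp (\<i> * complex_of_real (t * x)) * exp (- \<epsilon> * \<bar>t\<bar>) \<partial>lborel) =
           complex_of_real (2 * \<epsilon> / (\<epsilon>\<^sup>2 + x\<^sup>2))"
proof -
  define s1 s2 where "s1 = Complex \<epsilon> (-x)" and "s2 = Complex \<epsilon> x"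
  have r: "Re s1 > 0" "Re s2 > 0" using assms by (auto simp: s1_def s2_def)
  define g where "g = (\<lambda>s t. indicator {0..} t *\<^sub>R exp (- s * complex_of_real t))"
  have i: "integrable lborel (g s1)" "integrable lborel (g s2)"
    unfolding g_def using integrable_cexp_half_line r by blast+
  have i2: "integrable lborel (\<lambda>t. g s2 (0 + (-1) * t))"
    by (rule lborel_integrable_real_affine[OF i(2)]) auto
  have e: "(\<integral>t. g s2 (0 + (-1) * t) \<partial>lborel) = (\<integral>t. g s2 t \<partial>lborel)"
    by (subst (2) lborel_integral_real_affine[where c="-1" and t=0]) auto
  have "(\<integral>t. exp (\<i> * complex_of_real (t * x)) * exp (- \<epsilon> * \<bar>t\<bar>) \<partial>lborel) =
        (\<integral>t. g s1 t + g s2 (0 + (-1) * t) \<partial>lborel)"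
  proof (rule integral_cong_AE)
    have "AE t in lborel. t \<noteq> (0::real)" by (rule AE_lborel_singleton)
    thus "AE t in lborel. exp (\<i> * complex_of_real (t * x)) * complex_of_real (exp (- \<epsilon> * \<bar>t\<bar>)) = g s1 t + g s2 (0 + (-1) * t)"
    proof eventually_elim
      case (elim t)
      have "exp (\<i> * complex_of_real (t * x)) * exp (- \<epsilon> * \<bar>t\<bar>) = exp (\<i> * complex_of_real (t * x) + complex_of_real (- \<epsilon> * \<bar>t\<bar>))"
        by (simp only: exp_add exp_of_real)
      also have "\<i> * complex_of_real (t * x) + complex_of_real (- \<epsilon> * \<bar>t\<bar>) =
        (if t > 0 then - s1 * complex_of_real t else - s2 * complex_of_real (- t))"
        by (auto simp: s1_def s2_def complex_eq_iff)
      finally show ?case using elim by (cases "t > 0") (auto simp: g_def)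
    qed
  qed (use i i2 in measurable)
  also have "\<dots> = 1 / s1 + 1 / s2"
    using i i2 e integral_cexp_half_line[OF r(1)] integral_cexp_half_line[OF r(2)] by (simp add: g_def)
  also have "\<dots> = complex_of_real (2 * \<epsilon> / (\<epsilon>\<^sup>2 + x\<^sup>2))"
  proof -
    have "s1 \<noteq> 0" "s2 \<noteq> 0" using r by auto
    hence "1 / s1 + 1 / s2 = (s1 + s2) / (s1 * s2)" by (simp add: field_simps)
    moreover have "s1 + s2 = of_real (2 * \<epsilon>)" "s1 * s2 = of_real (\<epsilon>\<^sup>2 + x\<^sup>2)"
      by (simp_all add: s1_def s2_def complex_eq_iff power2_eq_square)
    ultimately show ?thesis by simp
  qed
  finally show ?thesis .
qed

text \<open>Only the sup-norm estimate contained in Fourier inversion is required. Damping the inversion integral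
by \<open>exp (- \<epsilon> |t|)\<close> turns it, by Fubini, into the average of \<open>h (w + \<epsilon> z)\<close> against \<open>2 / (1 + z\<^sup>2)\<close>, which
tends to \<open>2 \<pi> h w\<close> as \<open>\<epsilon>\<close> tends to \<open>0\<close>, while the damped integral stays below \<open>\<pi> M\<close>.\<close>
lemma fourier_sup_bound:
  fixes h :: "real \<Rightarrow> real"
  assumes int: "integrable lborel h" and cont: "continuous_on UNIV h" and bdd: "\<And>v. \<bar>h v\<bar> \<le> B"
    and K: "\<And>t. norm (\<integral>v. of_real (h v) * exp (- \<i> * complex_of_real (t * v)) \<partial>lborel) \<le> M / (1 + t\<^sup>2)"
  shows "\<bar>h w\<bar> \<le> M / 2"
proof -
  have hm[measurable]: "h \<in> borel_measurable borel" using int by auto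
  have main: "norm (\<integral>z. h (w + \<epsilon> * z) * (2 / (1 + z\<^sup>2)) \<partial>lborel) \<le> M * pi" if e: "\<epsilon> > 0" for \<epsilon>
  proof -
    define F where "F = (\<lambda>(t, v). complex_of_real (h v) * exp (- \<i> * complex_of_real (t * v))
             * (exp (\<i> * complex_of_real (t * w)) * complex_of_real (exp (- \<epsilon> * \<bar>t\<bar>))))"
    have Fm[measurable]: "F \<in> borel_measurable (lborel \<Otimes>\<^sub>M lborel)"
      unfolding F_def by measurable
    have nF: "norm (F (t, v)) = \<bar>h v\<bar> * exp (- \<epsilon> * \<bar>t\<bar>)" for t v
      by (simp add: F_def norm_mult)
    have Fi: "integrable (lborel \<Otimes>\<^sub>M lborel) F"
    proof (rule lborel_pair.Fubini_integrable)
      show "integrable lborel (\<lambda>x. \<integral>y. norm (F (x, y)) \<partial>lborel)"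
        unfolding nF using integrable_exp_abs[OF e] by simp
      have "integrable lborel (\<lambda>y. F (x, y))" for x
        by (rule Bochner_Integration.integrable_bound[where f = "\<lambda>v. h v * exp (- \<epsilon> * \<bar>x\<bar>)"])
           (use int in \<open>auto simp: nF\<close>)
      thus "AE x in lborel. integrable lborel (\<lambda>y. F (x, y))" by simp
    qed (fact Fm)
    have "(\<integral>t. (\<integral>v. F (t, v) \<partial>lborel) \<partial>lborel) = (\<integral>v. (\<integral>t. F (t, v) \<partial>lborel) \<partial>lborel)"
      using lborel_pair.Fubini_integral[of "\<lambda>t v. F (t, v)"] Fi by simp
    also have "\<dots> = (\<integral>v. of_real (h v * (2 * \<epsilon> / (\<epsilon>\<^sup>2 + (w - v)\<^sup>2))) \<partial>lborel)"
    proof (rule Bochner_Integration.integral_cong[OF refl])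
      fix v
      have "(\<integral>t. F (t, v) \<partial>lborel) = (\<integral>t. of_real (h v) * (exp (\<i> * complex_of_real (t * (w - v))) * complex_of_real (exp (- \<epsilon> * \<bar>t\<bar>))) \<partial>lborel)"
        by (rule Bochner_Integration.integral_cong) (auto simp: F_def algebra_simps simp flip: exp_add)
      also have "\<dots> = of_real (h v) * of_real (2 * \<epsilon> / (\<epsilon>\<^sup>2 + (w - v)\<^sup>2))"
        by (simp only: integral_mult_right_zero poisson_kernel_integral[OF e])
      finally show "(\<integral>t. F (t, v) \<partial>lborel) = of_real (h v * (2 * \<epsilon> / (\<epsilon>\<^sup>2 + (w - v)\<^sup>2)))" by simp
    qed
    also have "\<dots> = of_real (\<integral>v. h v * (2 * \<epsilon> / (\<epsilon>\<^sup>2 + (w - v)\<^sup>2)) \<partial>lborel)" by (rule integral_complex_of_real)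
    also have "(\<integral>v. h v * (2 * \<epsilon> / (\<epsilon>\<^sup>2 + (w - v)\<^sup>2)) \<partial>lborel) = (\<integral>z. h (w + \<epsilon> * z) * (2 / (1 + z\<^sup>2)) \<partial>lborel)"
    proof -
      have eq: "\<epsilon> * (h (w + \<epsilon> * z) * (2 * \<epsilon> / (\<epsilon>\<^sup>2 + (w - (w + \<epsilon> * z))\<^sup>2))) = h (w + \<epsilon> * z) * (2 / (1 + z\<^sup>2))" for z
      proof -
        have "\<epsilon>\<^sup>2 + (w - (w + \<epsilon> * z))\<^sup>2 = \<epsilon> * \<epsilon> * (1 + z\<^sup>2)" by (simp add: algebra_simps power2_eq_square)
        thus ?thesis using e by simp
      qed
      have "(\<integral>v. h v * (2 * \<epsilon> / (\<epsilon>\<^sup>2 + (w - v)\<^sup>2)) \<partial>lborel) =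
        (\<integral>z. \<epsilon> * (h (w + \<epsilon> * z) * (2 * \<epsilon> / (\<epsilon>\<^sup>2 + (w - (w + \<epsilon> * z))\<^sup>2))) \<partial>lborel)"
        using e lborel_integral_real_affine[of \<epsilon> "\<lambda>v. h v * (2 * \<epsilon> / (\<epsilon>\<^sup>2 + (w - v)\<^sup>2))" w]
        by (simp only: abs_of_pos real_scaleR_def integral_mult_right_zero)
      thus ?thesis unfolding eq .
    qed
    finally have "(\<integral>t. (\<integral>v. F (t, v) \<partial>lborel) \<partial>lborel) = of_real (\<integral>z. h (w + \<epsilon> * z) * (2 / (1 + z\<^sup>2)) \<partial>lborel)" .
    hence "norm (\<integral>z. h (w + \<epsilon> * z) * (2 / (1 + z\<^sup>2)) \<partial>lborel) = norm (\<integral>t. (\<integral>v. F (t, v) \<partial>lborel) \<partial>lborel)"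
      by (simp only: norm_of_real real_norm_def)
    also have "\<dots> \<le> (\<integral>t. M * (1 / (1 + t\<^sup>2)) \<partial>lborel)"
    proof (rule Bochner_Integration.integral_norm_bound_integral)
      show "integrable lborel (\<lambda>t. (\<integral>v. F (t, v) \<partial>lborel))"
        using lborel_pair.integrable_fst'[OF Fi] by simp
      show "integrable lborel (\<lambda>t. M * (1 / (1 + t\<^sup>2)))" by (intro integrable_mult_right integrable_inverse_1_plus_sq)
      fix t :: real
      have "(\<integral>v. F (t, v) \<partial>lborel) = (\<integral>v. of_real (h v) * exp (- \<i> * complex_of_real (t * v)) \<partial>lborel) * (exp (\<i> * complex_of_real (t * w)) * complex_of_real (exp (- \<epsilon> * \<bar>t\<bar>)))"
        by (simp add: F_def)
      hence "norm (\<integral>v. F (t, v) \<partial>lborel) = norm (\<integral>v. of_real (h v) * exp (- \<i> * complex_of_real (t * v)) \<partial>lborel) * exp (- \<epsilon> * \<bar>t\<bar>)"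
        by (simp add: norm_mult)
      also have "\<dots> \<le> norm (\<integral>v. of_real (h v) * exp (- \<i> * complex_of_real (t * v)) \<partial>lborel)"
        using e by (intro mult_left_le) auto
      finally show "norm (\<integral>v. F (t, v) \<partial>lborel) \<le> M * (1 / (1 + t\<^sup>2))" using K[of t] by simp
    qed
    also have "\<dots> = M * pi" by (simp only: integral_mult_right_zero integral_inverse_1_plus_sq)
    finally show ?thesis .
  qed
  have "(\<lambda>n. \<integral>z. h (w + (1 / Suc n) * z) * (2 / (1 + z\<^sup>2)) \<partial>lborel) \<longlonglongrightarrow> (\<integral>z. h w * (2 / (1 + z\<^sup>2)) \<partial>lborel)"
  proof (rule integral_dominated_convergence[where w = "\<lambda>z. B * 2 * (1 / (1 + z\<^sup>2))"])
    show "integrable lborel (\<lambda>z. B * 2 * (1 / (1 + z\<^sup>2)))" by (intro integrable_mult_right integrable_inverse_1_plus_sq)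
    have "(\<lambda>n. h (w + (1 / Suc n) * z) * (2 / (1 + z\<^sup>2))) \<longlonglongrightarrow> h (w + 0 * z) * (2 / (1 + z\<^sup>2))" for z
    proof (intro tendsto_mult tendsto_const)
      have "(\<lambda>n. w + 1 / real (Suc n) * z) \<longlonglongrightarrow> w + 0 * z"
        by (intro tendsto_add tendsto_mult tendsto_const) real_asymp
      moreover have "isCont h (w + 0 * z)" using cont by (simp add: continuous_on_eq_continuous_at)
      ultimately show "(\<lambda>n. h (w + 1 / real (Suc n) * z)) \<longlonglongrightarrow> h (w + 0 * z)"
        by (rule isCont_tendsto_compose[rotated])
    qed
    thus "AE z in lborel. (\<lambda>n. h (w + (1 / Suc n) * z) * (2 / (1 + z\<^sup>2))) \<longlonglongrightarrow> h w * (2 / (1 + z\<^sup>2))" by simp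
    have "norm (h x * (2 / (1 + z\<^sup>2))) \<le> B * 2 * (1 / (1 + z\<^sup>2))" for x z
      using mult_right_mono[OF bdd[of x], of "2 / (1 + z\<^sup>2)"] by (simp add: abs_mult add_nonneg_nonneg)
    thus "AE z in lborel. norm (h (w + (1 / Suc n) * z) * (2 / (1 + z\<^sup>2))) \<le> B * 2 * (1 / (1 + z\<^sup>2))" for n by simp
  qed auto
  from tendsto_norm[OF this]
  have "norm (\<integral>z. h w * (2 / (1 + z\<^sup>2)) \<partial>lborel) \<le> M * pi"
    by (rule LIMSEQ_le_const2) (intro exI[of _ 0] allI impI main, auto)
  also have "(\<integral>z. h w * (2 / (1 + z\<^sup>2)) \<partial>lborel) = (\<integral>z. (h w * 2) * (1 / (1 + z\<^sup>2)) \<partial>lborel)" by simp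
  also have "\<dots> = h w * 2 * pi" by (simp only: integral_mult_right_zero integral_inverse_1_plus_sq)
  finally have "2 * \<bar>h w\<bar> * pi \<le> M * pi" by (simp add: abs_mult)
  thus ?thesis by simp
qed

section \<open>Laplace transforms on the half-plane\<close>

text \<open>Vanishing on the negative axis lets all transforms be integrals over the whole line, so that shifts and
convolutions carry no case distinctions.\<close>

definition laplace_class :: "(real \<Rightarrow> real) \<Rightarrow> bool" where
  "laplace_class f \<longleftrightarrow> (\<forall>v<0. f v = 0) \<and> (\<forall>\<sigma>>1. integrable lborel (\<lambda>v. f v * exp (- \<sigma> * v)))"

definition laplace :: "(real \<Rightarrow> real) \<Rightarrow> complex \<Rightarrow> complex" where
  "laplace f s = (\<integral>v. of_real (f v) * exp (- s * of_real v) \<partial>lborel)"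

lemma laplace_classD:
  assumes "laplace_class f"
  shows "v < 0 \<Longrightarrow> f v = 0" "\<sigma> > 1 \<Longrightarrow> integrable lborel (\<lambda>v. f v * exp (- \<sigma> * v))"
  using assms by (auto simp: laplace_class_def)

lemma laplace_class_measurable:
  assumes "laplace_class f"
  shows "f \<in> borel_measurable borel"
proof -
  have [measurable]: "(\<lambda>v. f v * exp (- 2 * v)) \<in> borel_measurable borel"
    using borel_measurable_integrable[OF laplace_classD(2)[OF assms, of 2]] by simp
  have "(\<lambda>v. f v * exp (- 2 * v) * exp (2 * v)) \<in> borel_measurable borel" by measurable
  also have "(\<lambda>v. f v * exp (- 2 * v) * exp (2 * v)) = f" by (simp add: mult_exp_exp mult.assoc)
  finally show ?thesis .
qed

lemma laplace_integrable:
  assumes "laplace_class f" "Re s > 1"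
  shows "integrable lborel (\<lambda>v. of_real (f v) * exp (- s * of_real v) :: complex)"
proof -
  note [measurable] = laplace_class_measurable[OF assms(1)]
  show ?thesis
    by (rule Bochner_Integration.integrable_bound[OF laplace_classD(2)[OF assms]])
       (auto simp: norm_mult abs_mult)
qed

lemma laplace_norm_bound:
  assumes "laplace_class f" "Re s > 1" "integrable lborel g" "\<And>v. \<bar>f v\<bar> * exp (- Re s * v) \<le> g v"
  shows "norm (laplace f s) \<le> (\<integral>v. g v \<partial>lborel)"
  unfolding laplace_def
  by (rule Bochner_Integration.integral_norm_bound_integral[OF laplace_integrable[OF assms(1,2)] assms(3)])
     (use assms(4) in \<open>simp add: norm_mult\<close>)

lemma laplace_class_dominated:
  assumes g: "\<And>\<sigma>. \<sigma> > 1 \<Longrightarrow> \<exists>g. integrable lborel g \<and> (\<forall>v\<ge>0. \<bar>f v\<bar> * exp (- \<sigma> * v) \<le> g v)"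
    and m: "f \<in> borel_measurable borel" and z: "\<And>v. v < 0 \<Longrightarrow> f v = 0"
  shows "laplace_class f"
  unfolding laplace_class_def
proof (intro conjI allI impI z)
  fix \<sigma> :: real assume "\<sigma> > 1"
  with g obtain g where g: "integrable lborel g" "\<And>v. v \<ge> 0 \<Longrightarrow> \<bar>f v\<bar> * exp (- \<sigma> * v) \<le> g v" by blast
  note [measurable] = m
  show "integrable lborel (\<lambda>v. f v * exp (- \<sigma> * v))"
  proof (rule Bochner_Integration.integrable_bound[OF g(1)])
    have "norm (f v * exp (- \<sigma> * v)) \<le> norm (g v)" for v
      using g(2)[of v] z[of v] by (cases "v \<ge> 0") (auto simp: abs_mult)
    thus "AE v in lborel. norm (f v * exp (- \<sigma> * v)) \<le> norm (g v)" by simp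
  qed measurable
qed

text \<open>One term of the exponential series already gives the bound.\<close>
lemma power_times_exp_bounded:
  assumes "\<delta> > 0"
  obtains C where "C \<ge> 0" "\<And>v::real. v \<ge> 0 \<Longrightarrow> v ^ n * exp (- \<delta> * v) \<le> C"
proof
  show "fact n / \<delta> ^ n \<ge> 0" using assms by simp
  fix v :: real assume v: "v \<ge> 0"
  have "(\<delta> * v) ^ n / fact n \<le> exp (\<delta> * v)"
    using sum_le_suminf[OF summable_exp_generic[of "\<delta> * v"], of "{n}"] assms v
    by (simp add: exp_def divide_inverse mult.commute)
  thus "v ^ n * exp (- \<delta> * v) \<le> fact n / \<delta> ^ n"
    using assms by (simp add: field_simps exp_minus)
qed

lemma laplace_class_power_times:
  assumes f: "laplace_class f"
  shows "laplace_class (\<lambda>v. v ^ n * f v)"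
proof (rule laplace_class_dominated)
  note [measurable] = laplace_class_measurable[OF f]
  show "(\<lambda>v. v ^ n * f v) \<in> borel_measurable borel" by measurable
  show "v ^ n * f v = 0" if "v < 0" for v using laplace_classD(1)[OF f that] by simp
  fix \<sigma> :: real assume s: "\<sigma> > 1"
  define \<delta> where "\<delta> = (\<sigma> - 1) / 2"
  have d: "\<delta> > 0" "\<sigma> - \<delta> > 1" using s by (auto simp: \<delta>_def field_simps)
  obtain C where C: "C \<ge> 0" "\<And>v::real. v \<ge> 0 \<Longrightarrow> v ^ n * exp (- \<delta> * v) \<le> C"
    using power_times_exp_bounded[OF d(1)] by blast
  have "\<bar>v ^ n * f v\<bar> * exp (- \<sigma> * v) \<le> C * \<bar>f v * exp (- (\<sigma> - \<delta>) * v)\<bar>" if v: "v \<ge> 0" for v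
  proof -
    have "exp (- \<sigma> * v) = exp (- \<delta> * v) * exp (- (\<sigma> - \<delta>) * v)"
      by (simp add: algebra_simps flip: exp_add)
    hence "\<bar>v ^ n * f v\<bar> * exp (- \<sigma> * v) = (v ^ n * exp (- \<delta> * v)) * \<bar>f v * exp (- (\<sigma> - \<delta>) * v)\<bar>"
      using v by (simp add: abs_mult mult_ac)
    also have "\<dots> \<le> C * \<bar>f v * exp (- (\<sigma> - \<delta>) * v)\<bar>"
      using C(2)[OF v] by (intro mult_right_mono) auto
    finally show ?thesis .
  qed
  moreover have "integrable lborel (\<lambda>v. C * \<bar>f v * exp (- (\<sigma> - \<delta>) * v)\<bar>)"
    using laplace_classD(2)[OF f d(2)] by (intro integrable_mult_right integrable_abs)
  ultimately show "\<exists>g. integrable lborel g \<and> (\<forall>v\<ge>0. \<bar>v ^ n * f v\<bar> * exp (- \<sigma> * v) \<le> g v)" by blast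
qed

lemma laplace_class_times_neg:
  assumes f: "laplace_class f"
  shows "laplace_class (\<lambda>v. (- v) ^ n * f v)"
proof -
  have eq: "(- v) ^ n * f v * exp (- \<sigma> * v) = (-1) ^ n * (v ^ n * f v * exp (- \<sigma> * v))" for v \<sigma> :: real
    by (subst power_minus) simp
  show ?thesis
    using laplace_class_power_times[OF f, of n]
    unfolding laplace_class_def eq by (auto intro!: integrable_mult_right)
qed

lemma norm_exp_minus_linear_le:
  fixes z :: complex
  shows "norm (exp z - 1 - z) \<le> norm z ^ 2 * exp (norm z)"
proof -
  have "norm (exp z - (\<Sum>i\<le>1. z ^ i / fact i)) \<le> exp \<bar>Re z\<bar> * (norm z ^ Suc 1) / fact 1"
    by (rule Taylor_exp)
  also have "\<dots> \<le> exp (norm z) * norm z ^ 2"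
    by (auto intro!: mult_right_mono abs_Re_le_cmod simp: numeral_2_eq_2)
  finally show ?thesis by (simp add: algebra_simps)
qed

text \<open>The second-order remainder of \<open>exp (- h v)\<close> is \<open>O(|h|\<^sup>2 v\<^sup>2 exp (|h| v))\<close>. For \<open>|h| < \<delta>\<close> the last factor is
absorbed by moving \<open>Re s\<close> to the left by \<open>\<delta>\<close>, which stays in the half-plane of convergence.\<close>
lemma laplace_has_field_derivative:
  assumes f: "laplace_class f" and s: "Re s > 1"
  shows "(laplace f has_field_derivative laplace (\<lambda>v. - v * f v) s) (at s)"
proof -
  define \<delta> where "\<delta> = (Re s - 1) / 2"
  have d: "\<delta> > 0" "Re s - \<delta> > 1" using s by (auto simp: \<delta>_def field_simps)
  have f1: "laplace_class (\<lambda>v. - v * f v)" using laplace_class_times_neg[OF f, of 1] by simp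
  have f2: "laplace_class (\<lambda>v. v ^ 2 * f v)" using laplace_class_power_times[OF f] .
  define K where "K = (\<integral>v. \<bar>v ^ 2 * f v * exp (- (Re s - \<delta>) * v)\<bar> \<partial>lborel)"
  have bound: "norm (laplace f (s + h) - laplace f s - h * laplace (\<lambda>v. - v * f v) s) \<le> norm h ^ 2 * K"
    if h: "norm h < \<delta>" for h
  proof -
    have "\<bar>Re h\<bar> \<le> norm h" by (rule abs_Re_le_cmod)
    hence sh: "Re (s + h) > 1" using h d by simp
    have "laplace f (s + h) - laplace f s - h * laplace (\<lambda>v. - v * f v) s =
       (\<integral>v. (of_real (f v) * exp (- (s + h) * of_real v) - of_real (f v) * exp (- s * of_real v))
            - h * (of_real (- v * f v) * exp (- s * of_real v)) \<partial>lborel)"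
      unfolding laplace_def
      using laplace_integrable[OF f sh] laplace_integrable[OF f s] laplace_integrable[OF f1 s]
      by (simp add: Bochner_Integration.integral_diff)
    also have "norm \<dots> \<le> (\<integral>v. norm h ^ 2 * \<bar>v ^ 2 * f v * exp (- (Re s - \<delta>) * v)\<bar> \<partial>lborel)"
    proof (rule Bochner_Integration.integral_norm_bound_integral)
      show "complex_integrable lborel (\<lambda>v. of_real (f v) * exp (- (s + h) * of_real v) - of_real (f v) * exp (- s * of_real v) - h * (of_real (- v * f v) * exp (- s * of_real v)))"
        using laplace_integrable[OF f sh] laplace_integrable[OF f s] laplace_integrable[OF f1 s]
        by (intro Bochner_Integration.integrable_diff integrable_mult_right)
      show "integrable lborel (\<lambda>v. norm h ^ 2 * \<bar>v ^ 2 * f v * exp (- (Re s - \<delta>) * v)\<bar>)"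
        using laplace_classD(2)[OF f2 d(2)] by (intro integrable_mult_right integrable_abs)
      fix v :: real
      show "norm (of_real (f v) * exp (- (s + h) * of_real v) - of_real (f v) * exp (- s * of_real v) - h * (of_real (- v * f v) * exp (- s * of_real v)))
            \<le> norm h ^ 2 * \<bar>v ^ 2 * f v * exp (- (Re s - \<delta>) * v)\<bar>"
      proof (cases "v \<ge> 0")
        case False
        thus ?thesis using laplace_classD(1)[OF f, of v] by simp
      next
        case True
        have "of_real (f v) * exp (- (s + h) * of_real v) - of_real (f v) * exp (- s * of_real v) - h * (of_real (- v * f v) * exp (- s * of_real v))
           = of_real (f v) * exp (- s * of_real v) * (exp (- h * of_real v) - 1 - (- h * of_real v))"
          by (simp add: algebra_simps exp_add exp_minus exp_diff divide_inverse)
        hence "norm (of_real (f v) * exp (- (s + h) * of_real v) - of_real (f v) * exp (- s * of_real v) - h * (of_real (- v * f v) * exp (- s * of_real v)))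
           = \<bar>f v\<bar> * exp (- Re s * v) * norm (exp (- h * of_real v) - 1 - (- h * of_real v))"
          by (simp add: norm_mult)
        also have "\<dots> \<le> \<bar>f v\<bar> * exp (- Re s * v) * (norm (- h * of_real v) ^ 2 * exp (norm (- h * of_real v)))"
          by (intro mult_left_mono norm_exp_minus_linear_le) auto
        also have "\<dots> = norm h ^ 2 * \<bar>v ^ 2 * f v\<bar> * exp (- Re s * v + norm h * v)"
          unfolding exp_add using True by (simp add: norm_mult abs_mult power_mult_distrib)
        also have "\<dots> \<le> norm h ^ 2 * \<bar>v ^ 2 * f v\<bar> * exp (- (Re s - \<delta>) * v)"
        proof -
          have "norm h * v \<le> \<delta> * v" using h True by (intro mult_right_mono) auto
          thus ?thesis by (intro mult_left_mono) (auto simp: algebra_simps)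
        qed
        finally show ?thesis by (simp add: abs_mult)
      qed
    qed
    finally show ?thesis by (simp add: K_def)
  qed
  have "K \<ge> 0" unfolding K_def by (rule integral_nonneg_AE) auto
  have "(\<lambda>h. (laplace f (s + h) - laplace f s) / h) \<midarrow>0\<rightarrow> laplace (\<lambda>v. - v * f v) s"
  proof (rule Lim_null[THEN iffD2])
    show "(\<lambda>h. (laplace f (s + h) - laplace f s) / h - laplace (\<lambda>v. - v * f v) s) \<midarrow>0\<rightarrow> 0"
    proof (rule Lim_null_comparison)
      have "eventually (\<lambda>h. h \<in> ball 0 \<delta> - {0}) (at (0::complex))"
        using d(1) by (intro eventually_at_in_open) auto
      thus "\<forall>\<^sub>F h in at 0. norm ((laplace f (s + h) - laplace f s) / h - laplace (\<lambda>v. - v * f v) s) \<le> norm h * K"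
      proof eventually_elim
        case (elim h)
        have "(laplace f (s + h) - laplace f s) / h - laplace (\<lambda>v. - v * f v) s =
              (laplace f (s + h) - laplace f s - h * laplace (\<lambda>v. - v * f v) s) / h"
          using elim by (simp add: field_simps)
        also have "norm \<dots> \<le> norm h ^ 2 * K / norm h"
          unfolding norm_divide using bound[of h] elim by (intro divide_right_mono) auto
        finally show ?case using elim by (simp add: power2_eq_square)
      qed
      show "((\<lambda>h. norm h * K) \<longlongrightarrow> 0) (at (0::complex))" by (auto intro!: tendsto_eq_intros)
    qed
  qed
  thus ?thesis by (simp add: DERIV_def)
qed

lemma laplace_holomorphic:
  assumes "laplace_class f" shows "laplace f holomorphic_on {s. Re s > 1}"
proof -
  have "open {s. Re s > 1}" by (rule open_halfspace_Re_gt)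
  thus ?thesis using laplace_has_field_derivative[OF assms] by (auto simp: holomorphic_on_open)
qed

lemma laplace_higher_deriv:
  assumes f: "laplace_class f" and s: "Re s > 1"
  shows "(deriv ^^ n) (laplace f) s = laplace (\<lambda>v. (- v) ^ n * f v) s"
  using s
proof (induction n arbitrary: s)
  case (Suc n)
  have op: "open {s. Re s > 1}" by (rule open_halfspace_Re_gt)
  have "(laplace (\<lambda>v. (- v) ^ n * f v) has_field_derivative laplace (\<lambda>v. - v * ((- v) ^ n * f v)) s) (at s)"
    by (rule laplace_has_field_derivative[OF laplace_class_times_neg[OF f] Suc.prems])
  hence "((deriv ^^ n) (laplace f) has_field_derivative laplace (\<lambda>v. - v * ((- v) ^ n * f v)) s) (at s)"
    by (rule has_field_derivative_transform_within_open[OF _ op]) (use Suc in auto)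
  from DERIV_imp_deriv[OF this] show ?case by (simp add: mult.assoc)
qed simp

lemma laplace_diff:
  assumes "laplace_class f" "laplace_class g" "Re s > 1"
  shows "laplace (\<lambda>v. f v - g v) s = laplace f s - laplace g s"
  using laplace_integrable[OF assms(1,3)] laplace_integrable[OF assms(2,3)]
  by (simp add: laplace_def algebra_simps flip: Bochner_Integration.integral_diff)

lemma laplace_class_diff:
  assumes "laplace_class f" "laplace_class g"
  shows "laplace_class (\<lambda>v. f v - g v)"
  using assms by (auto simp: laplace_class_def algebra_simps)

definition conv :: "(real \<Rightarrow> real) \<Rightarrow> (real \<Rightarrow> real) \<Rightarrow> real \<Rightarrow> real" where
  "conv f g w = (\<integral>v. f v * g (w - v) \<partial>lborel)"

lemma lborel_integrable_shift:
  fixes f :: "real \<Rightarrow> 'a :: {banach, second_countable_topology}"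
  shows "integrable lborel (\<lambda>x. f (x - c)) \<longleftrightarrow> integrable lborel f"
  using lborel_integrable_real_affine_iff[of 1 f "- c"] by simp

lemma lborel_integral_shift:
  fixes f :: "real \<Rightarrow> 'a :: {banach, second_countable_topology}"
  shows "(\<integral>x. f (x - c) \<partial>lborel) = (\<integral>x. f x \<partial>lborel)"
  using lborel_integral_real_affine[of 1 f "- c"] by simp

text \<open>Fubini for \<open>f v * g (w - v)\<close>, with the weight \<open>exp (- s w)\<close> split as \<open>exp (- s v) * exp (- s (w - v))\<close>.\<close>
lemma laplace_conv:
  assumes f: "laplace_class f" and g: "laplace_class g"
  shows "laplace_class (conv f g)"
    and "Re s > 1 \<Longrightarrow> laplace (conv f g) s = laplace f s * laplace g s"
proof -
  note [measurable] = laplace_class_measurable[OF f] laplace_class_measurable[OF g]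
  define F where "F = (\<lambda>s (v, w). (of_real (f v) * exp (- s * of_real v)) * (of_real (g (w - v)) * exp (- s * of_real (w - v))) :: complex)"
  have Fm[measurable]: "F s \<in> borel_measurable (lborel \<Otimes>\<^sub>M lborel)" for s
    unfolding F_def by measurable
  have Fi: "integrable (lborel \<Otimes>\<^sub>M lborel) (F s)" if s: "Re s > 1" for s
  proof (rule lborel_pair.Fubini_integrable)
    have i: "integrable lborel (\<lambda>w. of_real (g (w - v)) * exp (- s * of_real (w - v)) :: complex)" for v
      using laplace_integrable[OF g s] lborel_integrable_shift[of "\<lambda>v. of_real (g v) * exp (- s * of_real v) :: complex" v]
      by simp
    have eqn: "(\<lambda>x. \<integral>y. norm (F s (x, y)) \<partial>lborel) = (\<lambda>x. norm (of_real (f x) * exp (- s * of_real x)) * (\<integral>v. norm (of_real (g v) * exp (- s * of_real v)) \<partial>lborel))"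
      using lborel_integral_shift[of "\<lambda>v. norm (of_real (g v) * exp (- s * of_real v))"]
      by (simp add: F_def norm_mult)
    show "integrable lborel (\<lambda>x. \<integral>y. norm (F s (x, y)) \<partial>lborel)"
      unfolding eqn by (intro integrable_mult_left integrable_norm laplace_integrable f s)
    have "integrable lborel (\<lambda>y. F s (x, y))" for x
      unfolding F_def by (simp only: prod.case) (intro integrable_mult_right i)
    thus "AE x in lborel. integrable lborel (\<lambda>y. F s (x, y))" by simp
  qed (fact Fm)
  have eq: "(\<integral>v. F s (v, w) \<partial>lborel) = of_real (conv f g w) * exp (- s * of_real w)" for s w
  proof -
    have "(\<integral>v. F s (v, w) \<partial>lborel) = (\<integral>v. of_real (f v * g (w - v)) * exp (- s * of_real w) \<partial>lborel)"
      by (rule Bochner_Integration.integral_cong) (auto simp: F_def algebra_simps simp flip: exp_add)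
    also have "\<dots> = (\<integral>v. of_real (f v * g (w - v)) \<partial>lborel) * exp (- s * of_real w)"
      by (rule integral_mult_left_zero)
    also have "\<dots> = of_real (conv f g w) * exp (- s * of_real w)"
      unfolding conv_def by (simp only: integral_complex_of_real)
    finally show ?thesis .
  qed
  show "laplace_class (conv f g)"
    unfolding laplace_class_def
  proof (intro conjI allI impI)
    fix w :: real assume w: "w < 0"
    have "f v * g (w - v) = 0" for v
      using laplace_classD(1)[OF f, of v] laplace_classD(1)[OF g, of "w - v"] w by (cases "v < 0") auto
    hence "(\<lambda>v. f v * g (w - v)) = (\<lambda>_. 0)" by blast
    thus "conv f g w = 0" by (simp only: conv_def Bochner_Integration.integral_zero)
  next
    fix \<sigma> :: real assume "\<sigma> > 1"
    hence "integrable (lborel \<Otimes>\<^sub>M lborel) (F (of_real \<sigma>))" using Fi[of "of_real \<sigma>"] by simp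
    hence "integrable (lborel \<Otimes>\<^sub>M lborel) (case_prod (\<lambda>v w. F (of_real \<sigma>) (v, w)))" by simp
    from lborel_pair.integrable_snd[OF this]
    have "integrable lborel (\<lambda>w. of_real (conv f g w) * exp (- of_real \<sigma> * of_real w) :: complex)"
      using eq[of "of_real \<sigma>"] by simp
    hence "integrable lborel (\<lambda>w. of_real (conv f g w * exp (- \<sigma> * w)) :: complex)"
      by (simp add: exp_of_real[symmetric])
    thus "integrable lborel (\<lambda>w. conv f g w * exp (- \<sigma> * w))"
      using complex_of_real_integrable_eq by blast
  qed
  assume s: "Re s > 1"
  have "laplace (conv f g) s = (\<integral>w. (\<integral>v. F s (v, w) \<partial>lborel) \<partial>lborel)"
    by (simp add: laplace_def eq)
  also have "\<dots> = (\<integral>v. (\<integral>w. F s (v, w) \<partial>lborel) \<partial>lborel)"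
    using lborel_pair.Fubini_integral[of "\<lambda>v w. F s (v, w)"] Fi[OF s] by simp
  also have "\<dots> = (\<integral>v. of_real (f v) * exp (- s * of_real v) * laplace g s \<partial>lborel)"
    using lborel_integral_shift[of "\<lambda>v. of_real (g v) * exp (- s * of_real v)"]
    by (simp add: F_def laplace_def)
  also have "\<dots> = laplace f s * laplace g s" by (simp add: laplace_def)
  finally show "laplace (conv f g) s = laplace f s * laplace g s" .
qed

text \<open>The Cesaro weight \<open>(1 - u / x)\<^sup>m\<close> in the variable \<open>z = log (x / u)\<close>.\<close>
definition riesz_kernel :: "nat \<Rightarrow> real \<Rightarrow> real" where
  "riesz_kernel m z = (if z \<ge> 0 then (1 - exp (- z)) ^ m else 0)"

lemma riesz_kernel_measurable [measurable]: "riesz_kernel m \<in> borel_measurable borel"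
  unfolding riesz_kernel_def by measurable

lemma riesz_kernel_bounds: "0 \<le> riesz_kernel m z" "riesz_kernel m z \<le> 1"
  by (auto simp: riesz_kernel_def intro!: power_le_one)

lemma laplace_class_exp_bounded:
  assumes "f \<in> borel_measurable borel" "\<And>v. \<bar>f v\<bar> \<le> C * exp v" "\<And>v. v < 0 \<Longrightarrow> f v = 0"
  shows "laplace_class f"
proof (rule laplace_class_dominated)
  fix \<sigma> :: real assume s: "\<sigma> > 1"
  have "\<bar>f v\<bar> * exp (- \<sigma> * v) \<le> C * (indicator {0..} v * exp (- (\<sigma> - 1) * v))" if "v \<ge> 0" for v
  proof -
    have "\<bar>f v\<bar> * exp (- \<sigma> * v) \<le> C * exp v * exp (- \<sigma> * v)" using assms(2) by (intro mult_right_mono) auto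
    also have "\<dots> = C * exp (- (\<sigma> - 1) * v)" by (simp add: algebra_simps flip: exp_add)
    finally show ?thesis using that by simp
  qed
  moreover have "integrable lborel (\<lambda>v. C * (indicator {0..} v * exp (- (\<sigma> - 1) * v)))"
    by (intro integrable_mult_right integrable_exp_half_line) (use s in auto)
  ultimately show "\<exists>g. integrable lborel g \<and> (\<forall>v\<ge>0. \<bar>f v\<bar> * exp (- \<sigma> * v) \<le> g v)" by blast
qed (use assms in auto)

lemma laplace_class_riesz_kernel: "laplace_class (riesz_kernel m)"
proof (rule laplace_class_exp_bounded[where C = 1])
  show "\<bar>riesz_kernel m v\<bar> \<le> 1 * exp v" for v
  proof (cases "v \<ge> 0")
    case True
    have "\<bar>riesz_kernel m v\<bar> \<le> 1" using riesz_kernel_bounds[of m v] by auto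
    also have "\<dots> \<le> exp v" using True by simp
    finally show ?thesis by simp
  qed (auto simp: riesz_kernel_def)
qed (auto simp: riesz_kernel_def)

text \<open>Expanding one factor \<open>1 - exp (-z)\<close> expresses the transform for \<open>m + 1\<close> at \<open>s\<close> by those for \<open>m\<close> at \<open>s\<close> and
at \<open>s + 1\<close>; this is the recursion of a Beta integral.\<close>
lemma laplace_riesz_kernel:
  assumes "Re s > 1"
  shows "laplace (riesz_kernel m) s = fact m / pochhammer s (Suc m)"
  using assms
proof (induction m arbitrary: s)
  case 0
  have "laplace (riesz_kernel 0) s = (\<integral>x. indicator {0..} x *\<^sub>R exp (- s * complex_of_real x) \<partial>lborel)"
    unfolding laplace_def by (rule Bochner_Integration.integral_cong) (auto simp: riesz_kernel_def)
  thus ?case using integral_cexp_half_line[of s] 0 by (simp add: pochhammer_Suc)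
next
  case (Suc m)
  note i = laplace_integrable[OF laplace_class_riesz_kernel]
  have s1: "Re (s + 1) > 1" using Suc.prems by simp
  have nz: "s + of_nat k \<noteq> 0" for k
    using Suc.prems by (metis add_nonneg_nonneg complex_Re_of_nat less_le_not_le of_nat_0_le_iff order_less_imp_le plus_complex.simps(1) zero_complex.simps(1) zero_less_one order.strict_trans add_pos_nonneg less_irrefl)
  have "laplace (riesz_kernel (Suc m)) s = laplace (riesz_kernel m) s - laplace (riesz_kernel m) (s + 1)"
    unfolding laplace_def Bochner_Integration.integral_diff[OF i[OF Suc.prems] i[OF s1], symmetric]
  proof (rule Bochner_Integration.integral_cong[OF refl])
    fix v :: real
    have "exp (- (s + 1) * of_real v) = exp (- s * of_real v) * complex_of_real (exp (- v))"
      by (simp add: algebra_simps flip: exp_of_real exp_add)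
    thus "complex_of_real (riesz_kernel (Suc m) v) * exp (- s * of_real v) =
      of_real (riesz_kernel m v) * exp (- s * of_real v) - of_real (riesz_kernel m v) * exp (- (s + 1) * of_real v)"
      by (simp add: riesz_kernel_def algebra_simps)
  qed
  also have "\<dots> = fact m / pochhammer s (Suc m) - fact m / pochhammer (s + 1) (Suc m)"
    using Suc.IH[OF Suc.prems] Suc.IH[OF s1] by simp
  also have "pochhammer s (Suc m) = s * pochhammer (s + 1) m" by (simp add: pochhammer_rec)
  also have "pochhammer (s + 1) (Suc m) = pochhammer (s + 1) m * (s + of_nat (Suc m))"
    by (simp add: pochhammer_Suc algebra_simps)
  also have "fact m / (s * pochhammer (s + 1) m) - fact m / (pochhammer (s + 1) m * (s + of_nat (Suc m)))
     = fact (Suc m) / (s * pochhammer (s + 1) m * (s + of_nat (Suc m)))"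
  proof -
    have "pochhammer (s + 1) m \<noteq> 0"
      using nz[of "Suc _"] by (auto simp: pochhammer_eq_0_iff eq_neg_iff_add_eq_0 algebra_simps)
    thus ?thesis using nz[of 0] nz[of "Suc m"] by (simp add: divide_simps) (simp add: algebra_simps)
  qed
  also have "s * pochhammer (s + 1) m * (s + of_nat (Suc m)) = pochhammer s (Suc (Suc m))"
    by (simp only: pochhammer_rec[of s "Suc m"] pochhammer_Suc[of "s + 1" m]) (simp add: algebra_simps)
  finally show ?case .
qed

section \<open>Tempered functions: polynomial growth of all derivatives\<close>

definition poly_bound :: "real \<Rightarrow> (complex \<Rightarrow> complex) \<Rightarrow> bool" where
  "poly_bound \<beta> f \<longleftrightarrow> (\<exists>C. \<forall>s. Re s > 1 \<longrightarrow> norm (f s) \<le> C * (1 + norm s) powr \<beta>)"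

text \<open>The intermediate notion with one common exponent for the first \<open>n\<close> derivatives exists because its
exponents add under products. This quantifies the decay gained from dividing by a Pochhammer symbol.\<close>
definition deriv_bound :: "nat \<Rightarrow> real \<Rightarrow> (complex \<Rightarrow> complex) \<Rightarrow> bool" where
  "deriv_bound n \<beta> f \<longleftrightarrow> f holomorphic_on {s. Re s > 1} \<and> (\<forall>k\<le>n. poly_bound \<beta> ((deriv ^^ k) f))"

definition tempered :: "(complex \<Rightarrow> complex) \<Rightarrow> bool" where
  "tempered f \<longleftrightarrow> (\<forall>n. \<exists>\<beta>. deriv_bound n \<beta> f)"

lemma open_rhp: "open {s::complex. Re s > 1}"
  by (rule open_halfspace_Re_gt)

lemma poly_boundI:
  "(\<And>s. Re s > 1 \<Longrightarrow> norm (f s) \<le> C * (1 + norm s) powr \<beta>) \<Longrightarrow> poly_bound \<beta> f"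
  by (auto simp: poly_bound_def)

lemma poly_boundE:
  assumes "poly_bound \<beta> f"
  obtains C where "C > 0" "\<And>s. Re s > 1 \<Longrightarrow> norm (f s) \<le> C * (1 + norm s) powr \<beta>"
proof -
  from assms obtain C where C: "\<And>s. Re s > 1 \<Longrightarrow> norm (f s) \<le> C * (1 + norm s) powr \<beta>"
    by (auto simp: poly_bound_def)
  have "norm (f s) \<le> (\<bar>C\<bar> + 1) * (1 + norm s) powr \<beta>" if "Re s > 1" for s
    using C[OF that] by (rule order_trans) (auto intro!: mult_right_mono)
  thus ?thesis using that[of "\<bar>C\<bar> + 1"] by auto
qed

lemma poly_bound_cong:
  "(\<And>s. Re s > 1 \<Longrightarrow> f s = g s) \<Longrightarrow> poly_bound \<beta> f \<longleftrightarrow> poly_bound \<beta> g"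
  by (simp add: poly_bound_def)

lemma poly_bound_mono:
  assumes "poly_bound \<beta> f" "\<beta> \<le> \<gamma>" shows "poly_bound \<gamma> f"
proof -
  obtain C where C: "C > 0" "\<And>s. Re s > 1 \<Longrightarrow> norm (f s) \<le> C * (1 + norm s) powr \<beta>"
    using poly_boundE[OF assms(1)] by blast
  show ?thesis
  proof (rule poly_boundI)
    fix s :: complex assume "Re s > 1"
    have "norm (f s) \<le> C * (1 + norm s) powr \<beta>" using C \<open>Re s > 1\<close> by blast
    also have "\<dots> \<le> C * (1 + norm s) powr \<gamma>"
      using C(1) assms(2) by (intro mult_left_mono powr_mono) auto
    finally show "norm (f s) \<le> C * (1 + norm s) powr \<gamma>" .
  qed
qed

lemma poly_bound_add:
  assumes "poly_bound \<beta> f" "poly_bound \<beta> g" shows "poly_bound \<beta> (\<lambda>s. f s + g s)"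
proof -
  obtain C where C: "\<And>s. Re s > 1 \<Longrightarrow> norm (f s) \<le> C * (1 + norm s) powr \<beta>"
    using poly_boundE[OF assms(1)] by blast
  obtain D where D: "\<And>s. Re s > 1 \<Longrightarrow> norm (g s) \<le> D * (1 + norm s) powr \<beta>"
    using poly_boundE[OF assms(2)] by blast
  show ?thesis
    by (rule poly_boundI[where C = "C + D"])
       (use C D in \<open>auto intro!: norm_triangle_le add_mono simp: distrib_right\<close>)
qed

lemma poly_bound_mult:
  assumes "poly_bound \<beta> f" "poly_bound \<gamma> g" shows "poly_bound (\<beta> + \<gamma>) (\<lambda>s. f s * g s)"
proof -
  obtain C where C: "C > 0" "\<And>s. Re s > 1 \<Longrightarrow> norm (f s) \<le> C * (1 + norm s) powr \<beta>"
    using poly_boundE[OF assms(1)] by blast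
  obtain D where D: "D > 0" "\<And>s. Re s > 1 \<Longrightarrow> norm (g s) \<le> D * (1 + norm s) powr \<gamma>"
    using poly_boundE[OF assms(2)] by blast
  show ?thesis
  proof (rule poly_boundI[where C = "C * D"])
    fix s :: complex assume s: "Re s > 1"
    have "norm (f s * g s) \<le> (C * (1 + norm s) powr \<beta>) * (D * (1 + norm s) powr \<gamma>)"
      unfolding norm_mult using C D s by (intro mult_mono) auto
    also have "\<dots> = C * D * (1 + norm s) powr (\<beta> + \<gamma>)" by (simp add: powr_add)
    finally show "norm (f s * g s) \<le> C * D * (1 + norm s) powr (\<beta> + \<gamma>)" .
  qed
qed

lemma poly_bound_const: "poly_bound 0 (\<lambda>_. c)"
proof (rule poly_boundI[where C = "norm c"])
  fix s :: complex
  have "1 + norm s > 0" using norm_ge_zero[of s] by linarith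
  thus "norm c \<le> norm c * (1 + norm s) powr 0" by simp
qed

lemma deriv_bound_0: "deriv_bound 0 \<beta> f \<longleftrightarrow> f holomorphic_on {s. Re s > 1} \<and> poly_bound \<beta> f"
  by (simp add: deriv_bound_def)

text \<open>The recursive form: closure properties follow from it by induction on \<open>n\<close>, without a Leibniz formula for
higher derivatives.\<close>
lemma deriv_bound_Suc:
  "deriv_bound (Suc n) \<beta> f \<longleftrightarrow> f holomorphic_on {s. Re s > 1} \<and> poly_bound \<beta> f \<and> deriv_bound n \<beta> (deriv f)"
proof -
  have *: "(deriv ^^ k) (deriv f) = (deriv ^^ Suc k) f" for k
    by (metis funpow_swap1 funpow.simps(2) comp_apply)
  have "(\<forall>k\<le>Suc n. poly_bound \<beta> ((deriv ^^ k) f)) \<longleftrightarrow> poly_bound \<beta> f \<and> (\<forall>k\<le>n. poly_bound \<beta> ((deriv ^^ Suc k) f))"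
    by (metis Suc_le_mono bot_nat_0.extremum funpow_0 not0_implies_Suc)
  thus ?thesis
    unfolding deriv_bound_def * using holomorphic_deriv[OF _ open_rhp, of f] by auto
qed

lemma deriv_bound_holomorphic: "deriv_bound n \<beta> f \<Longrightarrow> f holomorphic_on {s. Re s > 1}"
  by (simp add: deriv_bound_def)

lemma deriv_bound_poly_bound: "deriv_bound n \<beta> f \<Longrightarrow> k \<le> n \<Longrightarrow> poly_bound \<beta> ((deriv ^^ k) f)"
  by (simp add: deriv_bound_def)

lemma deriv_bound_le: "deriv_bound n \<beta> f \<Longrightarrow> m \<le> n \<Longrightarrow> deriv_bound m \<beta> f"
  by (simp add: deriv_bound_def)

lemma deriv_bound_mono: "deriv_bound n \<beta> f \<Longrightarrow> \<beta> \<le> \<gamma> \<Longrightarrow> deriv_bound n \<gamma> f"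
  by (auto simp: deriv_bound_def intro: poly_bound_mono)

lemma deriv_bound_cong:
  assumes "deriv_bound n \<beta> f" "\<And>s. Re s > 1 \<Longrightarrow> f s = g s"
  shows "deriv_bound n \<beta> g"
proof -
  have g: "g holomorphic_on {s. Re s > 1}"
    by (rule holomorphic_transform[OF deriv_bound_holomorphic[OF assms(1)]]) (use assms in auto)
  have "(deriv ^^ k) f s = (deriv ^^ k) g s" if "Re s > 1" for k s
    by (rule higher_deriv_transform_within_open[OF deriv_bound_holomorphic[OF assms(1)] g open_rhp])
       (use assms that in auto)
  hence "poly_bound \<beta> ((deriv ^^ k) f) \<longleftrightarrow> poly_bound \<beta> ((deriv ^^ k) g)" for k
    by (intro poly_bound_cong)
  thus ?thesis using assms(1) g by (simp add: deriv_bound_def)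
qed

lemma holomorphic_differentiable_rhp:
  "f holomorphic_on {s. Re s > 1} \<Longrightarrow> Re s > 1 \<Longrightarrow> f field_differentiable at s"
  using holomorphic_on_imp_differentiable_at[OF _ open_rhp, of f s] by simp

lemma deriv_bound_add:
  assumes "deriv_bound n \<beta> f" "deriv_bound n \<beta> g"
  shows "deriv_bound n \<beta> (\<lambda>s. f s + g s)"
  using assms
proof (induction n arbitrary: f g)
  case 0
  thus ?case by (auto simp: deriv_bound_0 intro!: poly_bound_add holomorphic_intros)
next
  case (Suc n)
  note d = holomorphic_differentiable_rhp
  have "deriv_bound n \<beta> (\<lambda>s. deriv f s + deriv g s)"
    using Suc by (auto simp: deriv_bound_Suc)
  hence "deriv_bound n \<beta> (deriv (\<lambda>s. f s + g s))"
    by (rule deriv_bound_cong) (use Suc.prems d in \<open>auto simp: deriv_bound_Suc\<close>)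
  thus ?case using Suc.prems by (auto simp: deriv_bound_Suc intro!: poly_bound_add holomorphic_intros)
qed

lemma deriv_bound_mult:
  assumes "deriv_bound n \<beta> f" "deriv_bound n \<gamma> g"
  shows "deriv_bound n (\<beta> + \<gamma>) (\<lambda>s. f s * g s)"
  using assms
proof (induction n arbitrary: f g)
  case 0
  thus ?case by (auto simp: deriv_bound_0 intro!: poly_bound_mult holomorphic_intros)
next
  case (Suc n)
  note d = holomorphic_differentiable_rhp
  have le: "deriv_bound n \<beta> f" "deriv_bound n \<gamma> g"
    using Suc.prems by (auto intro: deriv_bound_le)
  have "deriv_bound n (\<beta> + \<gamma>) (\<lambda>s. f s * deriv g s + deriv f s * g s)"
    using Suc.prems le by (intro deriv_bound_add Suc.IH) (auto simp: deriv_bound_Suc)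
  hence "deriv_bound n (\<beta> + \<gamma>) (deriv (\<lambda>s. f s * g s))"
    by (rule deriv_bound_cong) (use Suc.prems d in \<open>auto simp: deriv_bound_Suc\<close>)
  thus ?case using Suc.prems by (auto simp: deriv_bound_Suc intro!: poly_bound_mult holomorphic_intros)
qed

lemma deriv_bound_const: "deriv_bound n 0 (\<lambda>_. c)"
proof (induction n arbitrary: c)
  case (Suc n)
  have "deriv (\<lambda>_. c) = (\<lambda>_. 0 :: complex)" by auto
  thus ?case using Suc by (auto simp: deriv_bound_Suc intro: poly_bound_const)
qed (auto simp: deriv_bound_0 intro: poly_bound_const)

lemma deriv_bound_linear: "deriv_bound n 1 (\<lambda>s. s + c)"
proof -
  have p: "poly_bound 1 (\<lambda>s. s + c)"
  proof (rule poly_boundI[where C = "1 + norm c"])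
    fix s :: complex
    have "norm (s + c) \<le> norm s + norm c" by (rule norm_triangle_ineq)
    also have "\<dots> \<le> (1 + norm c) * (1 + norm s)" by (simp add: algebra_simps)
    finally show "norm (s + c) \<le> (1 + norm c) * (1 + norm s) powr 1" by simp
  qed
  have "deriv (\<lambda>s. s + c) = (\<lambda>_. 1)" by (auto simp: fun_eq_iff)
  hence "deriv_bound m 1 (deriv (\<lambda>s. s + c))" for m
    using deriv_bound_mono[OF deriv_bound_const, of 1 m 1] by simp
  thus ?thesis using p by (cases n) (auto simp: deriv_bound_0 deriv_bound_Suc intro!: holomorphic_intros)
qed

text \<open>The derivative of \<open>f = 1 / (s + k)\<close> is \<open>- f * f\<close>, so the bound for \<open>n\<close> derivatives gives the bound for one
more.\<close>
lemma deriv_bound_reciprocal: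
  "deriv_bound n (-1) (\<lambda>s. 1 / (s + of_nat k))"
proof (induction n)
  have nz: "s + of_nat k \<noteq> 0" if "Re s > 1" for s
    using that by (auto simp: complex_eq_iff)
  have hol: "(\<lambda>s. 1 / (s + of_nat k)) holomorphic_on {s. Re s > 1}"
    using nz by (auto intro!: holomorphic_intros)
  have p: "poly_bound (-1) (\<lambda>s. 1 / (s + of_nat k))"
  proof (rule poly_boundI[where C = 2])
    fix s :: complex assume s: "Re s > 1"
    have "norm s \<le> norm (s + of_nat k)"
      unfolding cmod_def using s by (auto intro!: power_mono)
    moreover have "1 \<le> norm s" using complex_Re_le_cmod[of s] s by linarith
    ultimately have "1 + norm s \<le> 2 * norm (s + of_nat k)" by simp
    moreover have "0 < 1 + norm s" using norm_ge_zero[of s] by linarith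
    ultimately show "norm (1 / (s + of_nat k)) \<le> 2 * (1 + norm s) powr (- 1)"
      using nz[OF s] by (simp add: norm_divide powr_minus field_simps)
  qed
  show "deriv_bound 0 (-1) (\<lambda>s. 1 / (s + of_nat k))" using hol p by (simp add: deriv_bound_0)
  fix n assume IH: "deriv_bound n (-1) (\<lambda>s. 1 / (s + of_nat k))"
  have "deriv_bound n (-1) (\<lambda>s. (-1) * ((1 / (s + of_nat k)) * (1 / (s + of_nat k))))"
    using deriv_bound_mult[OF deriv_bound_const[of n "-1"] deriv_bound_mult[OF IH IH]]
    by (rule deriv_bound_mono) auto
  moreover have "(-1) * ((1 / (s + of_nat k)) * (1 / (s + of_nat k))) = deriv (\<lambda>s. 1 / (s + of_nat k)) s"
    if "Re s > 1" for s
    by (rule DERIV_imp_deriv[symmetric]) (auto intro!: derivative_eq_intros simp: nz[OF that] power2_eq_square divide_simps)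
  ultimately have "deriv_bound n (-1) (deriv (\<lambda>s. 1 / (s + of_nat k)))"
    by (rule deriv_bound_cong)
  thus "deriv_bound (Suc n) (-1) (\<lambda>s. 1 / (s + of_nat k))" using hol p by (simp add: deriv_bound_Suc)
qed

lemma deriv_bound_power:
  assumes "deriv_bound n \<beta> f"
  shows "deriv_bound n (real k * \<beta>) (\<lambda>s. f s ^ k)"
proof (induction k)
  case (Suc k)
  have "deriv_bound n (\<beta> + real k * \<beta>) (\<lambda>s. f s * f s ^ k)"
    by (rule deriv_bound_mult[OF assms Suc])
  thus ?case by (simp add: algebra_simps)
qed (simp add: deriv_bound_const)

lemma deriv_bound_pochhammer: "deriv_bound n (real m) (\<lambda>s. pochhammer s m)"
proof (induction m)
  case (Suc m)
  show ?case using deriv_bound_mult[OF Suc deriv_bound_linear[of n "of_nat m"]]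
    by (simp add: pochhammer_Suc add.commute)
qed (simp add: deriv_bound_const)

lemma deriv_bound_inverse_pochhammer: "deriv_bound n (- real m) (\<lambda>s. 1 / pochhammer s m)"
proof (induction m)
  case (Suc m)
  show ?case using deriv_bound_mult[OF Suc deriv_bound_reciprocal[of n m]]
    by (simp add: pochhammer_Suc add.commute)
qed (simp add: deriv_bound_const)

lemma tempered_holomorphic: "tempered f \<Longrightarrow> f holomorphic_on {s. Re s > 1}"
  by (auto simp: tempered_def deriv_bound_def)

lemma temperedI:
  assumes hol: "f holomorphic_on {s. Re s > 1}" and b: "\<And>n. \<exists>\<beta>. poly_bound \<beta> ((deriv ^^ n) f)"
  shows "tempered f"
proof -
  from b obtain \<beta> where \<beta>: "\<And>n. poly_bound (\<beta> n) ((deriv ^^ n) f)" by metis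
  have "deriv_bound n (Max (\<beta> ` {..n})) f" for n
    using hol unfolding deriv_bound_def by (auto intro!: poly_bound_mono[OF \<beta>])
  thus ?thesis by (auto simp: tempered_def)
qed

lemma tempered_cong:
  "tempered f \<Longrightarrow> (\<And>s. Re s > 1 \<Longrightarrow> f s = g s) \<Longrightarrow> tempered g"
  unfolding tempered_def using deriv_bound_cong by blast

lemma tempered_const: "tempered (\<lambda>_. c)"
  unfolding tempered_def using deriv_bound_const by blast

lemma tempered_linear: "tempered (\<lambda>s. s + c)"
  unfolding tempered_def using deriv_bound_linear by blast

lemma tempered_reciprocal: "tempered (\<lambda>s. 1 / s)"
  unfolding tempered_def using deriv_bound_reciprocal[of _ 0] by auto

lemma tempered_mult: "tempered f \<Longrightarrow> tempered g \<Longrightarrow> tempered (\<lambda>s. f s * g s)"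
  unfolding tempered_def using deriv_bound_mult by blast

lemma tempered_add:
  assumes "tempered f" "tempered g" shows "tempered (\<lambda>s. f s + g s)"
  unfolding tempered_def
proof
  fix n
  obtain \<beta> \<gamma> where "deriv_bound n \<beta> f" "deriv_bound n \<gamma> g"
    using assms unfolding tempered_def by blast
  hence "deriv_bound n (max \<beta> \<gamma>) f" "deriv_bound n (max \<beta> \<gamma>) g"
    by (auto elim: deriv_bound_mono)
  thus "\<exists>\<beta>. deriv_bound n \<beta> (\<lambda>s. f s + g s)" using deriv_bound_add by blast
qed

lemma tempered_deriv: "tempered f \<Longrightarrow> tempered (deriv f)"
  unfolding tempered_def using deriv_bound_Suc by blast

lemma deriv_bound_SucI:
  assumes "f holomorphic_on {s. Re s > 1}" "poly_bound \<beta> f" "deriv_bound n \<gamma> f'"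
    "\<And>s. Re s > 1 \<Longrightarrow> f' s = deriv f s"
  shows "\<exists>\<delta>. deriv_bound (Suc n) \<delta> f"
proof -
  have "deriv_bound n \<gamma> (deriv f)" by (rule deriv_bound_cong[OF assms(3,4)])
  hence "deriv_bound (Suc n) (max \<beta> \<gamma>) f"
    using assms(1) poly_bound_mono[OF assms(2), of "max \<beta> \<gamma>"] deriv_bound_mono[of n \<gamma> "deriv f" "max \<beta> \<gamma>"]
    by (simp add: deriv_bound_Suc)
  thus ?thesis by blast
qed

lemma tempered_of_deriv:
  assumes "f holomorphic_on {s. Re s > 1}" "poly_bound \<beta> f" "tempered (deriv f)"
  shows "tempered f"
  unfolding tempered_def
proof
  fix n
  obtain \<gamma> where "deriv_bound n \<gamma> (deriv f)" using assms(3) by (auto simp: tempered_def)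
  from deriv_bound_SucI[OF assms(1,2) this] obtain \<delta> where "deriv_bound (Suc n) \<delta> f" by auto
  thus "\<exists>\<beta>. deriv_bound n \<beta> f" using deriv_bound_le by (meson le_SucI order_refl)
qed

text \<open>A polynomial bound for \<open>exp J\<close> itself does not follow from one for \<open>J\<close> and must be supplied; the
derivatives then follow by induction from \<open>(exp J)' = J' exp J\<close>.\<close>
lemma tempered_exp:
  assumes "tempered J" "poly_bound \<beta> (\<lambda>s. exp (J s))"
  shows "tempered (\<lambda>s. exp (J s))"
  unfolding tempered_def
proof
  have hol: "(\<lambda>s. exp (J s)) holomorphic_on {s. Re s > 1}"
    using tempered_holomorphic[OF assms(1)] by (auto intro!: holomorphic_intros)
  fix n
  show "\<exists>\<beta>. deriv_bound n \<beta> (\<lambda>s. exp (J s))"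
  proof (induction n)
    case (Suc n)
    then obtain \<gamma> where "deriv_bound n \<gamma> (\<lambda>s. exp (J s))" by blast
    moreover obtain \<delta> where "deriv_bound n \<delta> (deriv J)"
      using tempered_deriv[OF assms(1)] by (auto simp: tempered_def)
    ultimately have d: "deriv_bound n (\<gamma> + \<delta>) (\<lambda>s. exp (J s) * deriv J s)" by (rule deriv_bound_mult)
    show ?case
    proof (rule deriv_bound_SucI[OF hol assms(2) d])
      fix s :: complex assume "Re s > 1"
      hence "(J has_field_derivative deriv J s) (at s)"
        using holomorphic_derivI[OF tempered_holomorphic[OF assms(1)] open_rhp] by auto
      thus "exp (J s) * deriv J s = deriv (\<lambda>s. exp (J s)) s"
        by (intro DERIV_imp_deriv[symmetric] DERIV_chain2[OF DERIV_exp])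
    qed
  qed (use hol assms(2) in \<open>auto simp: deriv_bound_0\<close>)
qed

text \<open>As for the exponential function, with \<open>(1 / Z)' = - Z' (1 / Z)\<^sup>2\<close>.\<close>
lemma tempered_inverse:
  assumes "tempered Z" "poly_bound \<beta> (\<lambda>s. 1 / Z s)" "\<And>s. Re s > 1 \<Longrightarrow> Z s \<noteq> 0"
  shows "tempered (\<lambda>s. 1 / Z s)"
  unfolding tempered_def
proof
  have hol: "(\<lambda>s. 1 / Z s) holomorphic_on {s. Re s > 1}"
    using tempered_holomorphic[OF assms(1)] assms(3) by (auto intro!: holomorphic_intros)
  fix n
  show "\<exists>\<beta>. deriv_bound n \<beta> (\<lambda>s. 1 / Z s)"
  proof (induction n)
    case (Suc n)
    then obtain \<gamma> where g: "deriv_bound n \<gamma> (\<lambda>s. 1 / Z s)" by blast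
    obtain \<delta> where "deriv_bound n \<delta> (deriv Z)"
      using tempered_deriv[OF assms(1)] by (auto simp: tempered_def)
    from deriv_bound_mult[OF deriv_bound_const[of n "-1"] deriv_bound_mult[OF this deriv_bound_mult[OF g g]]]
    have d: "deriv_bound n (0 + (\<delta> + (\<gamma> + \<gamma>))) (\<lambda>s. (-1) * (deriv Z s * (1 / Z s * (1 / Z s))))" .
    show ?case
    proof (rule deriv_bound_SucI[OF hol assms(2) d])
      fix s :: complex assume s: "Re s > 1"
      hence "(Z has_field_derivative deriv Z s) (at s)"
        using holomorphic_derivI[OF tempered_holomorphic[OF assms(1)] open_rhp] by auto
      thus "(-1) * (deriv Z s * (1 / Z s * (1 / Z s))) = deriv (\<lambda>s. 1 / Z s) s"
        by (intro DERIV_imp_deriv[symmetric]) (auto intro!: derivative_eq_intros simp: assms(3)[OF s] field_simps)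
    qed
  qed (use hol assms(2) in \<open>auto simp: deriv_bound_0\<close>)
qed

lemma tempered_iff:
  "tempered f \<longleftrightarrow> f holomorphic_on {s. Re s > 1} \<and> (\<exists>\<beta>::nat \<Rightarrow> real. (\<forall>n. \<beta> n > 0) \<and>
             (\<forall>n. \<exists>C::real. \<forall>s. Re s > 1 \<longrightarrow> norm ((deriv ^^ n) f s) \<le> C * (1 + norm s) powr \<beta> n))"
proof (intro iffI conjI)
  assume t: "tempered f"
  have "\<exists>\<beta>>0. poly_bound \<beta> ((deriv ^^ n) f)" for n
  proof -
    obtain \<beta> where "deriv_bound n \<beta> f" using t by (auto simp: tempered_def)
    hence "poly_bound (max 1 \<beta>) ((deriv ^^ n) f)" by (auto intro: poly_bound_mono deriv_bound_poly_bound)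
    thus ?thesis by (intro exI[of _ "max 1 \<beta>"]) auto
  qed
  then obtain \<beta> where "\<And>n. \<beta> n > 0" "\<And>n. poly_bound (\<beta> n) ((deriv ^^ n) f)" by metis
  thus "\<exists>\<beta>::nat \<Rightarrow> real. (\<forall>n. \<beta> n > 0) \<and>
             (\<forall>n. \<exists>C::real. \<forall>s. Re s > 1 \<longrightarrow> norm ((deriv ^^ n) f s) \<le> C * (1 + norm s) powr \<beta> n)"
    by (auto simp: poly_bound_def)
next
  assume *: "f holomorphic_on {s. Re s > 1} \<and> (\<exists>\<beta>::nat \<Rightarrow> real. (\<forall>n. \<beta> n > 0) \<and>
             (\<forall>n. \<exists>C::real. \<forall>s. Re s > 1 \<longrightarrow> norm ((deriv ^^ n) f s) \<le> C * (1 + norm s) powr \<beta> n))"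
  show "tempered f"
    by (rule temperedI) (use * in blast, use * in \<open>unfold poly_bound_def, blast\<close>)
qed (rule tempered_holomorphic)

lemma poly_bound_nonneg_exponentE:
  assumes "poly_bound \<beta> f"
  obtains C \<gamma> where "C > 0" "\<gamma> \<ge> 0" "\<And>s. Re s > 1 \<Longrightarrow> norm (f s) \<le> C * (1 + norm s) powr \<gamma>"
  using poly_boundE[OF poly_bound_mono[OF assms, of "max 0 \<beta>"]] by (metis max.cobounded1 max.cobounded2)

lemma tempered_derivE:
  assumes "tempered f"
  obtains C \<gamma> where "C > 0" "\<gamma> \<ge> 0" "\<And>s. Re s > 1 \<Longrightarrow> norm ((deriv ^^ n) f s) \<le> C * (1 + norm s) powr \<gamma>"
proof -
  obtain \<beta> where "deriv_bound n \<beta> f" using assms by (auto simp: tempered_def)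
  from poly_bound_nonneg_exponentE[OF deriv_bound_poly_bound[OF this order_refl]] that show ?thesis by blast
qed

lemma tempered_higher_deriv: "tempered f \<Longrightarrow> tempered ((deriv ^^ n) f)"
  by (induction n) (auto intro: tempered_deriv)

text \<open>Mean value inequality on the segment from \<open>1\<close> to \<open>s\<close>. The point \<open>1\<close> lies on the boundary of the domain,
so it is approached by points of the segment.\<close>
lemma rhp_mean_value_from_1:
  fixes r r' :: "complex \<Rightarrow> complex"
  assumes d: "\<And>s. Re s > 1 \<Longrightarrow> (r has_field_derivative r' s) (at s)"
    and lim: "(r \<longlongrightarrow> 0) (at 1 within {s. Re s > 1})"
    and s: "Re s > 1"
    and B: "\<And>\<theta>. 0 < \<theta> \<Longrightarrow> \<theta> \<le> 1 \<Longrightarrow> norm (r' (1 + of_real \<theta> * (s - 1))) \<le> B"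
  shows "norm (r s) \<le> B * norm (s - 1)"
proof -
  have re: "Re (1 + of_real \<theta> * (s - 1)) > 1" if "0 < \<theta>" for \<theta>
    using that s by simp
  define x where "x = (\<lambda>n. 1 + complex_of_real (1 / real (Suc (Suc n))) * (s - 1))"
  have x1: "x \<longlonglongrightarrow> 1"
  proof -
    have "(\<lambda>n. 1 / real (Suc (Suc n))) \<longlonglongrightarrow> 0" by real_asymp
    hence "(\<lambda>n. 1 + complex_of_real (1 / real (Suc (Suc n))) * (s - 1)) \<longlonglongrightarrow> 1 + of_real 0 * (s - 1)"
      by (intro tendsto_intros)
    thus ?thesis by (simp add: x_def)
  qed
  have rx: "(\<lambda>n. r (x n)) \<longlonglongrightarrow> 0"
  proof (rule filterlim_compose[OF lim])
    have "Re (x n) > 1" for n unfolding x_def by (rule re) simp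
    moreover from this have "x n \<noteq> 1" for n by (metis less_irrefl one_complex.simps(1))
    ultimately show "filterlim x (at 1 within {s. Re s > 1}) sequentially"
      using x1 by (auto simp: filterlim_at)
  qed
  have "norm (r s - r (x n)) \<le> B * norm (s - x n)" for n
  proof (rule field_differentiable_bound[where S = "closed_segment (x n) s" and f' = r'])
    fix z assume "z \<in> closed_segment (x n) s"
    then obtain u where u: "0 \<le> u" "u \<le> 1" "z = (1 - u) *\<^sub>R x n + u *\<^sub>R s" by (auto simp: in_segment)
    define c where "c = 1 / real (Suc (Suc n))"
    have c: "0 < c" "c \<le> 1" by (auto simp: c_def)
    define \<theta> where "\<theta> = (1 - u) * c + u"
    have z: "z = 1 + of_real \<theta> * (s - 1)"
      unfolding u(3) x_def \<theta>_def c_def[symmetric] by (simp add: scaleR_conv_of_real algebra_simps)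
    have th: "\<theta> > 0"
    proof (cases "u = 0")
      case False
      have "(1 - u) * c \<ge> 0" using u c by simp
      thus ?thesis using False u(1) by (simp add: \<theta>_def)
    qed (use c in \<open>simp add: \<theta>_def\<close>)
    have "(1 - u) * c \<le> 1 - u" using u c by (intro mult_left_le) auto
    hence th1: "\<theta> \<le> 1" by (simp add: \<theta>_def)
    show "(r has_field_derivative r' z) (at z within closed_segment (x n) s)"
      using d[of z] re[OF th] z has_field_derivative_at_within by blast
    show "norm (r' z) \<le> B" using B[OF th th1] z by simp
  qed auto
  hence "norm (r s - 0) \<le> B * norm (s - 1)"
    by (intro LIMSEQ_le[OF tendsto_norm[OF tendsto_diff[OF tendsto_const rx]] tendsto_mult[OF tendsto_const tendsto_norm[OF tendsto_diff[OF tendsto_const x1]]]]) auto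
  thus ?thesis by simp
qed

text \<open>Only the neighbourhood of \<open>1\<close> is delicate. With \<open>q = F / (s - 1)\<close> and \<open>r\<^sub>n = (s - 1)\<^sup>n\<^sup>+\<^sup>1 q\<^sup>(\<^sup>n\<^sup>)\<close>, the Leibniz
rule for \<open>(s - 1) q = F\<close> yields \<open>r\<^sub>n' = (s - 1)\<^sup>n F\<^sup>(\<^sup>n\<^sup>+\<^sup>1\<^sup>)\<close>, and \<open>r\<^sub>n\<close> tends to \<open>0\<close> at \<open>1\<close>. The mean value
inequality then bounds \<open>r\<^sub>n\<close> by \<open>|s - 1|\<^sup>n\<^sup>+\<^sup>1\<close> times the supremum of \<open>|F\<^sup>(\<^sup>n\<^sup>+\<^sup>1\<^sup>)|\<close> on the segment from \<open>1\<close>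
to \<open>s\<close>, and the powers of \<open>s - 1\<close> cancel.\<close>
lemma tempered_divide_by_zero_at_1:
  assumes F: "tempered F" and lim: "(F \<longlongrightarrow> 0) (at 1 within {s. Re s > 1})"
  shows "tempered (\<lambda>s. F s / (s - 1))"
proof -
  define q where "q = (\<lambda>s. F s / (s - 1))"
  have hF: "F holomorphic_on {s. Re s > 1}" by (rule tempered_holomorphic[OF F])
  have hq: "q holomorphic_on {s. Re s > 1}"
    unfolding q_def by (intro holomorphic_intros hF) auto
  define r where "r = (\<lambda>n s. (s - 1) ^ Suc n * (deriv ^^ n) q s)"
  have dF: "((deriv ^^ n) F has_field_derivative (deriv ^^ Suc n) F s) (at s)" if "Re s > 1" for n s
    using holomorphic_derivI[OF holomorphic_higher_deriv[OF hF open_rhp] open_rhp, of s n] that by simp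
  have dq: "((deriv ^^ n) q has_field_derivative (deriv ^^ Suc n) q s) (at s)" if "Re s > 1" for n s
    using holomorphic_derivI[OF holomorphic_higher_deriv[OF hq open_rhp] open_rhp, of s n] that by simp
  \<comment> \<open>differentiating \<open>(s - 1) q = F\<close>\<close>
  have leib: "(s - 1) * (deriv ^^ Suc n) q s + of_nat (Suc n) * (deriv ^^ n) q s = (deriv ^^ Suc n) F s"
    if s: "Re s > 1" for n s
    using s
  proof (induction n arbitrary: s)
    case 0
    have "((\<lambda>s. (s - 1) * q s) has_field_derivative (s - 1) * deriv q s + q s) (at s)"
      using dq[OF 0, of 0] by (auto intro!: derivative_eq_intros)
    hence "(F has_field_derivative (s - 1) * deriv q s + q s) (at s)"
      by (rule has_field_derivative_transform_within_open[OF _ open_rhp]) (use 0 in \<open>auto simp: q_def\<close>)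
    from DERIV_unique[OF this] dF[OF 0, of 0] show ?case by simp
  next
    case (Suc n)
    have "((\<lambda>s. (s - 1) * (deriv ^^ Suc n) q s + of_nat (Suc n) * (deriv ^^ n) q s) has_field_derivative
        ((s - 1) * (deriv ^^ Suc (Suc n)) q s + (deriv ^^ Suc n) q s + of_nat (Suc n) * (deriv ^^ Suc n) q s)) (at s)"
      using dq[OF Suc.prems, of n] dq[OF Suc.prems, of "Suc n"] by (auto intro!: derivative_eq_intros)
    hence "((deriv ^^ Suc n) F has_field_derivative
        ((s - 1) * (deriv ^^ Suc (Suc n)) q s + (deriv ^^ Suc n) q s + of_nat (Suc n) * (deriv ^^ Suc n) q s)) (at s)"
      by (rule has_field_derivative_transform_within_open[OF _ open_rhp]) (use Suc in auto)
    from DERIV_unique[OF this dF[OF Suc.prems]] show ?case by (simp add: algebra_simps)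
  qed
  have dr: "(r n has_field_derivative (s - 1) ^ n * (deriv ^^ Suc n) F s) (at s)" if s: "Re s > 1" for n s
  proof -
    have "(r n has_field_derivative (s - 1) ^ n * ((s - 1) * (deriv ^^ Suc n) q s + of_nat (Suc n) * (deriv ^^ n) q s)) (at s)"
    proof -
      have "((\<lambda>s. (s - 1) ^ Suc n) has_field_derivative of_nat (Suc n) * (s - 1) ^ n) (at s)"
        by (rule derivative_eq_intros refl | simp)+
      from DERIV_mult[OF this dq[OF s, of n]] show ?thesis
        unfolding r_def by (simp add: algebra_simps)
    qed
    thus ?thesis unfolding leib[OF s] .
  qed
  \<comment> \<open>by induction, since \<open>r (n + 1) = (s - 1) ^ (n + 1) * F^(n + 1) - (n + 1) * r n\<close>\<close>
  have r_lim: "(r n \<longlongrightarrow> 0) (at 1 within {s. Re s > 1})" for n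
  proof (induction n)
    case 0
    show ?case
      by (rule Lim_transform_eventually[OF lim])
         (auto simp: r_def q_def eventually_at_filter intro!: always_eventually)
  next
    case (Suc n)
    obtain C \<beta> where C: "C > 0" "\<beta> \<ge> 0" "\<And>s. Re s > 1 \<Longrightarrow> norm ((deriv ^^ Suc n) F s) \<le> C * (1 + norm s) powr \<beta>"
      using tempered_derivE[OF F, of "Suc n"] by blast
    have "((\<lambda>s. (s - 1) ^ Suc n * (deriv ^^ Suc n) F s) \<longlongrightarrow> 0) (at 1 within {s. Re s > 1})"
    proof (rule Lim_null_comparison)
      show "\<forall>\<^sub>F s in at 1 within {s. Re s > 1}. norm ((s - 1) ^ Suc n * (deriv ^^ Suc n) F s) \<le> norm (s - 1) ^ Suc n * (C * (1 + norm s) powr \<beta>)"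
        unfolding eventually_at_filter norm_mult norm_power
        by (rule always_eventually) (auto intro!: mult_left_mono C(3)[simplified])
      have "((\<lambda>s. norm (s - 1) ^ Suc n * (C * (1 + norm s) powr \<beta>)) \<longlongrightarrow> norm (1 - 1 :: complex) ^ Suc n * (C * (1 + norm (1::complex)) powr \<beta>)) (at 1 within {s. Re s > 1})"
        by (intro tendsto_intros) auto
      thus "((\<lambda>s. norm (s - 1) ^ Suc n * (C * (1 + norm s) powr \<beta>)) \<longlongrightarrow> 0) (at (1::complex) within {s. Re s > 1})" by simp
    qed
    from tendsto_diff[OF this tendsto_mult[OF tendsto_const Suc, of "of_nat (Suc n)"]]
    have "((\<lambda>s. (s - 1) ^ Suc n * (deriv ^^ Suc n) F s - of_nat (Suc n) * r n s) \<longlongrightarrow> 0) (at 1 within {s. Re s > 1})"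
      by simp
    thus ?case
    proof (rule Lim_transform_eventually)
      have "(s - 1) ^ Suc n * (deriv ^^ Suc n) F s - of_nat (Suc n) * r n s = r (Suc n) s" if "Re s > 1" for s
        unfolding leib[OF that, symmetric] r_def by (simp add: algebra_simps)
      thus "\<forall>\<^sub>F s in at 1 within {s. Re s > 1}. (s - 1) ^ Suc n * (deriv ^^ Suc n) F s - of_nat (Suc n) * r n s = r (Suc n) s"
        unfolding eventually_at_filter by (intro always_eventually) auto
    qed
  qed
  have "\<exists>\<beta>. poly_bound \<beta> ((deriv ^^ n) q)" for n
  proof -
    obtain C \<beta> where C: "C > 0" "\<beta> \<ge> 0" "\<And>s. Re s > 1 \<Longrightarrow> norm ((deriv ^^ Suc n) F s) \<le> C * (1 + norm s) powr \<beta>"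
      using tempered_derivE[OF F, of "Suc n"] by blast
    have "norm ((deriv ^^ n) q s) \<le> C * 2 powr \<beta> * (1 + norm s) powr \<beta>" if s: "Re s > 1" for s
    proof -
      define B where "B = norm (s - 1) ^ n * (C * (2 * (1 + norm s)) powr \<beta>)"
      have "norm (r n s) \<le> B * norm (s - 1)"
      proof (rule rhp_mean_value_from_1[OF dr r_lim s])
        fix \<theta> :: real assume th: "0 < \<theta>" "\<theta> \<le> 1"
        define w where "w = 1 + of_real \<theta> * (s - 1)"
        have "w = of_real (1 - \<theta>) + of_real \<theta> * s" by (simp add: w_def algebra_simps)
        also have "norm \<dots> \<le> (1 - \<theta>) + \<theta> * norm s"
          by (rule norm_triangle_le) (use th in \<open>auto simp: norm_mult simp del: of_real_diff\<close>)
        also have "\<dots> \<le> 1 + 1 * norm s" using th by (intro add_mono mult_right_mono) auto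
        finally have "norm w \<le> 1 + norm s" by simp
        hence w: "1 + norm w \<le> 2 * (1 + norm s)" using norm_ge_zero[of s] unfolding distrib_left by linarith
        have "Re w > 1" using th s by (simp add: w_def)
        hence "norm ((deriv ^^ Suc n) F w) \<le> C * (1 + norm w) powr \<beta>" by (rule C(3))
        also have "\<dots> \<le> C * (2 * (1 + norm s)) powr \<beta>"
          using C w by (intro mult_left_mono powr_mono2) (auto intro: add_nonneg_nonneg)
        finally have 1: "norm ((deriv ^^ Suc n) F w) \<le> C * (2 * (1 + norm s)) powr \<beta>" .
        have "norm (w - 1) \<le> norm (s - 1)"
          using th by (simp add: w_def norm_mult mult_left_le_one_le)
        hence "norm (w - 1) ^ n \<le> norm (s - 1) ^ n" by (intro power_mono) auto
        thus "norm ((w - 1) ^ n * (deriv ^^ Suc n) F w) \<le> B"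
          unfolding B_def norm_mult norm_power using 1 by (intro mult_mono) auto
      qed
      hence "norm (s - 1) ^ Suc n * norm ((deriv ^^ n) q s) \<le> norm (s - 1) ^ Suc n * (C * (2 * (1 + norm s)) powr \<beta>)"
        by (simp add: r_def norm_mult norm_power B_def mult_ac)
      moreover have "s \<noteq> 1" using s by auto
      hence "norm (s - 1) ^ Suc n > 0" by (intro zero_less_power) simp
      ultimately have "norm ((deriv ^^ n) q s) \<le> C * (2 * (1 + norm s)) powr \<beta>"
        by (metis mult_le_cancel_left_pos)
      also have "\<dots> = C * 2 powr \<beta> * (1 + norm s) powr \<beta>"
        by (subst powr_mult) (auto intro: add_nonneg_nonneg)
      finally show ?thesis .
    qed
    thus ?thesis by (auto intro: poly_boundI)
  qed
  thus ?thesis using hq unfolding q_def by (intro temperedI) auto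
qed

section \<open>Cesaro estimates and tempered Laplace transforms\<close>

lemma nn_integral_exp_substitution:
  fixes f :: "real \<Rightarrow> real"
  assumes "f \<in> borel_measurable borel" "x \<ge> 1"
  shows "(\<integral>\<^sup>+u. f u * indicator {1..x} u \<partial>lborel) =
           (\<integral>\<^sup>+v. f (exp v) * exp v * indicator {0..ln x} v \<partial>lborel)"
proof -
  note [measurable] = assms(1)
  have "(\<integral>\<^sup>+u. f u * indicator {exp 0..exp (ln x)} u \<partial>lborel) =
           (\<integral>\<^sup>+v. f (exp v) * exp v * indicator {0..ln x} v \<partial>lborel)"
    by (rule nn_integral_substitution)
       (use assms(2) in \<open>auto intro!: derivative_eq_intros continuous_intros simp: set_borel_measurable_def\<close>)
  thus ?thesis using assms(2) by simp
qed

lemma set_integrable_of_laplace_class_exp: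
  assumes m: "E \<in> borel_measurable borel" and z: "\<And>u. u < 1 \<Longrightarrow> E u = 0"
    and e: "laplace_class (\<lambda>v. E (exp v))"
  shows "set_integrable lborel {0..x} E"
proof (cases "x \<ge> 1")
  case False
  hence "(\<lambda>u. indicator {0..x} u *\<^sub>R E u) = (\<lambda>_. 0)" using z by (auto simp: indicator_def fun_eq_iff)
  thus ?thesis by (simp add: set_integrable_def)
next
  case True
  note [measurable] = m
  have i: "integrable lborel (\<lambda>v. x ^ 3 * \<bar>E (exp v) * exp (- 2 * v)\<bar>)"
    using laplace_classD(2)[OF e, of 2] by (intro integrable_mult_right integrable_abs) auto
  have "(\<integral>\<^sup>+u. ennreal (norm (indicator {0..x} u *\<^sub>R E u)) \<partial>lborel) = (\<integral>\<^sup>+u. \<bar>E u\<bar> * indicator {1..x} u \<partial>lborel)"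
    by (rule nn_integral_cong) (auto simp: indicator_def z not_le)
  also have "\<dots> = (\<integral>\<^sup>+v. \<bar>E (exp v)\<bar> * exp v * indicator {0..ln x} v \<partial>lborel)"
    by (rule nn_integral_exp_substitution) (use True in auto)
  also have "\<dots> \<le> (\<integral>\<^sup>+v. ennreal (norm (x ^ 3 * \<bar>E (exp v) * exp (- 2 * v)\<bar>)) \<partial>lborel)"
  proof (rule nn_integral_mono)
    fix v
    have "\<bar>E (exp v)\<bar> * exp v \<le> x ^ 3 * (\<bar>E (exp v)\<bar> * exp (- 2 * v))" if v: "v \<le> ln x"
    proof -
      have "exp v = exp v ^ 3 * exp (- 2 * v)" by (simp flip: exp_of_nat_mult exp_add)
      also have "exp v \<le> x" using v True by (metis exp_le_cancel_iff exp_ln less_le_trans zero_less_one)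
      hence "exp v ^ 3 * exp (- 2 * v) \<le> x ^ 3 * exp (- 2 * v)" by (intro mult_right_mono power_mono) auto
      finally have "\<bar>E (exp v)\<bar> * exp v \<le> \<bar>E (exp v)\<bar> * (x ^ 3 * exp (- 2 * v))" by (intro mult_left_mono) auto
      thus ?thesis by (simp add: mult_ac)
    qed
    thus "ennreal (\<bar>E (exp v)\<bar> * exp v * indicator {0..ln x} v) \<le> ennreal (norm (x ^ 3 * \<bar>E (exp v) * exp (- 2 * v)\<bar>))"
      using True by (intro ennreal_leI) (auto simp: indicator_def abs_mult)
  qed
  also have "\<dots> < \<infinity>" by (rule i[unfolded integrable_iff_bounded, THEN conjunct2])
  finally show ?thesis unfolding set_integrable_def by (intro integrableI_bounded) auto
qed

lemma cesaro_mean_eq_conv: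
  assumes m: "E \<in> borel_measurable borel" and z: "\<And>u. u < 1 \<Longrightarrow> E u = 0"
    and e: "laplace_class (\<lambda>v. E (exp v))" and x: "x \<ge> 1"
  shows "(LBINT u:{0..x}. E u / u * (1 - u / x) ^ m) = conv (\<lambda>v. E (exp v)) (riesz_kernel m) (ln x)"
proof -
  note [measurable] = m
  define f where "f = (\<lambda>u. E u / u * (1 - u / x) ^ m)"
  have fm[measurable]: "f \<in> borel_measurable borel" unfolding f_def by measurable
  have si: "set_integrable lborel {exp 0..exp (ln x)} f"
    unfolding set_integrable_def
  proof (rule Bochner_Integration.integrable_bound)
    show "integrable lborel (\<lambda>u. indicator {0..x} u *\<^sub>R E u)"
      using set_integrable_of_laplace_class_exp[OF m z e] by (simp add: set_integrable_def)
    have "\<bar>E u / u * (1 - u / x) ^ m\<bar> \<le> \<bar>E u\<bar>" if u: "1 \<le> u" "u \<le> x" for u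
    proof -
      have p: "0 \<le> 1 - u / x" "1 - u / x \<le> 1" using u by (auto simp: field_simps)
      have "\<bar>E u / u * (1 - u / x) ^ m\<bar> = \<bar>E u\<bar> / u * (1 - u / x) ^ m"
        using u zero_le_power[OF p(1), of m] by (simp add: abs_mult)
      also have "\<bar>E u\<bar> / u \<le> \<bar>E u\<bar>" using u by (simp add: pos_divide_le_eq mult_le_cancel_left1)
      hence "\<bar>E u\<bar> / u * (1 - u / x) ^ m \<le> \<bar>E u\<bar> * 1"
        using p by (intro mult_mono power_le_one) auto
      finally show ?thesis by simp
    qed
    thus "AE u in lborel. norm (indicator {exp 0..exp (ln x)} u *\<^sub>R f u) \<le> norm (indicator {0..x} u *\<^sub>R E u)"
      using x by (intro AE_I2) (auto simp: f_def indicator_def)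
  qed measurable
  have "(LBINT u:{0..x}. f u) = (LBINT u. f u * indicator {exp 0..exp (ln x)} u)"
    unfolding set_lebesgue_integral_def
    by (rule Bochner_Integration.integral_cong) (use x z in \<open>auto simp: indicator_def f_def not_le\<close>)
  also have "\<dots> = (LBINT v. f (exp v) * exp v * indicator {0..ln x} v)"
    by (rule integral_substitution(2)[where g = exp and a = 0 and b = "ln x" and g' = exp, OF si])
       (use x in \<open>auto intro!: derivative_eq_intros continuous_intros\<close>)
  also have "\<dots> = conv (\<lambda>v. E (exp v)) (riesz_kernel m) (ln x)"
    unfolding conv_def
  proof (rule Bochner_Integration.integral_cong[OF refl])
    fix v
    have "exp (- (ln x - v)) = exp v / x" using x by (simp add: exp_diff)
    thus "f (exp v) * exp v * indicator {0..ln x} v = E (exp v) * riesz_kernel m (ln x - v)"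
      using z[of "exp v"] by (cases "v < 0") (auto simp: f_def riesz_kernel_def indicator_def)
  qed
  finally show ?thesis by (simp add: f_def)
qed

lemma continuous_convolution:
  fixes f k :: "real \<Rightarrow> real"
  assumes f: "integrable lborel f" and k: "continuous_on UNIV k" "\<And>z. \<bar>k z\<bar> \<le> B"
  shows "continuous_on UNIV (\<lambda>w. \<integral>v. f v * k (w - v) \<partial>lborel)"
proof -
  have km[measurable]: "k \<in> borel_measurable borel" using k(1) by (rule borel_measurable_continuous_onI)
  have fm[measurable]: "f \<in> borel_measurable borel" using f by auto
  have "isCont (\<lambda>w. \<integral>v. f v * k (w - v) \<partial>lborel) w" for w
  proof (rule continuous_at_sequentiallyI)
    fix u :: "nat \<Rightarrow> real" assume u: "u \<longlonglongrightarrow> w"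
    show "(\<lambda>n. \<integral>v. f v * k (u n - v) \<partial>lborel) \<longlonglongrightarrow> (\<integral>v. f v * k (w - v) \<partial>lborel)"
    proof (rule integral_dominated_convergence[where w = "\<lambda>v. \<bar>f v\<bar> * B"])
      show "integrable lborel (\<lambda>v. \<bar>f v\<bar> * B)" using f by (intro integrable_mult_left integrable_abs)
      have "(\<lambda>n. f v * k (u n - v)) \<longlonglongrightarrow> f v * k (w - v)" for v
        by (intro tendsto_mult tendsto_const continuous_on_tendsto_compose[OF k(1)] tendsto_diff u) auto
      thus "AE v in lborel. (\<lambda>n. f v * k (u n - v)) \<longlonglongrightarrow> f v * k (w - v)" by simp
      show "AE v in lborel. norm (f v * k (u n - v)) \<le> \<bar>f v\<bar> * B" for n
        using k(2) by (auto simp: abs_mult intro!: AE_I2 mult_left_mono)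
    qed auto
  qed
  thus ?thesis by (simp add: continuous_on_eq_continuous_at)
qed

lemma riesz_kernel_continuous:
  assumes "m > 0" shows "continuous_on UNIV (riesz_kernel m)"
proof -
  have "continuous_on ({0..} \<union> {..0}) (\<lambda>z::real. if z \<ge> 0 then (1 - exp (- z)) ^ m else 0)"
    by (rule continuous_on_cases) (use assms in \<open>auto intro!: continuous_intros simp: power_0_left\<close>)
  moreover have "{0..} \<union> {..0} = (UNIV :: real set)" by auto
  ultimately show ?thesis by (simp add: riesz_kernel_def[abs_def])
qed

text \<open>After distributing the weight \<open>exp (- \<sigma> w)\<close> over both factors, this is the convolution of an integrable
function with a bounded function that is continuous for \<open>m > 0\<close>. Continuity and boundedness are what
\<open>fourier_sup_bound\<close> asks for.\<close>
lemma conv_riesz_kernel_exp: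
  assumes f: "laplace_class f" and m: "m > 0" and s: "\<sigma> > 1"
  shows "continuous_on UNIV (\<lambda>w. conv f (riesz_kernel m) w * exp (- \<sigma> * w))"
    and "\<exists>K. \<forall>w. \<bar>conv f (riesz_kernel m) w * exp (- \<sigma> * w)\<bar> \<le> K"
proof -
  define F where "F = (\<lambda>v. f v * exp (- \<sigma> * v))"
  define k where "k = (\<lambda>z. riesz_kernel m z * exp (- \<sigma> * z))"
  have F: "integrable lborel F" unfolding F_def by (rule laplace_classD(2)[OF f s])
  have kc: "continuous_on UNIV k" unfolding k_def by (intro continuous_intros riesz_kernel_continuous m)
  have kb: "\<bar>k z\<bar> \<le> 1" for z
  proof (cases "z \<ge> 0")
    case True
    thus ?thesis using riesz_kernel_bounds[of m z] s by (auto simp: k_def abs_mult intro!: mult_le_one)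
  qed (auto simp: k_def riesz_kernel_def)
  have eq: "conv f (riesz_kernel m) w * exp (- \<sigma> * w) = (\<integral>v. F v * k (w - v) \<partial>lborel)" for w
  proof -
    have "F v * k (w - v) = f v * riesz_kernel m (w - v) * exp (- \<sigma> * w)" for v
      by (simp add: F_def k_def algebra_simps flip: exp_add)
    thus ?thesis by (simp add: conv_def)
  qed
  show "continuous_on UNIV (\<lambda>w. conv f (riesz_kernel m) w * exp (- \<sigma> * w))"
    unfolding eq by (rule continuous_convolution[OF F kc kb])
  note [measurable] = borel_measurable_continuous_onI[OF kc]
  have "norm (\<integral>v. F v * k (w - v) \<partial>lborel) \<le> (\<integral>v. \<bar>F v\<bar> \<partial>lborel)" for w
  proof (rule Bochner_Integration.integral_norm_bound_integral)
    show b: "norm (F v * k (w - v)) \<le> \<bar>F v\<bar>" for v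
      using kb[of "w - v"] by (simp add: abs_mult mult_left_le)
    show "integrable lborel (\<lambda>v. F v * k (w - v))"
      by (rule Bochner_Integration.integrable_bound[OF F]) (use F b in auto)
  qed (use F in auto)
  thus "\<exists>K. \<forall>w. \<bar>conv f (riesz_kernel m) w * exp (- \<sigma> * w)\<bar> \<le> K" unfolding eq by auto
qed

lemma poly_bound_minus_2D:
  assumes "poly_bound (-2) f"
  obtains C where "C \<ge> 0" "\<And>s. Re s > 1 \<Longrightarrow> norm (f s) \<le> C / (1 + (Im s)\<^sup>2)"
proof -
  obtain C where C: "C > 0" "\<And>s. Re s > 1 \<Longrightarrow> norm (f s) \<le> C * (1 + norm s) powr (-2)"
    using poly_boundE[OF assms] by blast
  have "norm (f s) \<le> C / (1 + (Im s)\<^sup>2)" if s: "Re s > 1" for s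
  proof -
    have pos: "1 + norm s > 0" using norm_ge_zero[of s] by linarith
    have "(Im s)\<^sup>2 \<le> norm s ^ 2" using abs_Im_le_cmod[of s] by (metis abs_ge_zero power2_abs power_mono)
    hence "1 + (Im s)\<^sup>2 \<le> (1 + norm s) ^ 2" by (simp add: power2_sum add_increasing2)
    hence "C / (1 + norm s) ^ 2 \<le> C / (1 + (Im s)\<^sup>2)"
      using C(1) pos by (intro divide_left_mono) (auto intro!: mult_pos_pos add_pos_nonneg)
    moreover have "C * (1 + norm s) powr (-2) = C / (1 + norm s) ^ 2"
      using pos by (simp add: powr_minus_divide)
    ultimately show ?thesis using C(2)[OF s] by simp
  qed
  thus ?thesis using that[of C] C(1) by auto
qed

text \<open>From growth to decay. If \<open>n\<close> derivatives of the transform are \<open>O((1 + |s|)\<^sup>\<beta>)\<close>, then a mean of order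
\<open>m \<ge> \<beta> + 1\<close> has a transform whose first \<open>n\<close> derivatives are \<open>O((1 + |s|)\<^sup>-\<^sup>2)\<close>, hence integrable on vertical
lines. Fourier inversion applied to \<open>w\<^sup>n\<close> times the mean gives the claim with the weight \<open>exp (- \<sigma> w)\<close>;
let \<open>\<sigma>\<close> tend to \<open>1\<close>.\<close>
lemma riesz_mean_bound_of_tempered:
  assumes f: "laplace_class f" and t: "tempered (laplace f)"
  shows "\<exists>m C. \<forall>w>0. \<bar>conv f (riesz_kernel m) w\<bar> \<le> C * exp w / w ^ n"
proof -
  obtain \<beta> where b: "deriv_bound n \<beta> (laplace f)" using t by (auto simp: tempered_def)
  define m where "m = Suc (nat \<lceil>\<beta> + 1\<rceil>)"
  have m: "m > 0" "\<beta> - real (Suc m) \<le> -2" unfolding m_def by (auto, linarith)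
  define c where "c = conv f (riesz_kernel m)"
  have cl: "laplace_class c" unfolding c_def by (rule laplace_conv(1)[OF f laplace_class_riesz_kernel])
  have lc: "laplace c s = laplace f s * (fact m * (1 / pochhammer s (Suc m)))" if "Re s > 1" for s
    unfolding c_def laplace_conv(2)[OF f laplace_class_riesz_kernel that] laplace_riesz_kernel[OF that] by simp
  have "deriv_bound n (\<beta> + (0 + - real (Suc m))) (\<lambda>s. laplace f s * (fact m * (1 / pochhammer s (Suc m))))"
    by (rule deriv_bound_mult[OF b deriv_bound_mult[OF deriv_bound_const deriv_bound_inverse_pochhammer]])
  hence "deriv_bound n (-2) (\<lambda>s. laplace f s * (fact m * (1 / pochhammer s (Suc m))))"
    by (rule deriv_bound_mono) (use m in simp)
  hence "deriv_bound n (-2) (laplace c)" by (rule deriv_bound_cong) (simp add: lc)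
  hence "poly_bound (-2) ((deriv ^^ n) (laplace c))" by (rule deriv_bound_poly_bound) simp
  then obtain C where C: "C \<ge> 0" "\<And>s. Re s > 1 \<Longrightarrow> norm ((deriv ^^ n) (laplace c) s) \<le> C / (1 + (Im s)\<^sup>2)"
    using poly_bound_minus_2D by blast
  have key: "\<bar>w ^ n * c w * exp (- \<sigma> * w)\<bar> \<le> C / 2" if s: "\<sigma> > 1" for \<sigma> w
  proof -
    note cn = laplace_class_power_times[OF cl, of n]
    define \<sigma>1 where "\<sigma>1 = (1 + \<sigma>) / 2"
    have s1: "\<sigma>1 > 1" "\<sigma> - \<sigma>1 > 0" using s by (auto simp: \<sigma>1_def field_simps)
    obtain K where K: "\<And>w. \<bar>c w * exp (- \<sigma>1 * w)\<bar> \<le> K"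
      using conv_riesz_kernel_exp(2)[OF f m(1) s1(1)] unfolding c_def by blast
    obtain D where D: "D \<ge> 0" "\<And>v::real. v \<ge> 0 \<Longrightarrow> v ^ n * exp (- (\<sigma> - \<sigma>1) * v) \<le> D"
      using power_times_exp_bounded[OF s1(2)] by blast
    show ?thesis
    proof (rule fourier_sup_bound[where h = "\<lambda>w. w ^ n * c w * exp (- \<sigma> * w)" and B = "D * K" and M = C])
      show "integrable lborel (\<lambda>w. w ^ n * c w * exp (- \<sigma> * w))" by (rule laplace_classD(2)[OF cn s])
      have "continuous_on UNIV (\<lambda>w. w ^ n * (c w * exp (- \<sigma> * w)))"
        unfolding c_def by (intro continuous_intros conv_riesz_kernel_exp(1)[OF f m(1) s])
      thus "continuous_on UNIV (\<lambda>w. w ^ n * c w * exp (- \<sigma> * w))" by (simp add: mult.assoc)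
      show "\<bar>w ^ n * c w * exp (- \<sigma> * w)\<bar> \<le> D * K" for w
      proof (cases "w \<ge> 0")
        case True
        have "exp (- \<sigma> * w) = exp (- (\<sigma> - \<sigma>1) * w) * exp (- \<sigma>1 * w)" by (simp add: algebra_simps flip: exp_add)
        hence "\<bar>w ^ n * c w * exp (- \<sigma> * w)\<bar> = (w ^ n * exp (- (\<sigma> - \<sigma>1) * w)) * \<bar>c w * exp (- \<sigma>1 * w)\<bar>"
          using True by (simp add: abs_mult mult_ac)
        also have "\<dots> \<le> D * K" using D K True by (intro mult_mono) auto
        finally show ?thesis .
      next
        case False
        thus ?thesis using laplace_classD(1)[OF cl, of w] D(1) K[of 0] by simp
      qed
      fix t :: real
      define z where "z = Complex \<sigma> t"
      have z: "Re z > 1" "Im z = t" using s by (auto simp: z_def)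
      have "norm (\<integral>v. of_real (v ^ n * c v * exp (- \<sigma> * v)) * exp (- \<i> * complex_of_real (t * v)) \<partial>lborel)
         = norm (laplace (\<lambda>v. v ^ n * c v) z)"
      proof -
        have "z = of_real \<sigma> + \<i> * of_real t" by (simp add: z_def complex_eq_iff)
        hence "of_real (v ^ n * c v * exp (- \<sigma> * v)) * exp (- \<i> * complex_of_real (t * v)) = of_real (v ^ n * c v) * exp (- z * of_real v)" for v
          by (simp add: algebra_simps flip: exp_of_real exp_add)
        thus ?thesis by (simp only: laplace_def)
      qed
      also have "\<dots> = norm (laplace (\<lambda>v. (- v) ^ n * c v) z)"
      proof -
        have "complex_of_real ((- v) ^ n * c v) * exp (- z * of_real v) = (-1) ^ n * (of_real (v ^ n * c v) * exp (- z * of_real v))" for v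
          by (subst power_minus) simp
        hence "laplace (\<lambda>v. (- v) ^ n * c v) z = (-1) ^ n * laplace (\<lambda>v. v ^ n * c v) z"
          by (simp only: laplace_def integral_mult_right_zero)
        thus ?thesis by (simp add: norm_mult norm_power)
      qed
      also have "\<dots> \<le> C / (1 + t\<^sup>2)"
        using C(2)[OF z(1)] unfolding laplace_higher_deriv[OF cl z(1)] z(2) .
      finally show "norm (\<integral>v. of_real (v ^ n * c v * exp (- \<sigma> * v)) * exp (- \<i> * complex_of_real (t * v)) \<partial>lborel) \<le> C / (1 + t\<^sup>2)" .
    qed
  qed
  have "\<bar>c w\<bar> \<le> C / 2 * exp w / w ^ n" if w: "w > 0" for w
  proof -
    have "(\<lambda>k. \<bar>w ^ n * c w * exp (- (1 + 1 / real (Suc k)) * w)\<bar>) \<longlonglongrightarrow> \<bar>w ^ n * c w * exp (- (1 + 0) * w)\<bar>"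
      by (intro tendsto_intros) real_asymp
    hence "\<bar>w ^ n * c w * exp (- (1 + 0) * w)\<bar> \<le> C / 2"
      by (rule LIMSEQ_le_const2) (intro exI[of _ 0] allI impI key, simp)
    hence "w ^ n * \<bar>c w\<bar> * exp (- w) \<le> C / 2" using w by (simp add: abs_mult)
    thus ?thesis using w by (simp add: exp_minus field_simps)
  qed
  thus ?thesis unfolding c_def by blast
qed

text \<open>From decay to growth. A mean of size \<open>exp w / w\<^sup>n\<^sup>+\<^sup>2\<close> can be multiplied by \<open>w\<^sup>k\<close> with \<open>k \<le> n\<close> and still be
integrated against \<open>exp (- w)\<close>; so its transform has \<open>n\<close> derivatives that are bounded on \<open>Re s > 1\<close>.
Multiplying by the reciprocal of the transform of the kernel, a polynomial, recovers the
transform of \<open>f\<close>.\<close>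
lemma tempered_of_riesz_mean_bound:
  assumes f: "laplace_class f"
    and b: "\<And>n. \<exists>m C w0. \<forall>w\<ge>w0. \<bar>conv f (riesz_kernel m) w\<bar> \<le> C * exp w / w ^ n"
  shows "tempered (laplace f)"
  unfolding tempered_def
proof
  fix n
  obtain m C0 w0' where c0: "\<And>w. w \<ge> w0' \<Longrightarrow> \<bar>conv f (riesz_kernel m) w\<bar> \<le> C0 * exp w / w ^ (n + 2)"
    using b by blast
  define c where "c = conv f (riesz_kernel m)"
  define w0 where "w0 = max 1 w0'"
  define C where "C = \<bar>C0\<bar>"
  have w0: "w0 \<ge> 1" and C: "C \<ge> 0" by (auto simp: w0_def C_def)
  have cb: "\<bar>c w\<bar> \<le> C * exp w / w ^ (n + 2)" if "w \<ge> w0" for w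
  proof -
    have "\<bar>c w\<bar> \<le> C0 * exp w / w ^ (n + 2)" using c0[of w] that by (simp add: c_def w0_def)
    also have "\<dots> \<le> C * exp w / w ^ (n + 2)"
      using that w0 by (intro divide_right_mono mult_right_mono) (auto simp: C_def)
    finally show ?thesis .
  qed
  have cl: "laplace_class c" unfolding c_def by (rule laplace_conv(1)[OF f laplace_class_riesz_kernel])
  have "poly_bound 0 ((deriv ^^ k) (laplace c))" if k: "k \<le> n" for k
  proof -
    define d where "d = (\<lambda>v. (- v) ^ k * c v)"
    have dl: "laplace_class d" unfolding d_def by (rule laplace_class_times_neg[OF cl])
    define g where "g = (\<lambda>v. exp (2 * w0) * \<bar>d v * exp (- 2 * v)\<bar> + 2 * C * (1 / (1 + v\<^sup>2)))"
    have gi: "integrable lborel g"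
      unfolding g_def using laplace_classD(2)[OF dl, of 2]
      by (intro Bochner_Integration.integrable_add integrable_mult_right integrable_abs integrable_inverse_1_plus_sq) auto
    have db: "\<bar>d v\<bar> * exp (- \<sigma> * v) \<le> g v" if s: "\<sigma> > 1" for \<sigma> v
    proof -
      have g1: "0 \<le> exp (2 * w0) * \<bar>d v * exp (- 2 * v)\<bar>" "0 \<le> 2 * C * (1 / (1 + v\<^sup>2))"
        using C by (auto intro!: mult_nonneg_nonneg divide_nonneg_nonneg add_nonneg_nonneg)
      consider "v < 0" | "0 \<le> v" "v \<le> w0" | "v \<ge> w0" by linarith
      thus ?thesis
      proof cases
        case 1
        thus ?thesis using laplace_classD(1)[OF dl, of v] g1(2) by (simp add: g_def)
      next
        case 2
        have "exp (- \<sigma> * v) \<le> 1" using 2 s by simp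
        also have "1 \<le> exp (2 * w0) * exp (- 2 * v)" using 2 by (simp flip: exp_add)
        finally have "\<bar>d v\<bar> * exp (- \<sigma> * v) \<le> \<bar>d v\<bar> * (exp (2 * w0) * exp (- 2 * v))" by (intro mult_left_mono) auto
        also have "\<dots> = exp (2 * w0) * \<bar>d v * exp (- 2 * v)\<bar>" by (simp add: abs_mult)
        finally show ?thesis using g1 unfolding g_def by linarith
      next
        case 3
        have v1: "v \<ge> 1" using 3 w0 by simp
        have "v * 1 \<le> v * \<sigma>" using v1 s by (intro mult_left_mono) auto
        hence "\<bar>d v\<bar> * exp (- \<sigma> * v) \<le> \<bar>d v\<bar> * exp (- v)"
          by (intro mult_left_mono) (auto simp: mult.commute)
        also have "\<dots> = v ^ k * \<bar>c v\<bar> * exp (- v)" using v1 by (simp add: d_def abs_mult power_abs)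
        also have "\<dots> \<le> v ^ n * (C * exp v / v ^ (n + 2)) * exp (- v)"
          using v1 k cb[OF 3] by (intro mult_right_mono mult_mono power_increasing) auto
        also have "\<dots> = C / v\<^sup>2" using v1 by (simp add: power_add exp_minus power2_eq_square)
        also have "\<dots> \<le> 2 * C * (1 / (1 + v\<^sup>2))"
        proof -
          have "1 \<le> v\<^sup>2" using v1 by (simp add: one_le_power)
          hence "1 + v\<^sup>2 \<le> 2 * v\<^sup>2" by simp
          hence "1 / v\<^sup>2 \<le> 2 * (1 / (1 + v\<^sup>2))" using v1 by (simp add: field_simps add_pos_nonneg)
          from mult_left_mono[OF this C] show ?thesis by (simp add: mult_ac)
        qed
        finally show ?thesis using g1 unfolding g_def by linarith
      qed
    qed
    show ?thesis
    proof (rule poly_boundI[where C = "\<integral>v. g v \<partial>lborel"])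
      fix s :: complex assume s: "Re s > 1"
      have "norm ((deriv ^^ k) (laplace c) s) \<le> (\<integral>v. g v \<partial>lborel)"
        unfolding laplace_higher_deriv[OF cl s] d_def[symmetric]
        by (rule laplace_norm_bound[OF dl s gi db[OF s]])
      moreover have "1 + norm s > 0" using norm_ge_zero[of s] by linarith
      ultimately show "norm ((deriv ^^ k) (laplace c) s) \<le> (\<integral>v. g v \<partial>lborel) * (1 + norm s) powr 0" by simp
    qed
  qed
  hence "deriv_bound n 0 (laplace c)" using laplace_holomorphic[OF cl] by (simp add: deriv_bound_def)
  from deriv_bound_mult[OF this deriv_bound_mult[OF deriv_bound_const deriv_bound_pochhammer]]
  have "deriv_bound n (0 + (0 + real (Suc m))) (\<lambda>s. laplace c s * ((1 / fact m) * pochhammer s (Suc m)))" .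
  hence "deriv_bound n (0 + (0 + real (Suc m))) (laplace f)"
  proof (rule deriv_bound_cong)
    fix s :: complex assume s: "Re s > 1"
    have "pochhammer s (Suc m) \<noteq> 0"
    proof
      assume "pochhammer s (Suc m) = 0"
      then obtain k where "s = - of_nat k" by (auto simp: pochhammer_eq_0_iff)
      thus False using s by simp
    qed
    thus "laplace c s * ((1 / fact m) * pochhammer s (Suc m)) = laplace f s"
      unfolding c_def laplace_conv(2)[OF f laplace_class_riesz_kernel s] laplace_riesz_kernel[OF s] by simp
  qed
  thus "\<exists>\<beta>. deriv_bound n \<beta> (laplace f)" by blast
qed

theorem cesaro_bigo_iff_tempered:
  assumes m: "E \<in> borel_measurable borel" and z: "\<And>u. u < 1 \<Longrightarrow> E u = 0"
    and e: "laplace_class (\<lambda>v. E (exp v))"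
  shows "(\<forall>n::nat. cesaro_bigo (real n) E) \<longleftrightarrow> tempered (laplace (\<lambda>v. E (exp v)))"
proof
  assume t: "tempered (laplace (\<lambda>v. E (exp v)))"
  show "\<forall>n::nat. cesaro_bigo (real n) E"
    unfolding cesaro_bigo_def
  proof (intro allI conjI set_integrable_of_laplace_class_exp[OF m z e])
    fix n :: nat
    obtain k C where C: "\<And>w. w > 0 \<Longrightarrow> \<bar>conv (\<lambda>v. E (exp v)) (riesz_kernel k) w\<bar> \<le> C * exp w / w ^ n"
      using riesz_mean_bound_of_tempered[OF e t] by blast
    have "(\<lambda>x. LBINT u:{0..x}. E u / u * (1 - u / x) ^ k) \<in> O[at_top](\<lambda>x. x / ln x powr real n)"
    proof (rule bigoI[where c = C])
      show "\<forall>\<^sub>F x in at_top. norm (LBINT u:{0..x}. E u / u * (1 - u / x) ^ k) \<le> C * norm (x / ln x powr real n)"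
        using eventually_gt_at_top[of 1]
      proof eventually_elim
        case (elim x)
        have "norm (LBINT u:{0..x}. E u / u * (1 - u / x) ^ k) \<le> C * exp (ln x) / ln x ^ n"
        proof -
          have eq: "(LBINT u:{0..x}. E u / u * (1 - u / x) ^ k) = conv (\<lambda>v. E (exp v)) (riesz_kernel k) (ln x)"
            by (rule cesaro_mean_eq_conv[OF m z e]) (use elim in auto)
          show ?thesis unfolding eq real_norm_def by (rule C) (use elim in auto)
        qed
        thus ?case using elim by (simp add: powr_realpow)
      qed
    qed
    thus "\<exists>m. (\<lambda>x. LBINT u:{0..x}. E u / u * (1 - u / x) ^ m) \<in> O[at_top](\<lambda>x. x / ln x powr real n)" ..
  qed
next
  assume b: "\<forall>n::nat. cesaro_bigo (real n) E"
  show "tempered (laplace (\<lambda>v. E (exp v)))"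
  proof (rule tempered_of_riesz_mean_bound[OF e])
    fix n :: nat
    obtain k where "(\<lambda>x. LBINT u:{0..x}. E u / u * (1 - u / x) ^ k) \<in> O[at_top](\<lambda>x. x / ln x powr real n)"
      using b unfolding cesaro_bigo_def by blast
    then obtain C where "\<forall>\<^sub>F x in at_top. norm (LBINT u:{0..x}. E u / u * (1 - u / x) ^ k) \<le> C * norm (x / ln x powr real n)"
      by (elim landau_o.bigE) auto
    then obtain x0 where x0: "\<And>x. x \<ge> x0 \<Longrightarrow> norm (LBINT u:{0..x}. E u / u * (1 - u / x) ^ k) \<le> C * norm (x / ln x powr real n)"
      by (auto simp: eventually_at_top_linorder)
    define x1 where "x1 = max x0 2"
    have "\<bar>conv (\<lambda>v. E (exp v)) (riesz_kernel k) w\<bar> \<le> C * exp w / w ^ n" if w: "w \<ge> ln x1" for w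
    proof -
      have "w \<ge> ln 2" using w by (rule order_trans[rotated]) (auto simp: x1_def)
      hence w0: "w > 0" using ln_gt_zero[of "2::real"] by linarith
      have "exp w \<ge> exp (ln x1)" using w by simp
      hence "exp w \<ge> x0" by (auto simp: x1_def)
      note x0[OF this]
      also have "(LBINT u:{0..exp w}. E u / u * (1 - u / exp w) ^ k) = conv (\<lambda>v. E (exp v)) (riesz_kernel k) (ln (exp w))"
        by (rule cesaro_mean_eq_conv[OF m z e]) (use w0 in auto)
      finally show ?thesis using w0 by (simp add: powr_realpow)
    qed
    thus "\<exists>m C w0. \<forall>w\<ge>w0. \<bar>conv (\<lambda>v. E (exp v)) (riesz_kernel m) w\<bar> \<le> C * exp w / w ^ n" by blast
  qed
qed

section \<open>Dirichlet integrals as Laplace transforms\<close>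

text \<open>Integration by parts in the form of Fubini: \<open>x powr (-s) = s \<integral> exp (- s v) dv\<close> over \<open>v \<ge> log x\<close>, and the
inner integral over \<open>x \<le> exp v\<close> gives \<open>F (exp v)\<close>.\<close>

lemma laplace_stieltjes:
  fixes F :: "real \<Rightarrow> real"
  assumes mono: "mono F" and rc: "\<And>x. continuous (at_right x) F"
    and A: "A \<in> sets borel" "A \<subseteq> {1..}"
    and mA: "\<And>u. emeasure (interval_measure F) (A \<inter> {..u}) = F u" and nn: "\<And>u. F u \<ge> 0"
    and z: "\<And>u. u < 1 \<Longrightarrow> F u = 0"
    and int: "\<And>s. Re s > 1 \<Longrightarrow> set_integrable (interval_measure F) A (\<lambda>x. complex_of_real x powr (- s))"
  shows "laplace_class (\<lambda>v. F (exp v))"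
    and "Re s > 1 \<Longrightarrow> laplace (\<lambda>v. F (exp v)) s = (LINT x:A|interval_measure F. complex_of_real x powr (- s)) / s"
proof -
  define M where "M = interval_measure F"
  have sets_M[measurable_cong]: "sets M = sets borel" by (simp add: M_def)
  interpret M: sigma_finite_measure M
    unfolding M_def by (rule sigma_finite_interval_measure) (use mono rc in \<open>auto simp: mono_def\<close>)
  interpret pair_sigma_finite M lborel ..
  note [measurable] = A(1)
  define G where "G = (\<lambda>s (x, v). (if x \<in> A \<and> x \<le> exp v then exp (- s * complex_of_real v) else 0))"
  have Gm[measurable]: "G s \<in> borel_measurable (M \<Otimes>\<^sub>M lborel)" for s unfolding G_def by measurable
  have Gx: "G s (x, v) = indicator A x *\<^sub>R (complex_of_real x powr (- s) * (indicator {0..} (v - ln x) *\<^sub>R exp (- s * complex_of_real (v - ln x))))" for s x v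
  proof (cases "x \<in> A")
    case True
    hence x: "x \<ge> 1" using A(2) by auto
    have "x \<le> exp v \<longleftrightarrow> ln x \<le> v" using x by (metis exp_le_cancel_iff exp_ln less_le_trans zero_less_one)
    moreover have "complex_of_real x powr (- s) = exp (- s * of_real (ln x))"
      using x by (simp add: powr_def Ln_of_real)
    hence "exp (- s * complex_of_real v) = complex_of_real x powr (- s) * exp (- s * complex_of_real (v - ln x))"
      by (simp add: algebra_simps flip: exp_add)
    ultimately show ?thesis using True by (auto simp: G_def indicator_def)
  qed (simp add: G_def)
  have Gint_v: "(\<integral>v. G s (x, v) \<partial>lborel) = (indicator A x *\<^sub>R complex_of_real x powr (- s)) / s" if "Re s > 1" for s x
  proof -
    have "(\<integral>v. G s (x, v) \<partial>lborel) = indicator A x *\<^sub>R (complex_of_real x powr (- s) * (\<integral>v. indicator {0..} (v - ln x) *\<^sub>R exp (- s * complex_of_real (v - ln x)) \<partial>lborel))"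
      by (simp only: Gx integral_scaleR_right integral_mult_right_zero)
    also have "(\<integral>v. indicator {0..} (v - ln x) *\<^sub>R exp (- s * complex_of_real (v - ln x)) \<partial>lborel) = 1 / s"
      using lborel_integral_shift[of "\<lambda>v. indicator {0..} v *\<^sub>R exp (- s * complex_of_real v)"] integral_cexp_half_line[of s] that by simp
    finally show ?thesis by (simp add: scaleR_conv_of_real)
  qed
  have Gi_v: "integrable lborel (\<lambda>v. G s (x, v))" if "Re s > 1" for s x
  proof -
    have "integrable lborel (\<lambda>v. indicator {0..} (v - ln x) *\<^sub>R exp (- s * complex_of_real (v - ln x)))"
      using lborel_integrable_shift[of "\<lambda>v. indicator {0..} v *\<^sub>R exp (- s * complex_of_real v)"] integrable_cexp_half_line[of s] that by simp
    thus ?thesis unfolding Gx by (intro integrable_scaleR_right integrable_mult_right)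
  qed
  have nG: "norm (G s (x, v)) = Re (G (of_real (Re s)) (x, v))" for s x v
    unfolding G_def by (auto simp: Re_exp)
  have Gi: "integrable (M \<Otimes>\<^sub>M lborel) (G s)" if s: "Re s > 1" for s
  proof (rule Fubini_integrable)
    have s': "Re (of_real (Re s)) > 1" using s by simp
    have "(\<lambda>x. \<integral>v. norm (G s (x, v)) \<partial>lborel) = (\<lambda>x. Re (\<integral>v. G (of_real (Re s)) (x, v) \<partial>lborel))"
      unfolding nG by (intro ext integral_Re Gi_v s')
    also have "\<dots> = (\<lambda>x. Re ((indicator A x *\<^sub>R complex_of_real x powr (- of_real (Re s))) / of_real (Re s)))"
      by (simp only: Gint_v[OF s'])
    finally have eq: "(\<lambda>x. \<integral>v. norm (G s (x, v)) \<partial>lborel) = (\<lambda>x. Re ((indicator A x *\<^sub>R complex_of_real x powr (- of_real (Re s))) / of_real (Re s)))" .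
    show "integrable M (\<lambda>x. \<integral>v. norm (G s (x, v)) \<partial>lborel)"
      unfolding eq using int[OF s'] unfolding set_integrable_def M_def
      by (intro integrable_Re integrable_divide)
  qed (use Gi_v[OF s] in auto)
  have Gint_x: "(\<integral>x. G s (x, v) \<partial>M) = of_real (F (exp v)) * exp (- s * of_real v)" for s v
  proof -
    have "(\<integral>x. G s (x, v) \<partial>M) = (\<integral>x. indicator (A \<inter> {..exp v}) x *\<^sub>R exp (- s * complex_of_real v) \<partial>M)"
      by (rule Bochner_Integration.integral_cong) (auto simp: G_def indicator_def)
    also have "\<dots> = measure M (A \<inter> {..exp v}) *\<^sub>R exp (- s * complex_of_real v)"
      using mA[of "exp v"] by (subst integral_scaleR_left) (auto simp: M_def sets_M)
    also have "measure M (A \<inter> {..exp v}) = F (exp v)"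
      using mA[of "exp v"] nn[of "exp v"] by (simp add: measure_def M_def)
    finally show ?thesis by (simp add: scaleR_conv_of_real)
  qed
  show "laplace_class (\<lambda>v. F (exp v))"
    unfolding laplace_class_def
  proof (intro conjI allI impI)
    fix \<sigma> :: real assume "\<sigma> > 1"
    hence "integrable (M \<Otimes>\<^sub>M lborel) (case_prod (\<lambda>x v. G (of_real \<sigma>) (x, v)))" using Gi[of "of_real \<sigma>"] by simp
    from integrable_snd[OF this]
    have "integrable lborel (\<lambda>v. of_real (F (exp v)) * exp (- of_real \<sigma> * of_real v) :: complex)"
      unfolding Gint_x .
    hence "integrable lborel (\<lambda>v. of_real (F (exp v) * exp (- \<sigma> * v)) :: complex)"
      by (simp add: exp_of_real[symmetric])
    thus "integrable lborel (\<lambda>v. F (exp v) * exp (- \<sigma> * v))"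
      using complex_of_real_integrable_eq by blast
  qed (simp add: z)
  assume s: "Re s > 1"
  have "laplace (\<lambda>v. F (exp v)) s = (\<integral>v. (\<integral>x. G s (x, v) \<partial>M) \<partial>lborel)"
    by (simp only: laplace_def Gint_x)
  also have "\<dots> = (\<integral>x. (\<integral>v. G s (x, v) \<partial>lborel) \<partial>M)"
    using Fubini_integral[of "\<lambda>x v. G s (x, v)"] Gi[OF s] by simp
  also have "\<dots> = (LINT x:A|M. complex_of_real x powr (- s)) / s"
    by (simp only: Gint_v[OF s] set_lebesgue_integral_def integral_divide_zero)
  finally show "laplace (\<lambda>v. F (exp v)) s = (LINT x:A|interval_measure F. complex_of_real x powr (- s)) / s"
    by (simp add: M_def)
qed

lemma emeasure_interval_measure_below_support:
  assumes mono: "mono F" and rc: "\<And>x. continuous (at_right x) F" and z: "\<And>x. x < c \<Longrightarrow> F x = (0::real)"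
  shows "emeasure (interval_measure F) {..<c} = 0"
proof -
  have mono': "\<And>x y. x \<le> y \<Longrightarrow> F x \<le> F y" using mono by (auto simp: mono_def)
  have "{..<c} = (\<Union>n::nat. {c - real n - 1<..c - 1 / real (Suc n)})"
  proof (intro set_eqI iffI)
    fix x assume x: "x \<in> {..<c}"
    obtain n1 where n1: "1 / (c - x) < real n1" using reals_Archimedean2 by blast
    obtain n2 where n2: "c - x < real n2" using reals_Archimedean2 by blast
    define n where "n = max n1 n2"
    have "1 / (c - x) < real (Suc n)" using n1 by (simp add: n_def)
    hence "1 / real (Suc n) < c - x" using x by (simp add: field_simps)
    moreover have "c - x < real n + 1" using n2 by (simp add: n_def)
    ultimately show "x \<in> (\<Union>n::nat. {c - real n - 1<..c - 1 / real (Suc n)})" by (intro UN_I[of n]) auto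
  next
    fix x assume "x \<in> (\<Union>n::nat. {c - real n - 1<..c - 1 / real (Suc n)})"
    then obtain n where "x \<le> c - 1 / real (Suc n)" by auto
    moreover have "1 / real (Suc n) > 0" by simp
    ultimately have "x < c" by linarith
    thus "x \<in> {..<c}" by simp
  qed
  also have "emeasure (interval_measure F) \<dots> = 0"
  proof (rule emeasure_UN_eq_0)
    fix n :: nat
    have "emeasure (interval_measure F) {c - real n - 1<..c - 1 / real (Suc n)} = F (c - 1 / real (Suc n)) - F (c - real n - 1)"
      by (rule emeasure_interval_measure_Ioc) (use mono' rc in \<open>auto simp: field_simps\<close>)
    also have "F (c - 1 / real (Suc n)) = 0" by (rule z) simp
    also have "F (c - real n - 1) = 0" by (rule z) simp
    finally show "emeasure (interval_measure F) {c - real n - 1<..c - 1 / real (Suc n)} = 0" by simp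
  qed auto
  finally show ?thesis .
qed

definition prime_dirichlet :: "(real \<Rightarrow> real) \<Rightarrow> complex \<Rightarrow> complex" where
  "prime_dirichlet P s = (LINT x:{1<..}|interval_measure P. complex_of_real x powr (- s))"

text \<open>\<open>log \<zeta>\<close> on the real axis, as a real number.\<close>
definition prime_real :: "(real \<Rightarrow> real) \<Rightarrow> real \<Rightarrow> real" where
  "prime_real P \<sigma> = (LINT x:{1<..}|interval_measure P. x powr (- \<sigma>))"

context
  fixes N P :: "real \<Rightarrow> real"
  assumes gns: "generalized_number_system N P"
begin

lemma gns_mono: "mono N" "mono P" and gns_rc: "\<And>x. continuous (at_right x) N" "\<And>x. continuous (at_right x) P"
  and gns_zero: "\<And>x. x < 1 \<Longrightarrow> N x = 0" "\<And>x. x < 1 \<Longrightarrow> P x = 0" and gns_at_1: "N 1 = 1" "P 1 = 0"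
  and gns_integrable_P: "Re s > 1 \<Longrightarrow> set_integrable (interval_measure P) {1<..} (\<lambda>x. complex_of_real x powr (- s))"
  and gns_integrable_N: "Re s > 1 \<Longrightarrow> set_integrable (interval_measure N) {1..} (\<lambda>x. complex_of_real x powr (- s))"
  and zeta_eq_exp: "Re s > 1 \<Longrightarrow> beurling_zeta N s = exp (prime_dirichlet P s)"
  using gns unfolding generalized_number_system_def prime_dirichlet_def by blast+

lemma gns_nonneg: "N x \<ge> 0" "P x \<ge> 0"
  using monoD[OF gns_mono(1), of "min x 0" x] monoD[OF gns_mono(2), of "min x 0" x]
    gns_zero(1)[of "min x 0"] gns_zero(2)[of "min x 0"] by auto

lemma laplace_N:
  shows "laplace_class (\<lambda>v. N (exp v))"
    and "Re s > 1 \<Longrightarrow> laplace (\<lambda>v. N (exp v)) s = beurling_zeta N s / s"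
proof -
  have *: "emeasure (interval_measure N) ({1..} \<inter> {..u}) = N u" for u
  proof (cases "u \<ge> 1")
    case True
    have "emeasure (interval_measure N) ({1..} \<inter> {..u}) = emeasure (interval_measure N) {0<..u}"
    proof (rule emeasure_eq_AE)
      have "{..<1} \<in> null_sets (interval_measure N)"
        using emeasure_interval_measure_below_support[OF gns_mono(1) gns_rc(1) gns_zero(1)] by (simp add: null_sets_def)
      hence "AE x in interval_measure N. x \<notin> {..<1}" by (rule AE_not_in)
      thus "AE x in interval_measure N. x \<in> {1..} \<inter> {..u} \<longleftrightarrow> x \<in> {0<..u}"
        by eventually_elim auto
    qed auto
    also have "\<dots> = N u - N 0"
      by (rule emeasure_interval_measure_Ioc) (use True gns_mono gns_rc in \<open>auto simp: mono_def\<close>)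
    finally show ?thesis using gns_zero(1)[of 0] by simp
  next
    case False
    hence "{1..} \<inter> {..u} = {}" by auto
    thus ?thesis using gns_zero(1)[of u] False by simp
  qed
  show "laplace_class (\<lambda>v. N (exp v))"
    by (rule laplace_stieltjes(1)[OF gns_mono(1) gns_rc(1) _ _ * gns_nonneg(1) gns_zero(1) gns_integrable_N]) auto
  show "laplace (\<lambda>v. N (exp v)) s = beurling_zeta N s / s" if "Re s > 1"
    unfolding beurling_zeta_def
    by (rule laplace_stieltjes(2)[OF gns_mono(1) gns_rc(1) _ _ * gns_nonneg(1) gns_zero(1) gns_integrable_N that]) auto
qed

lemma laplace_P:
  shows "laplace_class (\<lambda>v. P (exp v))"
    and "Re s > 1 \<Longrightarrow> laplace (\<lambda>v. P (exp v)) s = prime_dirichlet P s / s"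
proof -
  have *: "emeasure (interval_measure P) ({1<..} \<inter> {..u}) = P u" for u
  proof (cases "u \<ge> 1")
    case True
    have "{1<..} \<inter> {..u} = {1<..u}" by auto
    hence "emeasure (interval_measure P) ({1<..} \<inter> {..u}) = emeasure (interval_measure P) {1<..u}" by simp
    also have "\<dots> = P u - P 1"
      by (rule emeasure_interval_measure_Ioc) (use True gns_mono gns_rc in \<open>auto simp: mono_def\<close>)
    finally show ?thesis using gns_at_1 by simp
  next
    case False
    hence "{1<..} \<inter> {..u} = {}" by auto
    thus ?thesis using gns_zero(2)[of u] False by simp
  qed
  show "laplace_class (\<lambda>v. P (exp v))"
    by (rule laplace_stieltjes(1)[OF gns_mono(2) gns_rc(2) _ _ * gns_nonneg(2) gns_zero(2) gns_integrable_P]) auto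
  show "laplace (\<lambda>v. P (exp v)) s = prime_dirichlet P s / s" if "Re s > 1"
    unfolding prime_dirichlet_def
    by (rule laplace_stieltjes(2)[OF gns_mono(2) gns_rc(2) _ _ * gns_nonneg(2) gns_zero(2) gns_integrable_P that]) auto
qed

lemma prime_dirichlet_holomorphic: "prime_dirichlet P holomorphic_on {s. Re s > 1}"
proof (rule holomorphic_transform)
  show "(\<lambda>s. s * laplace (\<lambda>v. P (exp v)) s) holomorphic_on {s. Re s > 1}"
    by (intro holomorphic_intros laplace_holomorphic laplace_P)
  show "s * laplace (\<lambda>v. P (exp v)) s = prime_dirichlet P s" if "s \<in> {s. Re s > 1}" for s
    using that laplace_P(2)[of s] by auto
qed

lemma zeta_holomorphic: "beurling_zeta N holomorphic_on {s. Re s > 1}"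
  by (rule holomorphic_transform[OF holomorphic_on_exp'[OF prime_dirichlet_holomorphic]]) (auto simp: zeta_eq_exp)

lemma norm_powr_P: "x > 1 \<Longrightarrow> norm (complex_of_real x powr (- s)) = x powr (- Re s)"
  by (simp add: norm_powr_real_powr)

lemma prime_real_integrable:
  assumes "\<sigma> > 1" shows "set_integrable (interval_measure P) {1<..} (\<lambda>x. x powr (- \<sigma>))"
proof -
  have "set_integrable (interval_measure P) {1<..} (\<lambda>x. norm (complex_of_real x powr (- of_real \<sigma>)))"
    by (intro set_integrable_norm gns_integrable_P) (use assms in simp)
  thus ?thesis
    by (rule set_integrable_cong[THEN iffD1, rotated -1]) (auto simp: norm_powr_P)
qed

lemma norm_prime_dirichlet_le:
  assumes "Re s > 1" shows "norm (prime_dirichlet P s) \<le> prime_real P (Re s)"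
  unfolding prime_dirichlet_def prime_real_def set_lebesgue_integral_def
  by (rule Bochner_Integration.integral_norm_bound_integral)
     (use gns_integrable_P[OF assms] prime_real_integrable[OF assms] in
       \<open>auto simp: set_integrable_def indicator_def norm_powr_P\<close>)

lemma prime_dirichlet_real:
  assumes "\<sigma> > 1" shows "prime_dirichlet P (of_real \<sigma>) = of_real (prime_real P \<sigma>)"
proof -
  have "prime_dirichlet P (of_real \<sigma>) = (\<integral>x. complex_of_real (indicator {1<..} x *\<^sub>R x powr (- \<sigma>)) \<partial>interval_measure P)"
    unfolding prime_dirichlet_def set_lebesgue_integral_def
    by (rule Bochner_Integration.integral_cong) (auto simp: indicator_def powr_of_real simp flip: of_real_minus)
  thus ?thesis by (simp only: integral_complex_of_real prime_real_def set_lebesgue_integral_def)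
qed

lemma prime_real_nonneg: "prime_real P \<sigma> \<ge> 0"
  unfolding prime_real_def set_lebesgue_integral_def
  by (rule integral_nonneg_AE) (auto simp: indicator_def)

lemma prime_real_antimono:
  assumes "1 < \<sigma>" "\<sigma> \<le> \<tau>" shows "prime_real P \<tau> \<le> prime_real P \<sigma>"
  unfolding prime_real_def
  by (rule set_integral_mono) (use assms prime_real_integrable in \<open>auto intro!: powr_mono\<close>)

text \<open>From \<open>3 + 4 cos \<theta> + cos (2 \<theta>) = 2 (1 + cos \<theta>)\<^sup>2 \<ge> 0\<close> and the positivity of \<open>dP\<close>.\<close>
lemma prime_three_four_one:
  assumes "\<sigma> > 1"
  shows "3 * prime_real P \<sigma> + 4 * Re (prime_dirichlet P (Complex \<sigma> t)) + Re (prime_dirichlet P (Complex \<sigma> (2 * t))) \<ge> 0"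
proof -
  define M where "M = interval_measure P"
  have i0: "integrable M (\<lambda>x. indicator {1<..} x * x powr (- \<sigma>))"
    using prime_real_integrable[OF assms] by (simp add: set_integrable_def M_def)
  have i1: "integrable M (\<lambda>x. Re (indicator {1<..} x *\<^sub>R complex_of_real x powr (- Complex \<sigma> u)))" for u
    using gns_integrable_P[of "Complex \<sigma> u"] assms unfolding set_integrable_def M_def by (intro integrable_Re) auto
  have e: "Re (prime_dirichlet P (Complex \<sigma> u)) = (\<integral>x. Re (indicator {1<..} x *\<^sub>R complex_of_real x powr (- Complex \<sigma> u)) \<partial>M)" for u
    using gns_integrable_P[of "Complex \<sigma> u"] assms unfolding prime_dirichlet_def set_lebesgue_integral_def set_integrable_def M_def
    by (intro integral_Re[symmetric]) auto
  have r: "Re (indicator {1<..} x *\<^sub>R complex_of_real x powr (- Complex \<sigma> u)) = indicator {1<..} x * x powr (- \<sigma>) * cos (u * ln x)" for x u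
  proof (cases "x > 1")
    case True
    have "complex_of_real x powr (- Complex \<sigma> u) = exp (- Complex \<sigma> u * of_real (ln x))"
      using True by (simp add: powr_def Ln_of_real)
    also have "Re \<dots> = exp (- \<sigma> * ln x) * cos (u * ln x)" by (simp add: Re_exp)
    also have "exp (- \<sigma> * ln x) = x powr (- \<sigma>)" using True by (simp add: powr_def)
    finally show ?thesis using True by simp
  qed simp
  have "3 * prime_real P \<sigma> + 4 * Re (prime_dirichlet P (Complex \<sigma> t)) + Re (prime_dirichlet P (Complex \<sigma> (2 * t))) =
    (\<integral>x. 3 * (indicator {1<..} x * x powr (- \<sigma>)) + 4 * Re (indicator {1<..} x *\<^sub>R complex_of_real x powr (- Complex \<sigma> t))
      + Re (indicator {1<..} x *\<^sub>R complex_of_real x powr (- Complex \<sigma> (2 * t))) \<partial>M)"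
    unfolding e prime_real_def set_lebesgue_integral_def M_def[symmetric]
    using i0 i1 by (simp add: Bochner_Integration.integral_add)
  also have "\<dots> \<ge> 0"
  proof (rule integral_nonneg_AE, rule AE_I2)
    fix x
    have "3 + 4 * cos (t * ln x) + cos (2 * t * ln x) = 2 * (1 + cos (t * ln x))\<^sup>2"
      using cos_double_cos[of "t * ln x"] by (simp add: power2_eq_square algebra_simps)
    hence "0 \<le> 3 + 4 * cos (t * ln x) + cos (2 * t * ln x)" by simp
    hence "0 \<le> indicator {1<..} x * x powr (- \<sigma>) * (3 + 4 * cos (t * ln x) + cos (2 * t * ln x))"
      by (intro mult_nonneg_nonneg) auto
    thus "0 \<le> 3 * (indicator {1<..} x * x powr (- \<sigma>)) + 4 * Re (indicator {1<..} x *\<^sub>R complex_of_real x powr (- Complex \<sigma> t))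
      + Re (indicator {1<..} x *\<^sub>R complex_of_real x powr (- Complex \<sigma> (2 * t)))"
      unfolding r by (simp add: algebra_simps)
  qed
  finally show ?thesis .
qed

end

lemma laplace_exp:
  fixes a :: real
  shows "laplace_class (\<lambda>v. if v \<ge> 0 then a * exp v else 0)"
    and "Re s > 1 \<Longrightarrow> laplace (\<lambda>v. if v \<ge> 0 then a * exp v else 0) s = of_real a / (s - 1)"
proof -
  show "laplace_class (\<lambda>v. if v \<ge> 0 then a * exp v else 0)"
    by (rule laplace_class_exp_bounded[where C = "\<bar>a\<bar>"]) (auto simp: abs_mult)
  assume s: "Re s > 1"
  have "laplace (\<lambda>v. if v \<ge> 0 then a * exp v else 0) s = (\<integral>v. of_real a * (indicator {0..} v *\<^sub>R exp (- (s - 1) * complex_of_real v)) \<partial>lborel)"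
    unfolding laplace_def
    by (rule Bochner_Integration.integral_cong)
       (auto simp: indicator_def algebra_simps exp_of_real[symmetric] simp flip: exp_add)
  also have "\<dots> = of_real a * (1 / (s - 1))"
    using s by (subst integral_mult_right_zero, subst integral_cexp_half_line) auto
  finally show "laplace (\<lambda>v. if v \<ge> 0 then a * exp v else 0) s = of_real a / (s - 1)" by simp
qed

section \<open>The Laplace transform of the logarithmic integral\<close>

lemma Li_has_derivative:
  assumes "x > 1" shows "(Li has_real_derivative 1 / ln x) (at x)"
proof -
  define a b where "a = (1 + min x 2) / 2" and "b = max x 2 + 1"
  have ab: "1 < a" "a < x" "a < 2" "x < b" "2 < b" using assms by (auto simp: a_def b_def)
  have "((\<lambda>u. LBINT y=ereal 2..u. 1 / ln y) has_vector_derivative 1 / ln x) (at x within {a..b})"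
    by (rule interval_integral_FTC2) (use ab in \<open>auto intro!: continuous_intros\<close>)
  hence "(Li has_real_derivative 1 / ln x) (at x within {a..b})"
    unfolding has_real_derivative_iff_has_vector_derivative Li_def[abs_def] by (simp add: numeral_eq_ereal)
  moreover have "at x within {a..b} = at x" by (rule at_within_Icc_at) (use ab in auto)
  ultimately show ?thesis by simp
qed

lemma Li_2: "Li 2 = 0"
  by (simp add: Li_def)

lemma Li_exp_has_derivative:
  assumes "v > 0" shows "((\<lambda>v. Li (exp v)) has_real_derivative exp v / v) (at v)"
  using DERIV_chain2[OF Li_has_derivative[of "exp v"] DERIV_exp] assms by simp

lemma Li_exp_mono:
  assumes "0 < v" "v \<le> w" shows "Li (exp v) \<le> Li (exp w)"
proof (rule DERIV_nonneg_imp_nondecreasing[OF assms(2)])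
  fix x assume "v \<le> x" "x \<le> w"
  hence "x > 0" using assms by simp
  thus "\<exists>y. ((\<lambda>v. Li (exp v)) has_real_derivative y) (at x) \<and> 0 \<le> y"
    using Li_exp_has_derivative[of x] by (intro exI[of _ "exp x / x"]) auto
qed

text \<open>Near \<open>v = 0\<close> the singularity of \<open>Li (exp v)\<close> is logarithmic: compare derivatives with \<open>2 ln v\<close>, using
\<open>exp v \<le> 2\<close>.\<close>
lemma Li_exp_lower:
  assumes "0 < v" "v \<le> ln 2" shows "2 * ln v - 2 * ln (ln 2) \<le> Li (exp v)" "Li (exp v) \<le> 0"
proof -
  have "Li (exp (ln 2)) - 2 * ln (ln 2) \<le> Li (exp v) - 2 * ln v"
  proof (rule DERIV_nonpos_imp_nonincreasing[OF assms(2)])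
    fix x assume x: "v \<le> x" "x \<le> ln 2"
    have "((\<lambda>v. Li (exp v) - 2 * ln v) has_real_derivative exp x / x - 2 * (1 / x)) (at x)"
      using x assms by (auto intro!: derivative_eq_intros Li_exp_has_derivative)
    moreover have "exp x \<le> exp (ln 2)" using x by (subst exp_le_cancel_iff)
    hence "exp x / x - 2 * (1 / x) \<le> 0" using x assms by (simp add: field_simps)
    ultimately show "\<exists>y. ((\<lambda>v. Li (exp v) - 2 * ln v) has_real_derivative y) (at x) \<and> y \<le> 0" by blast
  qed
  thus "2 * ln v - 2 * ln (ln 2) \<le> Li (exp v)" by (simp add: Li_2)
  show "Li (exp v) \<le> 0" using Li_exp_mono[OF assms] by (simp add: Li_2)
qed

lemma Li_exp_upper:
  assumes "v \<ge> ln 2" shows "0 \<le> Li (exp v)" "Li (exp v) \<le> exp v / ln 2"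
proof -
  have l2: "ln (2::real) > 0" by simp
  have "Li (exp v) - exp v / ln 2 \<le> Li (exp (ln 2)) - exp (ln 2) / ln 2"
  proof (rule DERIV_nonpos_imp_nonincreasing[OF assms])
    fix x :: real assume x: "ln 2 \<le> x" "x \<le> v"
    have x0: "x > 0" using x l2 by linarith
    have "((\<lambda>v. Li (exp v) - exp v / ln 2) has_real_derivative exp x / x - exp x / ln 2) (at x)"
      using x0 by (auto intro!: derivative_eq_intros Li_exp_has_derivative)
    moreover have "exp x / x - exp x / ln 2 \<le> 0"
      using divide_left_mono[of "ln 2" x "exp x"] x x0 l2 by simp
    ultimately show "\<exists>y. ((\<lambda>v. Li (exp v) - exp v / ln 2) has_real_derivative y) (at x) \<and> y \<le> 0" by blast
  qed
  hence "Li (exp v) - exp v / ln 2 \<le> - (2 / ln 2)" by (simp add: Li_2)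
  moreover have "0 \<le> 2 / ln (2::real)" by simp
  ultimately show "Li (exp v) \<le> exp v / ln 2" by linarith
  show "0 \<le> Li (exp v)" using Li_exp_mono[OF l2 assms] by (simp add: Li_2)
qed

lemma times_Li_exp_tendsto_0: "((\<lambda>v. v * Li (exp v)) \<longlongrightarrow> 0) (at_right 0)"
proof (rule Lim_null_comparison)
  define L where "L = ln (2::real)"
  have "eventually (\<lambda>v. v \<in> {0<..<L}) (at_right 0)"
    by (rule eventually_at_right_real) (simp add: L_def)
  thus "\<forall>\<^sub>F v in at_right 0. norm (v * Li (exp v)) \<le> v * (2 * ln L - 2 * ln v)"
  proof eventually_elim
    case (elim v)
    hence v: "v > 0" "v \<le> ln 2" by (auto simp: L_def)
    have "norm (v * Li (exp v)) = v * (- Li (exp v))" using v Li_exp_lower(2)[OF v] by (simp add: abs_mult)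
    also have "\<dots> \<le> v * (2 * ln L - 2 * ln v)"
      using v Li_exp_lower(1)[OF v] by (intro mult_left_mono) (auto simp: L_def)
    finally show ?case .
  qed
  show "((\<lambda>v. v * (2 * ln L - 2 * ln v)) \<longlongrightarrow> 0) (at_right 0)"
    by real_asymp
qed

lemma Li_exp_measurable [measurable]: "(\<lambda>v. if v \<ge> 0 then Li (exp v) else 0) \<in> borel_measurable borel"
proof -
  have "continuous_on {0<..} (\<lambda>v. Li (exp v))"
    by (rule continuous_at_imp_continuous_on) (auto intro!: DERIV_isCont Li_exp_has_derivative)
  hence [measurable]: "(\<lambda>v. indicator {0<..} v *\<^sub>R Li (exp v)) \<in> borel_measurable borel"
    by (intro borel_measurable_continuous_on_indicator) auto
  have "(\<lambda>v. indicator {0<..} v *\<^sub>R Li (exp v) + indicator {0} v * Li 1) \<in> borel_measurable borel"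
    by measurable
  also have "(\<lambda>v. indicator {0<..} v *\<^sub>R Li (exp v) + indicator {0} v * Li 1) = (\<lambda>v. if v \<ge> 0 then Li (exp v) else 0)"
    by (auto simp: fun_eq_iff indicator_def)
  finally show ?thesis .
qed

lemma Li_measurable: "(\<lambda>u. if u \<ge> 1 then Li u else 0) \<in> borel_measurable borel"
proof -
  have "(\<lambda>u. if u \<ge> 1 then (\<lambda>v. if v \<ge> 0 then Li (exp v) else 0) (ln u) else 0) \<in> borel_measurable borel"
    by measurable
  also have "(\<lambda>u. if u \<ge> 1 then (\<lambda>v. if v \<ge> 0 then Li (exp v) else 0) (ln u) else 0) = (\<lambda>u. if u \<ge> 1 then Li u else 0)"
    by (auto simp: fun_eq_iff)
  finally show ?thesis .
qed

text \<open>Integrability at \<open>0\<close> comes from the explicit antiderivative \<open>v Li (exp v) - exp v\<close> of \<open>Li (exp v)\<close>, which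
has a finite limit there.\<close>
lemma laplace_class_Li: "laplace_class (\<lambda>v. if v \<ge> 0 then Li (exp v) else 0)"
proof (rule laplace_class_dominated)
  define L where "L = ln (2::real)"
  have L: "L > 0" by (simp add: L_def)
  fix \<sigma> :: real assume s: "\<sigma> > 1"
  have "set_integrable lborel (einterval 0 (ereal L)) (\<lambda>v. - Li (exp v))"
  proof (rule interval_integral_FTC_nonneg)
    fix v assume v: "0 < ereal v" "ereal v < ereal L"
    hence v': "0 < v" "v < L" by (auto simp: zero_ereal_def)
    have "((\<lambda>v. exp v - v * Li (exp v)) has_real_derivative exp v - (1 * Li (exp v) + exp v / v * v)) (at v)"
      by (intro DERIV_diff DERIV_exp DERIV_mult DERIV_ident Li_exp_has_derivative v')
    thus "((\<lambda>v. exp v - v * Li (exp v)) has_real_derivative - Li (exp v)) (at v)" using v' by simp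
    show "isCont (\<lambda>v. - Li (exp v)) v"
      by (intro continuous_minus DERIV_isCont[OF Li_exp_has_derivative] v')
  next
    show "AE v in lborel. 0 < ereal v \<longrightarrow> ereal v < ereal L \<longrightarrow> 0 \<le> - Li (exp v)"
      using Li_exp_lower(2) by (auto simp: L_def zero_ereal_def)
    have "((\<lambda>v. exp v - v * Li (exp v)) \<longlongrightarrow> exp 0 - 0) (at_right 0)"
      by (intro tendsto_diff times_Li_exp_tendsto_0 tendsto_exp tendsto_ident_at)
    thus "(((\<lambda>v. exp v - v * Li (exp v)) \<circ> real_of_ereal) \<longlongrightarrow> 1) (at_right 0)"
      by (simp add: zero_ereal_def ereal_tendsto_simps)
    have "isCont (\<lambda>v. exp v - v * Li (exp v)) L"
      by (intro continuous_intros DERIV_isCont[OF Li_exp_has_derivative] L)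
    hence "((\<lambda>v. exp v - v * Li (exp v)) \<longlongrightarrow> exp L - L * Li (exp L)) (at_left L)"
      by (auto simp: isCont_def intro: filterlim_mono[OF _ order_refl at_le])
    thus "(((\<lambda>v. exp v - v * Li (exp v)) \<circ> real_of_ereal) \<longlongrightarrow> exp L - L * Li (exp L)) (at_left (ereal L))"
      by (simp add: ereal_tendsto_simps)
  qed (use L in \<open>auto simp: zero_ereal_def\<close>)
  moreover have "einterval 0 (ereal L) = {0<..<L}" by (auto simp: einterval_def zero_ereal_def)
  ultimately have i1: "integrable lborel (\<lambda>v. indicator {0<..<L} v * - Li (exp v))"
    by (simp add: set_integrable_def)
  have i2: "integrable lborel (\<lambda>v. indicator {0..} v * exp (- (\<sigma> - 1) * v))"
    by (rule integrable_exp_half_line) (use s in simp)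
  have i3: "integrable lborel (\<lambda>v. indicator {0::real} v * \<bar>Li 1\<bar>)"
    by (intro integrable_mult_left integrable_real_indicator) auto
  define g where "g = (\<lambda>v. indicator {0<..<L} v * - Li (exp v) + 1 / L * (indicator {0..} v * exp (- (\<sigma> - 1) * v)) + indicator {0} v * \<bar>Li 1\<bar>)"
  have "integrable lborel g" unfolding g_def
    by (intro Bochner_Integration.integrable_add integrable_mult_right i1 i2 i3)
  moreover have "\<bar>if v \<ge> 0 then Li (exp v) else 0\<bar> * exp (- \<sigma> * v) \<le> g v" if v: "v \<ge> 0" for v
  proof -
    consider "v = 0" | "0 < v" "v < L" | "v \<ge> L" using v by linarith
    thus ?thesis
    proof cases
      case 2
      have li: "Li (exp v) \<le> 0" by (rule Li_exp_lower(2)) (use 2 in \<open>auto simp: L_def\<close>)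
      have "- Li (exp v) * exp (- \<sigma> * v) \<le> - Li (exp v) * 1"
        using 2 s li by (intro mult_left_mono) auto
      moreover have "0 \<le> 1 / L * exp (- (\<sigma> - 1) * v)" using L by simp
      moreover have "g v = - Li (exp v) + 1 / L * exp (- (\<sigma> - 1) * v)" using 2 by (simp add: g_def)
      moreover have "\<bar>if v \<ge> 0 then Li (exp v) else 0\<bar> * exp (- \<sigma> * v) = - Li (exp v) * exp (- \<sigma> * v)"
        using 2 li by simp
      ultimately show ?thesis by linarith
    next
      case 3
      note li = Li_exp_upper[OF 3[unfolded L_def]]
      have "Li (exp v) * exp (- \<sigma> * v) \<le> exp v / L * exp (- \<sigma> * v)"
        using li by (intro mult_right_mono) (auto simp: L_def)
      also have "\<dots> = 1 / L * exp (- (\<sigma> - 1) * v)" by (simp add: algebra_simps flip: exp_add)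
      finally show ?thesis using 3 L li by (simp add: g_def)
    qed (use L in \<open>simp add: g_def\<close>)
  qed
  ultimately show "\<exists>g. integrable lborel g \<and> (\<forall>v\<ge>0. \<bar>if v \<ge> 0 then Li (exp v) else 0\<bar> * exp (- \<sigma> * v) \<le> g v)"
    by blast
qed auto

text \<open>With \<open>l v = Li (exp v)\<close>, the function \<open>v l v\<close> vanishes at \<open>0\<close> and has derivative \<open>l v + exp v\<close>.
Transforming this gives \<open>L + 1 / (s - 1) + s L' = 0\<close> for the transform \<open>L\<close> of \<open>l\<close>, so \<open>s L + log (s - 1)\<close> is
constant. This avoids principal values and leaves the constant undetermined, which is enough.\<close>
lemma laplace_Li:
  obtains c where "\<And>s. Re s > 1 \<Longrightarrow> laplace (\<lambda>v. if v \<ge> 0 then Li (exp v) else 0) s = (c - Ln (s - 1)) / s"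
proof -
  define l where "l = (\<lambda>v. if v \<ge> 0 then Li (exp v) else 0)"
  define ex where "ex = (\<lambda>v::real. if v \<ge> 0 then 1 * exp v else 0)"
  note ll = laplace_class_Li[folded l_def]
  have lm: "laplace_class (\<lambda>v. - v * l v)" using laplace_class_times_neg[OF ll, of 1] by simp
  note lex = laplace_exp[where a = 1, folded ex_def]
  have ode: "laplace l s + 1 / (s - 1) + s * laplace (\<lambda>v. - v * l v) s = 0" if s: "Re s > 1" for s
  proof -
    note i = laplace_integrable[OF _ s]
    define F where "F = (\<lambda>v. of_real (v * Li (exp v)) * exp (- s * complex_of_real v))"
    define f where "f = (\<lambda>v. of_real (Li (exp v)) * exp (- s * complex_of_real v) + of_real (exp v) * exp (- s * complex_of_real v)
        + s * (of_real (- v * Li (exp v)) * exp (- s * complex_of_real v)))"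
    have eq: "indicator {0..} v *\<^sub>R f v = of_real (l v) * exp (- s * complex_of_real v) + of_real (ex v) * exp (- s * complex_of_real v)
        + s * (of_real (- v * l v) * exp (- s * complex_of_real v))" for v
      by (auto simp: f_def l_def ex_def indicator_def)
    have "(\<integral>v. indicator {0..} v *\<^sub>R f v \<partial>lborel) = 0 - 0"
    proof (rule lborel_integral_FTC_half_line)
      fix v :: real assume v: "v > 0"
      have "((\<lambda>v. v * Li (exp v)) has_real_derivative 1 * Li (exp v) + exp v / v * v) (at v)"
        by (intro DERIV_mult DERIV_ident Li_exp_has_derivative v)
      hence "((\<lambda>v. v * Li (exp v)) has_real_derivative Li (exp v) + exp v) (at v)" using v by simp
      hence "((\<lambda>v. complex_of_real (v * Li (exp v))) has_vector_derivative of_real (Li (exp v) + exp v)) (at v)"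
        by (rule has_vector_derivative_of_real)
      moreover have "((\<lambda>v. exp (- s * complex_of_real v)) has_vector_derivative - s * exp (- s * complex_of_real v)) (at v)"
        by (rule has_vector_derivative_real_field) (auto intro!: derivative_eq_intros)
      ultimately have "(F has_vector_derivative (of_real (v * Li (exp v)) * (- s * exp (- s * complex_of_real v)) + of_real (Li (exp v) + exp v) * exp (- s * complex_of_real v))) (at v)"
        unfolding F_def by (rule has_vector_derivative_mult)
      thus "(F has_vector_derivative f v) (at v)" by (simp add: f_def algebra_simps)
      have "isCont (\<lambda>v. Li (exp v)) v" by (rule DERIV_isCont[OF Li_exp_has_derivative[OF v]])
      thus "isCont f v" unfolding f_def by (intro continuous_intros)
    next
      show "integrable lborel (\<lambda>v. indicator {0..} v *\<^sub>R f v)"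
        unfolding eq by (intro Bochner_Integration.integrable_add integrable_mult_right i ll lm lex(1))
      have "((\<lambda>v. of_real (v * Li (exp v)) * exp (- s * complex_of_real v)) \<longlongrightarrow> of_real 0 * exp (- s * of_real 0)) (at_right 0)"
        by (intro tendsto_intros times_Li_exp_tendsto_0)
      thus "(F \<longlongrightarrow> 0) (at_right 0)" by (simp add: F_def)
      define \<sigma> where "\<sigma> = Re s"
      have \<sigma>: "\<sigma> > 1" using s by (simp add: \<sigma>_def)
      show "(F \<longlongrightarrow> 0) at_top"
      proof (rule Lim_null_comparison)
        show "\<forall>\<^sub>F v in at_top. norm (F v) \<le> v * (exp v / ln 2) * exp (- \<sigma> * v)"
          using eventually_ge_at_top[of "ln 2"]
        proof eventually_elim
          case (elim v)
          have "ln (2::real) > 0" by simp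
          hence v: "v > 0" using elim by linarith
          note li = Li_exp_upper[OF elim]
          have "norm (F v) = v * Li (exp v) * exp (- \<sigma> * v)"
            using v li by (simp add: F_def norm_mult abs_mult \<sigma>_def)
          also have "\<dots> \<le> v * (exp v / ln 2) * exp (- \<sigma> * v)"
            using v li by (intro mult_right_mono mult_left_mono) auto
          finally show ?case .
        qed
        have "((\<lambda>v. v * exp (- (\<sigma> - 1) * v) / ln 2) \<longlongrightarrow> 0) at_top"
          using \<sigma> by real_asymp
        thus "((\<lambda>v. v * (exp v / ln 2) * exp (- \<sigma> * v)) \<longlongrightarrow> 0) at_top"
          by (simp add: algebra_simps flip: exp_add)
      qed
    qed
    moreover have "(\<integral>v. indicator {0..} v *\<^sub>R f v \<partial>lborel) = laplace l s + laplace ex s + s * laplace (\<lambda>v. - v * l v) s"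
      unfolding eq laplace_def using i[OF ll] i[OF lm] i[OF lex(1)]
      by (simp add: Bochner_Integration.integral_add)
    ultimately show ?thesis using lex(2)[OF s] by simp
  qed
  have "\<exists>c. \<forall>s\<in>{s. Re s > 1}. s * laplace l s + Ln (s - 1) = c"
  proof (rule has_field_derivative_zero_constant)
    show "convex {s. Re s > 1}" by (rule convex_halfspace_Re_gt)
    fix s assume "s \<in> {s. Re s > 1}"
    hence s: "Re s > 1" by simp
    have "((\<lambda>s. s * laplace l s + Ln (s - 1)) has_field_derivative (laplace l s + s * laplace (\<lambda>v. - v * l v) s + 1 / (s - 1))) (at s)"
      using s by (auto intro!: derivative_eq_intros laplace_has_field_derivative[OF ll s] simp: complex_nonpos_Reals_iff divide_inverse)
    moreover have "laplace l s + s * laplace (\<lambda>v. - v * l v) s + 1 / (s - 1) = 0" using ode[OF s] by (simp add: algebra_simps)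
    ultimately show "((\<lambda>s. s * laplace l s + Ln (s - 1)) has_field_derivative 0) (at s within {s. Re s > 1})"
      by (metis has_field_derivative_at_within)
  qed
  then obtain c where c: "\<And>s. Re s > 1 \<Longrightarrow> s * laplace l s + Ln (s - 1) = c" by auto
  show ?thesis
  proof (rule that[of c])
    fix s :: complex assume s: "Re s > 1"
    hence "s \<noteq> 0" by auto
    thus "laplace (\<lambda>v. if v \<ge> 0 then Li (exp v) else 0) s = (c - Ln (s - 1)) / s"
      using c[OF s] by (simp add: field_simps l_def)
  qed
qed

section \<open>Smooth extension to the closed half-plane\<close>

lemma closure_rhp: "closure {s. Re s > 1} = {s. Re s \<ge> 1}"
  using closure_halfspace_gt[of "1::complex" 1] by (simp add: inner_complex_def)

text \<open>Multiplying by a high power of \<open>1/s\<close> makes the derivative bounded, so the product is Lipschitz on the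
whole half-plane and extends to the closure.\<close>
lemma tempered_continuous_extension:
  assumes "tempered f"
  obtains H where "continuous_on {s. Re s \<ge> 1} H" "\<And>s. Re s > 1 \<Longrightarrow> H s = f s"
proof -
  obtain \<beta> where b: "deriv_bound 1 \<beta> f" using assms by (auto simp: tempered_def)
  define k where "k = nat \<lceil>\<beta>\<rceil>"
  have k: "\<beta> \<le> real k" unfolding k_def by linarith
  define g where "g = (\<lambda>s. f s * (1 / s) ^ k)"
  have "deriv_bound 1 (\<beta> + real k * (-1)) g"
    unfolding g_def using deriv_bound_reciprocal[of 1 0] by (intro deriv_bound_mult b deriv_bound_power) simp
  hence g: "deriv_bound 1 0 g" by (rule deriv_bound_mono) (use k in simp)
  obtain C where C: "C > 0" "\<And>s. Re s > 1 \<Longrightarrow> norm (deriv g s) \<le> C * (1 + norm s) powr 0"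
    using poly_boundE[OF deriv_bound_poly_bound[OF g order_refl]] by auto
  have C': "norm (deriv g s) \<le> C" if "Re s > 1" for s
  proof -
    have "1 + norm s > 0" using norm_ge_zero[of s] by linarith
    thus ?thesis using C(2)[OF that] by simp
  qed
  have lip: "norm (g x - g y) \<le> C * norm (x - y)" if "Re x > 1" "Re y > 1" for x y
  proof (rule field_differentiable_bound[where S = "{s. Re s > 1}" and f' = "deriv g"])
    show "convex {s. Re s > 1}" by (rule convex_halfspace_Re_gt)
    show "(g has_field_derivative deriv g z) (at z within {s. Re s > 1})" if "z \<in> {s. Re s > 1}" for z
      using holomorphic_derivI[OF deriv_bound_holomorphic[OF g] open_rhp that] has_field_derivative_at_within by blast
  qed (use C' that in auto)
  have "uniformly_continuous_on {s. Re s > 1} g"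
    unfolding uniformly_continuous_on_def
  proof (intro allI impI)
    fix e :: real assume e: "e > 0"
    show "\<exists>d>0. \<forall>x\<in>{s. Re s > 1}. \<forall>x'\<in>{s. Re s > 1}. dist x' x < d \<longrightarrow> dist (g x') (g x) < e"
    proof (intro exI[of _ "e / C"] conjI ballI impI)
      fix x x' assume x: "x \<in> {s. Re s > 1}" "x' \<in> {s. Re s > 1}" "dist x' x < e / C"
      have "dist (g x') (g x) \<le> C * dist x' x" using lip[of x' x] x by (simp add: dist_norm)
      also have "\<dots> < e" using x(3) C(1) by (simp add: field_simps)
      finally show "dist (g x') (g x) < e" .
    qed (use e C in auto)
  qed
  then obtain h where h: "uniformly_continuous_on (closure {s. Re s > 1}) h" "\<And>x. x \<in> {s. Re s > 1} \<Longrightarrow> g x = h x"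
    using uniformly_continuous_on_extension_on_closure by metis
  show ?thesis
  proof (rule that[of "\<lambda>s. h s * s ^ k"])
    show "continuous_on {s. Re s \<ge> 1} (\<lambda>s. h s * s ^ k)"
      using uniformly_continuous_imp_continuous[OF h(1)] by (auto simp: closure_rhp intro!: continuous_intros)
    fix s :: complex assume s: "Re s > 1"
    hence "s \<noteq> 0" by auto
    thus "h s * s ^ k = f s" using h(2)[of s] s by (simp add: g_def field_simps)
  qed
qed

lemma shift_right_in_rhp:
  assumes "Re s \<ge> 1" shows "Re (s + of_real (1 / real (Suc j))) > 1"
proof -
  have "1 / real (Suc j) > 0" by simp
  thus ?thesis using assms unfolding plus_complex.sel Re_complex_of_real by linarith
qed

lemma shift_right_tendsto:
  assumes "continuous_on {s. Re s \<ge> 1} F" "Re s \<ge> 1"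
  shows "(\<lambda>j. F (s + of_real (1 / real (Suc j)))) \<longlonglongrightarrow> F s"
proof (rule continuous_on_tendsto_compose[OF assms(1)])
  have "(\<lambda>j. 1 / real (Suc j)) \<longlonglongrightarrow> 0" by real_asymp
  hence "(\<lambda>j. s + complex_of_real (1 / real (Suc j))) \<longlonglongrightarrow> s + of_real 0" by (intro tendsto_intros)
  thus "(\<lambda>j. s + complex_of_real (1 / real (Suc j))) \<longlonglongrightarrow> s" by simp
qed (use assms(2) in \<open>auto intro!: always_eventually add_increasing2\<close>)

text \<open>Continuous extensions of the derivatives are automatically derivatives of the extension: the quadratic
Taylor estimate holds inside with a constant given by a local bound for \<open>F (n + 2)\<close>, and it
persists when both points move to the boundary.\<close>
lemma boundary_has_field_derivative:
  assumes hol: "f holomorphic_on {s. Re s > 1}"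
    and cont: "\<And>n. continuous_on {s. Re s \<ge> 1} (F n)"
    and eq: "\<And>n s. Re s > 1 \<Longrightarrow> F n s = (deriv ^^ n) f s"
    and s0: "Re s0 \<ge> 1"
  shows "(F n has_field_derivative F (Suc n) s0) (at s0 within {s. Re s \<ge> 1})"
proof -
  define K where "K = {s. Re s \<ge> 1} \<inter> cball s0 2"
  have "compact K" unfolding K_def by (intro closed_Int_compact closed_halfspace_Re_ge compact_cball)
  hence "bounded (F (Suc (Suc n)) ` K)"
    by (intro compact_imp_bounded compact_continuous_image continuous_on_subset[OF cont]) (auto simp: K_def)
  then obtain M where M: "\<And>s. s \<in> K \<Longrightarrow> norm (F (Suc (Suc n)) s) \<le> M" by (auto simp: bounded_iff)
  define S where "S = {s. Re s > 1} \<inter> cball s0 2"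
  have cS: "convex S" unfolding S_def by (intro convex_Int convex_halfspace_Re_gt convex_cball)
  have dF: "((deriv ^^ k) f has_field_derivative (deriv ^^ Suc k) f z) (at z within S)" if "z \<in> S" for k z
    using holomorphic_derivI[OF holomorphic_higher_deriv[OF hol open_rhp] open_rhp, of z k] that
    by (auto simp: S_def intro: has_field_derivative_at_within)
  have taylor: "norm (F n z - (F n w + F (Suc n) w * (z - w))) \<le> M * norm (z - w) ^ 2" if "z \<in> S" "w \<in> S" for z w
  proof -
    have "norm ((deriv ^^ (0 + n)) f z - (\<Sum>i\<le>1. (deriv ^^ (i + n)) f w * (z - w) ^ i / fact i)) \<le> M * norm (z - w) ^ Suc 1 / fact 1"
    proof (rule complex_Taylor[OF cS, where f = "\<lambda>i. (deriv ^^ (i + n)) f"])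
      fix x assume x: "x \<in> S"
      have "x \<in> K" using x by (auto simp: K_def S_def)
      from M[OF this] show "norm ((deriv ^^ (Suc 1 + n)) f x) \<le> M"
        using eq[of x "Suc (Suc n)"] x by (auto simp: S_def)
    next
      fix i x assume x: "x \<in> S"
      show "((deriv ^^ (i + n)) f has_field_derivative (deriv ^^ (Suc i + n)) f x) (at x within S)"
        using dF[OF x, of "i + n"] by simp
    qed (use that in auto)
    thus ?thesis using that eq by (simp add: S_def numeral_2_eq_2 add.commute)
  qed
  have quad: "norm (F n s - (F n s0 + F (Suc n) s0 * (s - s0))) \<le> M * norm (s - s0) ^ 2"
    if s: "Re s \<ge> 1" "norm (s - s0) < 1" for s
  proof -
    define x where "x = (\<lambda>z j. z + complex_of_real (1 / real (Suc j)))"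
    have "norm (F n (x s j) - (F n (x s0 j) + F (Suc n) (x s0 j) * (x s j - x s0 j))) \<le> M * norm (x s j - x s0 j) ^ 2" for j
    proof (rule taylor)
      define c where "c = complex_of_real (1 / real (Suc j))"
      have x: "x z j = z + c" for z by (simp only: x_def c_def)
      have 1: "norm c \<le> 1" unfolding c_def norm_of_real by (simp add: field_simps)
      have "norm (s + c - s0) \<le> norm (s - s0) + norm c"
        by (rule order_trans[OF _ norm_triangle_ineq]) (simp add: algebra_simps)
      hence 2: "norm (s + c - s0) \<le> 2" using 1 s(2) by linarith
      have re: "Re (s + c) > 1" "Re (s0 + c) > 1"
        unfolding c_def by (rule shift_right_in_rhp, rule s(1), rule shift_right_in_rhp, rule s0)
      show "x s j \<in> S" using re(1) 2 by (simp add: S_def x dist_norm norm_minus_commute)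
      show "x s0 j \<in> S" using re(2) 1 by (simp add: S_def x dist_norm)
    qed
    hence le: "norm (F n (x s j) - (F n (x s0 j) + F (Suc n) (x s0 j) * (s - s0))) \<le> M * norm (s - s0) ^ 2" for j
      by (simp add: x_def)
    have "(\<lambda>j. norm (F n (x s j) - (F n (x s0 j) + F (Suc n) (x s0 j) * (s - s0)))) \<longlonglongrightarrow> norm (F n s - (F n s0 + F (Suc n) s0 * (s - s0)))"
      unfolding x_def by (intro tendsto_intros shift_right_tendsto cont s s0)
    thus ?thesis by (rule LIMSEQ_le_const2) (use le in auto)
  qed
  show ?thesis
    unfolding has_field_derivative_iff
  proof (rule Lim_null[THEN iffD2], rule Lim_null_comparison)
    show "\<forall>\<^sub>F s in at s0 within {s. Re s \<ge> 1}. norm ((F n s - F n s0) / (s - s0) - F (Suc n) s0) \<le> M * norm (s - s0)"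
      unfolding eventually_at
    proof (intro exI[of _ 1] conjI ballI impI)
      fix s assume s: "s \<in> {s. Re s \<ge> 1}" "s \<noteq> s0 \<and> dist s s0 < 1"
      have "(F n s - F n s0) / (s - s0) - F (Suc n) s0 = (F n s - (F n s0 + F (Suc n) s0 * (s - s0))) / (s - s0)"
        using s by (simp add: field_simps)
      also have "norm \<dots> \<le> M * norm (s - s0) ^ 2 / norm (s - s0)"
        unfolding norm_divide using quad[of s] s by (intro divide_right_mono) (auto simp: dist_norm)
      also have "\<dots> = M * norm (s - s0)" using s by (simp add: power2_eq_square)
      finally show "norm ((F n s - F n s0) / (s - s0) - F (Suc n) s0) \<le> M * norm (s - s0)" .
    qed simp
    have "((\<lambda>s. M * norm (s - s0)) \<longlongrightarrow> M * norm (s0 - s0)) (at s0 within {s. Re s \<ge> 1})" by (intro tendsto_intros)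
    thus "((\<lambda>s. M * norm (s - s0)) \<longlongrightarrow> 0) (at s0 within {s. Re s \<ge> 1})" by simp
  qed
qed

text \<open>Along the line \<open>Re s = 1\<close> each differentiation in \<open>t\<close> contributes a factor \<open>\<i>\<close>, so the derivatives in the
definition of \<open>O_M\<close> have the absolute values of the extended derivatives of \<open>f\<close>.\<close>
lemma boundary_vector_derivative:
  assumes hol: "f holomorphic_on {s. Re s > 1}"
    and cont: "\<And>n. continuous_on {s. Re s \<ge> 1} (F n)"
    and eq: "\<And>n s. Re s > 1 \<Longrightarrow> F n s = (deriv ^^ n) f s"
  shows "((\<lambda>t. \<i> ^ n * F n (1 + \<i> * complex_of_real t)) has_vector_derivative \<i> ^ Suc n * F (Suc n) (1 + \<i> * of_real t)) (at t)"
    and "nth_vector_derivative n (\<lambda>t. F 0 (1 + \<i> * complex_of_real t)) = (\<lambda>t. \<i> ^ n * F n (1 + \<i> * of_real t))"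
proof -
  have vd: "((\<lambda>t. \<i> ^ n * F n (1 + \<i> * complex_of_real t)) has_vector_derivative \<i> ^ Suc n * F (Suc n) (1 + \<i> * of_real t)) (at t)" for n t
  proof -
    have "((\<lambda>t. 1 + \<i> * complex_of_real t) has_vector_derivative \<i>) (at t)"
      by (rule has_vector_derivative_real_field) (auto intro!: derivative_eq_intros)
    moreover have "(F n has_field_derivative F (Suc n) (1 + \<i> * of_real t)) (at (1 + \<i> * of_real t) within (\<lambda>t. 1 + \<i> * complex_of_real t) ` UNIV)"
      by (rule has_field_derivative_subset[OF boundary_has_field_derivative[OF hol cont eq]]) auto
    ultimately have "(F n \<circ> (\<lambda>t. 1 + \<i> * complex_of_real t) has_vector_derivative \<i> * F (Suc n) (1 + \<i> * of_real t)) (at t)"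
      by (rule field_vector_diff_chain_within)
    from has_vector_derivative_mult_right[OF this, of "\<i> ^ n"] show ?thesis by (simp add: o_def mult_ac)
  qed
  thus "((\<lambda>t. \<i> ^ n * F n (1 + \<i> * complex_of_real t)) has_vector_derivative \<i> ^ Suc n * F (Suc n) (1 + \<i> * of_real t)) (at t)" .
  show "nth_vector_derivative n (\<lambda>t. F 0 (1 + \<i> * complex_of_real t)) = (\<lambda>t. \<i> ^ n * F n (1 + \<i> * of_real t))"
  proof (induction n)
    case (Suc n)
    have "nth_vector_derivative (Suc n) g = (\<lambda>t. vector_derivative (nth_vector_derivative n g) (at t))" for g
      by (simp add: nth_vector_derivative_def)
    thus ?case using vector_derivative_at[OF vd[of n]] by (simp only: Suc)
  qed (simp add: nth_vector_derivative_def)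
qed

lemma smooth_extension_of_tempered:
  assumes t: "tempered f"
  shows "\<exists>H. smooth_extension f H \<and> (\<lambda>t. H (1 + \<i> * complex_of_real t)) \<in> O_M"
proof -
  have hol: "f holomorphic_on {s. Re s > 1}" by (rule tempered_holomorphic[OF t])
  have "\<exists>H. continuous_on {s. Re s \<ge> 1} H \<and> (\<forall>s. Re s > 1 \<longrightarrow> H s = (deriv ^^ n) f s)" for n
    using tempered_continuous_extension[OF tempered_higher_deriv[OF t, of n]] by metis
  then obtain F where cont: "\<And>n. continuous_on {s. Re s \<ge> 1} (F n)"
    and eq: "\<And>n s. Re s > 1 \<Longrightarrow> F n s = (deriv ^^ n) f s" by metis
  have "smooth_extension f (F 0)"
    unfolding smooth_extension_def using hol cont eq by (intro conjI exI[of _ F]) auto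
  moreover have "(\<lambda>t. F 0 (1 + \<i> * complex_of_real t)) \<in> O_M"
    unfolding O_M_def mem_Collect_eq
  proof (intro conjI allI)
    have nd: "nth_vector_derivative n (\<lambda>t. F 0 (1 + \<i> * complex_of_real t)) = (\<lambda>t. \<i> ^ n * F n (1 + \<i> * of_real t))" for n
      by (rule boundary_vector_derivative(2)[OF hol cont]) (rule eq)
    fix n
    show "nth_vector_derivative n (\<lambda>t. F 0 (1 + \<i> * complex_of_real t)) differentiable at t" for t
      unfolding nd by (rule differentiableI_vector, rule boundary_vector_derivative(1)[OF hol cont]) (rule eq)
    obtain C \<beta> where C: "C > 0" "\<beta> \<ge> 0" "\<And>s. Re s > 1 \<Longrightarrow> norm ((deriv ^^ n) f s) \<le> C * (1 + norm s) powr \<beta>"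
      using tempered_derivE[OF t] by metis
    have bd: "norm (F n s) \<le> C * (1 + norm s) powr \<beta>" if s: "Re s \<ge> 1" for s
    proof (rule LIMSEQ_le)
      show "(\<lambda>j. norm (F n (s + of_real (1 / real (Suc j))))) \<longlonglongrightarrow> norm (F n s)"
        by (intro tendsto_norm shift_right_tendsto cont s)
      show "(\<lambda>j. C * (1 + norm (s + of_real (1 / real (Suc j)))) powr \<beta>) \<longlonglongrightarrow> C * (1 + norm s) powr \<beta>"
      proof (rule shift_right_tendsto[OF _ s])
        have "1 + norm s \<noteq> 0" for s :: complex using norm_ge_zero[of s] by linarith
        thus "continuous_on {s. Re s \<ge> 1} (\<lambda>s. C * (1 + norm s) powr \<beta>)"
          by (auto intro!: continuous_intros)
      qed
      have "norm (F n (s + of_real (1 / real (Suc j)))) \<le> C * (1 + norm (s + of_real (1 / real (Suc j)))) powr \<beta>" for j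
      proof -
        have "Re (s + of_real (1 / real (Suc j))) > 1" by (rule shift_right_in_rhp[OF s])
        thus ?thesis using C(3) eq by metis
      qed
      thus "\<exists>N. \<forall>j\<ge>N. norm (F n (s + of_real (1 / real (Suc j)))) \<le> C * (1 + norm (s + of_real (1 / real (Suc j)))) powr \<beta>"
        by blast
    qed
    have "(\<lambda>t. norm (nth_vector_derivative n (\<lambda>t. F 0 (1 + \<i> * complex_of_real t)) t)) \<in> O[at_infinity](\<lambda>t. \<bar>t\<bar> powr \<beta>)"
    proof (rule bigoI[where c = "C * 3 powr \<beta>"])
      have "eventually (\<lambda>t::real. norm t \<ge> 1) at_infinity"
        unfolding eventually_at_infinity by auto
      thus "\<forall>\<^sub>F t in at_infinity. norm (norm (nth_vector_derivative n (\<lambda>t. F 0 (1 + \<i> * complex_of_real t)) t)) \<le> C * 3 powr \<beta> * norm (\<bar>t\<bar> powr \<beta>)"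
      proof eventually_elim
        case (elim t)
        have "norm (norm (nth_vector_derivative n (\<lambda>t. F 0 (1 + \<i> * complex_of_real t)) t)) = norm (F n (1 + \<i> * of_real t))"
          unfolding nd by (simp add: norm_mult norm_power)
        also have "\<dots> \<le> C * (1 + norm (1 + \<i> * complex_of_real t)) powr \<beta>" by (rule bd) simp
        also have "norm (1 + \<i> * complex_of_real t) \<le> 1 + \<bar>t\<bar>"
          by (rule norm_triangle_le) (simp add: norm_mult)
        hence "C * (1 + norm (1 + \<i> * complex_of_real t)) powr \<beta> \<le> C * (3 * \<bar>t\<bar>) powr \<beta>"
          using elim C by (intro mult_left_mono powr_mono2) (auto intro: add_nonneg_nonneg)
        also have "\<dots> = C * 3 powr \<beta> * norm (\<bar>t\<bar> powr \<beta>)" by (simp add: powr_mult)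
        finally show ?case .
      qed
    qed
    thus "\<exists>\<beta>. (\<lambda>t. norm (nth_vector_derivative n (\<lambda>t. F 0 (1 + \<i> * complex_of_real t)) t)) \<in> O[at_infinity](\<lambda>t. \<bar>t\<bar> powr \<beta>)" ..
  qed
  ultimately show ?thesis by blast
qed

text \<open>Cauchy's inequality on a disc of half the distance to the line \<open>Re s = 1\<close>.\<close>
lemma higher_deriv_interior_bound:
  assumes hol: "G holomorphic_on {s. Re s > 1}"
    and C: "\<And>s. 1 < Re s \<Longrightarrow> Re s \<le> 3 \<Longrightarrow> norm (G s) \<le> C / (Re s - 1)"
    and s: "1 < Re s" "Re s \<le> 2"
  shows "norm ((deriv ^^ n) G s) \<le> fact n * 2 ^ Suc n * C / (Re s - 1) ^ Suc n"
proof -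
  define r where "r = (Re s - 1) / 2"
  have r: "r > 0" using s by (simp add: r_def)
  have "norm (G 2) \<le> C" using C[of 2] by simp
  hence C0: "C \<ge> 0" using norm_ge_zero[of "G 2"] by linarith
  have re: "Re x - 1 \<ge> r" "Re x \<le> 3" if "norm (s - x) \<le> r" for x
  proof -
    have "\<bar>Re s - Re x\<bar> \<le> r" using abs_Re_le_cmod[of "s - x"] that by simp
    hence 1: "Re s - Re x \<le> r" "Re x - Re s \<le> r" by linarith+
    show "Re x - 1 \<ge> r" using 1 s unfolding r_def by argo
    show "Re x \<le> 3" using 1 s unfolding r_def by argo
  qed
  have sub: "cball s r \<subseteq> {s. Re s > 1}" using re(1) r by (force simp: dist_norm)
  have "norm ((deriv ^^ n) G s) \<le> fact n * (C / r) / r ^ n"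
  proof (rule Cauchy_inequality)
    show "G holomorphic_on ball s r" by (rule holomorphic_on_subset[OF hol]) (use sub ball_subset_cball in blast)
    show "continuous_on (cball s r) G"
      by (rule holomorphic_on_imp_continuous_on, rule holomorphic_on_subset[OF hol sub])
    fix x assume x: "norm (s - x) = r"
    have "norm (G x) \<le> C / (Re x - 1)" by (rule C) (use re[of x] x r in auto)
    also have "\<dots> \<le> C / r" using re(1)[of x] x r C0 by (intro divide_left_mono) auto
    finally show "norm (G x) \<le> C / r" .
  qed (fact r)
  also have "fact n * (C / r) / r ^ n = fact n * 2 ^ Suc n * C / (Re s - 1) ^ Suc n"
    using r s by (simp add: r_def power_divide field_simps)
  finally show ?thesis .
qed

lemma higher_deriv_right_bound:
  assumes hol: "G holomorphic_on {s. Re s > 1}"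
    and D: "\<And>s. Re s \<ge> 3 / 2 \<Longrightarrow> norm (G s) \<le> D"
    and s: "Re s \<ge> 2"
  shows "norm ((deriv ^^ n) G s) \<le> fact n * D * 2 ^ n"
proof -
  have re: "Re x \<ge> 3 / 2" if "norm (s - x) \<le> 1 / 2" for x
    using abs_Re_le_cmod[of "s - x"] that s unfolding minus_complex.simps by linarith
  have sub: "cball s (1 / 2) \<subseteq> {s. Re s > 1}" using re by (force simp: dist_norm)
  have "norm ((deriv ^^ n) G s) \<le> fact n * D / (1 / 2) ^ n"
  proof (rule Cauchy_inequality)
    show "G holomorphic_on ball s (1 / 2)" by (rule holomorphic_on_subset[OF hol]) (use sub ball_subset_cball in blast)
    show "continuous_on (cball s (1 / 2)) G"
      by (rule holomorphic_on_imp_continuous_on, rule holomorphic_on_subset[OF hol sub])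
  qed (use re D in auto)
  thus ?thesis by (simp add: power_divide)
qed

text \<open>The bound \<open>K / (Re s - 1)\<^sup>n\<^sup>+\<^sup>1\<close> for the \<open>n\<close>-th derivative blows up at \<open>Re s = 1\<close>. On the rectangle
\<open>[1, 2] \<times> [t0 - 1, t0 + 1]\<close> with \<open>w0 = 1 + i t0\<close>, multiply the derivative by \<open>((s - w0)\<^sup>2 + 1)\<^sup>n\<^sup>+\<^sup>1\<close>. This
factor vanishes to the right order at the two corners \<open>w0 \<plusminus> i\<close>, so on the horizontal sides it cancels the
singularity; on the vertical sides the derivative itself is controlled. On the middle line \<open>Im s = t0\<close>
the factor is at least \<open>1\<close>, and the maximum modulus principle gives the estimate there.\<close>
lemma tempered_of_smooth_extension:
  assumes ext: "smooth_extension G H" and OM: "(\<lambda>t. H (1 + \<i> * complex_of_real t)) \<in> O_M"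
    and C: "\<And>s. 1 < Re s \<Longrightarrow> Re s \<le> 3 \<Longrightarrow> norm (G s) \<le> C / (Re s - 1)"
    and D: "\<And>s. Re s \<ge> 3 / 2 \<Longrightarrow> norm (G s) \<le> D"
  shows "tempered G"
proof -
  obtain F where hol: "G holomorphic_on {s. Re s > 1}" and F0: "F 0 = H"
    and cont: "\<And>n. continuous_on {s. Re s \<ge> 1} (F n)"
    and eq: "\<And>n s. Re s > 1 \<Longrightarrow> F n s = (deriv ^^ n) G s"
    using ext unfolding smooth_extension_def by blast
  have nd: "nth_vector_derivative n (\<lambda>t. F 0 (1 + \<i> * complex_of_real t)) = (\<lambda>t. \<i> ^ n * F n (1 + \<i> * of_real t))" for n
    by (rule boundary_vector_derivative(2)[OF hol cont]) (rule eq)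
  have "norm (G 2) \<le> C" using C[of 2] by simp
  hence C0: "C \<ge> 0" using norm_ge_zero[of "G 2"] by linarith
  have "norm (G 2) \<le> D" by (rule D) auto
  hence D0: "D \<ge> 0" using norm_ge_zero[of "G 2"] by linarith
  have "\<exists>\<beta>. poly_bound \<beta> ((deriv ^^ n) G)" for n
  proof -
    obtain A \<beta> where A: "A \<ge> 0" "\<beta> \<ge> 0" "\<And>t::real. norm (F n (1 + \<i> * of_real t)) \<le> A * (1 + \<bar>t\<bar>) powr \<beta>"
    proof -
      obtain \<beta> where "(\<lambda>t. norm (nth_vector_derivative n (\<lambda>t. H (1 + \<i> * complex_of_real t)) t)) \<in> O[at_infinity](\<lambda>t. \<bar>t\<bar> powr \<beta>)"
        using OM unfolding O_M_def by blast
      then obtain c where c: "c > 0" and "\<forall>\<^sub>F t in at_infinity. norm (norm (nth_vector_derivative n (\<lambda>t. H (1 + \<i> * complex_of_real t)) t)) \<le> c * norm (\<bar>t\<bar> powr \<beta>)"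
        by (elim landau_o.bigE) auto
      then obtain T where T: "\<And>t. \<bar>t\<bar> \<ge> T \<Longrightarrow> norm (F n (1 + \<i> * of_real t)) \<le> c * \<bar>t\<bar> powr \<beta>"
        unfolding eventually_at_infinity F0[symmetric] nd by (auto simp: norm_mult norm_power)
      have "compact ((\<lambda>t. F n (1 + \<i> * complex_of_real t)) ` {- \<bar>T\<bar> - 1..\<bar>T\<bar> + 1})"
        by (intro compact_continuous_image continuous_on_compose2[OF cont]) (auto intro!: continuous_intros)
      hence "bounded ((\<lambda>t. F n (1 + \<i> * complex_of_real t)) ` {- \<bar>T\<bar> - 1..\<bar>T\<bar> + 1})"
        by (rule compact_imp_bounded)
      then obtain K where K: "\<And>t. t \<in> {- \<bar>T\<bar> - 1..\<bar>T\<bar> + 1} \<Longrightarrow> norm (F n (1 + \<i> * of_real t)) \<le> K"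
        unfolding bounded_iff ball_simps(9) by metis
      have K0: "K \<ge> 0" by (rule order_trans[OF norm_ge_zero K[of 0]]) simp
      define \<gamma> where "\<gamma> = max 0 \<beta>"
      show ?thesis
      proof (rule that[of "c + K" \<gamma>])
        fix t :: real
        have ge1: "(1 + \<bar>t\<bar>) powr \<gamma> \<ge> 1" by (rule ge_one_powr_ge_zero) (auto simp: \<gamma>_def)
        show "norm (F n (1 + \<i> * of_real t)) \<le> (c + K) * (1 + \<bar>t\<bar>) powr \<gamma>"
        proof (cases "\<bar>t\<bar> \<ge> \<bar>T\<bar> + 1")
          case True
          have "norm (F n (1 + \<i> * of_real t)) \<le> c * \<bar>t\<bar> powr \<beta>" by (rule T) (use True in auto)
          also have "\<dots> \<le> c * (1 + \<bar>t\<bar>) powr \<gamma>"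
            using True c by (intro mult_left_mono order_trans[OF powr_mono powr_mono2]) (auto simp: \<gamma>_def)
          also have "\<dots> \<le> (c + K) * (1 + \<bar>t\<bar>) powr \<gamma>" using K0 by (intro mult_right_mono) auto
          finally show ?thesis .
        next
          case False
          have "t \<in> {- \<bar>T\<bar> - 1..\<bar>T\<bar> + 1}" unfolding atLeastAtMost_iff using False by linarith
          hence "norm (F n (1 + \<i> * of_real t)) \<le> K * 1" using K[of t] by simp
          also have "\<dots> \<le> (c + K) * (1 + \<bar>t\<bar>) powr \<gamma>" using K0 c ge1 by (intro mult_mono) auto
          finally show ?thesis .
        qed
      qed (use c K0 in \<open>auto simp: \<gamma>_def\<close>)
    qed
    define Kn where "Kn = fact n * 2 ^ Suc n * C"
    define Dn where "Dn = fact n * D * 2 ^ n"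
    have Kn: "Kn \<ge> 0" and Dn: "Dn \<ge> 0" using C0 D0 by (auto simp: Kn_def Dn_def)
    have strip: "norm (F n s0) \<le> 3 ^ Suc n * (A * (2 + \<bar>Im s0\<bar>) powr \<beta> + Dn + Kn)" if s0: "1 < Re s0" "Re s0 < 2" for s0
    proof -
      define t0 where "t0 = Im s0"
      define w0 where "w0 = Complex 1 t0"
      define R where "R = cbox (Complex 1 (t0 - 1)) (Complex 2 (t0 + 1))"
      define f where "f = (\<lambda>s. F n s * ((s - w0)\<^sup>2 + 1) ^ Suc n)"
      define B where "B = A * (2 + \<bar>t0\<bar>) powr \<beta> + Dn + Kn"
      have P: "A * (2 + \<bar>t0\<bar>) powr \<beta> \<ge> 0" using A by simp
      have "norm (f s0) \<le> 3 ^ Suc n * B"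
      proof (rule maximum_modulus_frontier[where S = R and f = f])
        have int: "interior R \<subseteq> {s. Re s > 1}" by (auto simp: R_def in_box_complex_iff interior_cbox)
        have "F n holomorphic_on interior R"
          by (rule holomorphic_transform[OF holomorphic_on_subset[OF holomorphic_higher_deriv[OF hol open_rhp, of n] int]])
             (use int eq in auto)
        thus "f holomorphic_on interior R" unfolding f_def by (intro holomorphic_intros)
        have "closure R \<subseteq> {s. Re s \<ge> 1}" unfolding R_def by (auto simp: in_cbox_complex_iff)
        thus "continuous_on (closure R) f"
          unfolding f_def by (intro continuous_intros continuous_on_subset[OF cont])
        show "bounded R" by (simp add: R_def bounded_cbox)
        show "s0 \<in> R" using s0 by (simp add: R_def in_cbox_complex_iff t0_def)
        fix s assume "s \<in> frontier R"
        hence "s \<in> R" and nb: "s \<notin> box (Complex 1 (t0 - 1)) (Complex 2 (t0 + 1))"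
          by (auto simp: R_def frontier_cbox)
        hence s: "1 \<le> Re s" "Re s \<le> 2" "t0 - 1 \<le> Im s" "Im s \<le> t0 + 1"
          by (auto simp: R_def in_cbox_complex_iff)
        define x y where "x = Re s - 1" and "y = Im s - t0"
        have xy: "0 \<le> x" "x \<le> 1" "\<bar>y\<bar> \<le> 1" using s by (auto simp: x_def y_def)
        have z: "s - w0 = Complex x y" by (simp add: w0_def x_def y_def complex_eq_iff)
        have fac3: "norm ((s - w0)\<^sup>2 + 1) \<le> 3"
        proof -
          have "norm ((s - w0)\<^sup>2 + 1) \<le> norm (s - w0) ^ 2 + 1"
            by (rule norm_triangle_le) (simp add: norm_power)
          also have "norm (s - w0) ^ 2 = x\<^sup>2 + y\<^sup>2" by (simp add: z cmod_def)
          also have "x\<^sup>2 \<le> 1" using xy by (simp add: power_le_one)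
          also have "y\<^sup>2 \<le> 1" using xy by (simp add: abs_square_le_1)
          finally show ?thesis by simp
        qed
        have nf: "norm (f s) = norm (F n s) * norm ((s - w0)\<^sup>2 + 1) ^ Suc n"
          by (simp only: f_def norm_mult norm_power)
        have easy: "norm (f s) \<le> 3 ^ Suc n * B" if "norm (F n s) \<le> B"
        proof -
          have "norm (f s) \<le> B * 3 ^ Suc n"
            unfolding nf using that fac3 P Kn Dn by (intro mult_mono power_mono) (auto simp: B_def)
          thus ?thesis by (simp add: mult.commute)
        qed
        consider "Re s = 1" | "Re s = 2" | "1 < Re s" "\<bar>y\<bar> = 1"
          using nb s unfolding in_box_complex_iff complex.sel greaterThanLessThan_iff y_def by argo
        thus "norm (f s) \<le> 3 ^ Suc n * B"
        proof cases
          case 1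
          have "s = 1 + \<i> * of_real (Im s)" using 1 by (simp add: complex_eq_iff)
          hence "norm (F n s) \<le> A * (1 + \<bar>Im s\<bar>) powr \<beta>" using A(3)[of "Im s"] by simp
          also have "\<dots> \<le> A * (2 + \<bar>t0\<bar>) powr \<beta>"
            using A s by (intro mult_left_mono powr_mono2) auto
          finally show ?thesis using Kn Dn by (intro easy) (simp add: B_def)
        next
          case 2
          have "norm (F n s) \<le> Dn"
            using higher_deriv_right_bound[OF hol D, of s n] eq[of s n] 2 by (simp add: Dn_def)
          thus ?thesis using Kn P by (intro easy) (simp add: B_def)
        next
          case 3
          have x0: "x > 0" using 3 by (simp add: x_def)
          have "norm (F n s) \<le> Kn / x ^ Suc n"
            using higher_deriv_interior_bound[OF hol C 3(1) s(2), of n] eq[of s n] 3 by (simp add: Kn_def x_def)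
          moreover have "norm ((s - w0)\<^sup>2 + 1) \<le> 3 * x"
          proof -
            have y2: "y\<^sup>2 = 1" using 3(2) by (metis power2_abs one_power2)
            have "(s - w0)\<^sup>2 + 1 = of_real x * Complex x (2 * y)"
              using y2 by (simp add: z complex_eq_iff power2_eq_square)
            also have "norm \<dots> \<le> x * 3"
            proof -
              have "norm (Complex x (2 * y)) \<le> \<bar>x\<bar> + \<bar>2 * y\<bar>" using cmod_le[of "Complex x (2 * y)"] by simp
              also have "\<dots> \<le> 3" using xy by simp
              finally show ?thesis using x0 by (simp add: norm_mult)
            qed
            finally show ?thesis by simp
          qed
          ultimately have "norm (f s) \<le> Kn / x ^ Suc n * (3 * x) ^ Suc n"
            unfolding nf using Kn x0 by (intro mult_mono power_mono) auto
          also have "\<dots> = 3 ^ Suc n * Kn" using x0 by (simp add: power_mult_distrib)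
          also have "\<dots> \<le> 3 ^ Suc n * B" using P Dn by (intro mult_left_mono) (auto simp: B_def)
          finally show ?thesis .
        qed
      qed
      moreover have "norm (F n s0) \<le> norm (f s0)"
      proof -
        have "s0 - w0 = of_real (Re s0 - 1)" by (simp add: w0_def t0_def complex_eq_iff)
        hence "(s0 - w0)\<^sup>2 + 1 = of_real ((Re s0 - 1)\<^sup>2 + 1)" by simp
        hence "norm ((s0 - w0)\<^sup>2 + 1) = \<bar>(Re s0 - 1)\<^sup>2 + 1\<bar>" by (metis norm_of_real)
        hence "norm ((s0 - w0)\<^sup>2 + 1) \<ge> 1" by simp
        hence "norm ((s0 - w0)\<^sup>2 + 1) ^ Suc n \<ge> 1" by (rule one_le_power)
        from mult_left_mono[OF this norm_ge_zero[of "F n s0"]] show ?thesis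
          by (simp only: f_def norm_mult norm_power mult_1_right)
      qed
      ultimately show ?thesis by (simp add: B_def t0_def)
    qed
    have "norm ((deriv ^^ n) G s) \<le> 3 ^ Suc n * (A * 2 powr \<beta> + Dn + Kn) * (1 + norm s) powr \<beta>" if s: "Re s > 1" for s
    proof -
      define X where "X = (1 + norm s) powr \<beta>"
      have X: "X \<ge> 1" unfolding X_def using A(2) by (intro ge_one_powr_ge_zero) auto
      have DK: "Dn \<le> Dn * X" "Kn \<le> Kn * X" using X Dn Kn by (auto simp: mult_le_cancel_left1)
      show ?thesis
      proof (cases "Re s < 2")
        case True
        have "norm ((deriv ^^ n) G s) \<le> 3 ^ Suc n * (A * (2 + \<bar>Im s\<bar>) powr \<beta> + Dn + Kn)"
          using strip[OF s True] eq[OF s] by simp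
        also have "(2 + \<bar>Im s\<bar>) powr \<beta> \<le> (2 * (1 + norm s)) powr \<beta>"
          using abs_Im_le_cmod[of s] A(2) by (intro powr_mono2) auto
        also have "\<dots> = 2 powr \<beta> * X" unfolding X_def by (subst powr_mult) (auto intro: add_nonneg_nonneg)
        finally have "norm ((deriv ^^ n) G s) \<le> 3 ^ Suc n * (A * (2 powr \<beta> * X) + Dn + Kn)"
          using A(1) by (simp add: mult_left_mono)
        also have "\<dots> \<le> 3 ^ Suc n * (A * (2 powr \<beta> * X) + Dn * X + Kn * X)"
          by (rule mult_left_mono) (use DK in linarith, simp)
        finally show ?thesis unfolding X_def[symmetric] by (simp add: algebra_simps)
      next
        case False
        have "norm ((deriv ^^ n) G s) \<le> 1 * Dn * 1"
          using higher_deriv_right_bound[OF hol D, of s n] False by (simp add: Dn_def)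
        also have "\<dots> \<le> 3 ^ Suc n * (A * 2 powr \<beta> + Dn + Kn) * X"
          using A(1) Dn Kn X by (intro mult_mono one_le_power) auto
        finally show ?thesis unfolding X_def .
      qed
    qed
    thus ?thesis by (auto intro: poly_boundI)
  qed
  with hol show ?thesis by (rule temperedI)
qed

section \<open>From the zeta function to its logarithm and back\<close>

text \<open>A shift to the right by \<open>\<eta> \<le> 1\<close> changes \<open>f\<close> by \<open>\<eta>\<close> times a polynomial bound. This is the tool for
leaving the line \<open>Re s = 1\<close>: \<open>\<eta>\<close> will be a negative power of \<open>1 + |s|\<close>.\<close>

lemma derivative_shift_bound:
  assumes f: "f holomorphic_on {s. Re s > 1}"
    and C: "C \<ge> 0" "\<gamma> \<ge> 0" "\<And>s. Re s > 1 \<Longrightarrow> norm (deriv f s) \<le> C * (1 + norm s) powr \<gamma>"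
    and s: "Re s > 1" and h: "0 \<le> \<eta>" "\<eta> \<le> 1"
  shows "norm (f s - f (s + of_real \<eta>)) \<le> \<eta> * (C * 2 powr \<gamma> * (1 + norm s) powr \<gamma>)"
proof -
  have "norm (f s - f (s + of_real \<eta>)) \<le> C * 2 powr \<gamma> * (1 + norm s) powr \<gamma> * norm (s - (s + of_real \<eta>))"
  proof (rule field_differentiable_bound[where S = "closed_segment s (s + of_real \<eta>)" and f' = "deriv f"])
    fix z assume "z \<in> closed_segment s (s + of_real \<eta>)"
    then obtain u where u: "0 \<le> u" "u \<le> 1" "z = (1 - u) *\<^sub>R s + u *\<^sub>R (s + of_real \<eta>)" by (auto simp: in_segment)
    have z: "z = s + of_real (u * \<eta>)" unfolding u(3) by (simp add: scaleR_conv_of_real algebra_simps)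
    have u': "0 \<le> u * \<eta>" "u * \<eta> \<le> 1" using u h by (auto intro: mult_le_one)
    have re: "Re z > 1" using s u' by (simp add: z)
    show "(f has_field_derivative deriv f z) (at z within closed_segment s (s + of_real \<eta>))"
      using holomorphic_derivI[OF f open_rhp, of z] re by (auto intro: has_field_derivative_at_within)
    have "norm z \<le> norm s + u * \<eta>" unfolding z using u' by (intro norm_triangle_le) (simp del: of_real_mult)
    hence "1 + norm z \<le> 2 * (1 + norm s)" using u' norm_ge_zero[of s] unfolding distrib_left by linarith
    hence "(1 + norm z) powr \<gamma> \<le> (2 * (1 + norm s)) powr \<gamma>" using C by (intro powr_mono2) (auto intro: add_nonneg_nonneg)
    also have "\<dots> = 2 powr \<gamma> * (1 + norm s) powr \<gamma>" by (subst powr_mult) (auto intro: add_nonneg_nonneg)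
    finally have "C * (1 + norm z) powr \<gamma> \<le> C * (2 powr \<gamma> * (1 + norm s) powr \<gamma>)" using C by (intro mult_left_mono)
    thus "norm (deriv f z) \<le> C * 2 powr \<gamma> * (1 + norm s) powr \<gamma>" using C(3)[OF re] by (simp add: mult.assoc)
  qed auto
  thus ?thesis using h by (simp add: mult_ac)
qed

text \<open>A holomorphic branch of \<open>log ((s - 1) \<zeta>(s))\<close>.\<close>
definition log_zeta_regularized :: "(real \<Rightarrow> real) \<Rightarrow> complex \<Rightarrow> complex" where
  "log_zeta_regularized P s = prime_dirichlet P s + Ln (s - 1)"

context
  fixes N P :: "real \<Rightarrow> real"
  assumes gns: "generalized_number_system N P"
begin

lemma zeta_remainder_holomorphic: "zeta_remainder N a holomorphic_on {s. Re s > 1}"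
  unfolding zeta_remainder_def by (intro holomorphic_intros zeta_holomorphic[OF gns]) auto

text \<open>The transform of \<open>N - a x\<close> is \<open>\<zeta> / s - a / (s - 1) = (G - a) / s\<close> with \<open>G = \<zeta> - a / (s - 1)\<close>.\<close>
lemma cesaro_N_iff_tempered:
  "(\<forall>n::nat. cesaro_approx (real n) N (\<lambda>x. a * x)) \<longleftrightarrow> tempered (zeta_remainder N a)"
proof -
  define E where "E = (\<lambda>x. if x \<ge> 1 then N x - a * x else 0)"
  have [measurable]: "N \<in> borel_measurable borel" by (rule borel_measurable_mono[OF gns_mono(1)[OF gns]])
  have m: "E \<in> borel_measurable borel" unfolding E_def by measurable
  have eq: "(\<lambda>v. E (exp v)) = (\<lambda>v. N (exp v) - (if v \<ge> 0 then a * exp v else 0))"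
    using gns_zero(1)[OF gns] by (auto simp: E_def fun_eq_iff)
  have e: "laplace_class (\<lambda>v. E (exp v))"
    unfolding eq by (intro laplace_class_diff laplace_N[OF gns] laplace_exp)
  have "(\<forall>n::nat. cesaro_approx (real n) N (\<lambda>x. a * x)) \<longleftrightarrow> tempered (laplace (\<lambda>v. E (exp v)))"
    unfolding cesaro_approx_def E_def[symmetric]
    by (rule cesaro_bigo_iff_tempered[OF m _ e]) (simp add: E_def)
  also have "\<dots> \<longleftrightarrow> tempered (zeta_remainder N a)"
  proof -
    have L: "laplace (\<lambda>v. E (exp v)) s = (zeta_remainder N a s + (- of_real a)) * (1 / s)" if s: "Re s > 1" for s
    proof -
      have nz: "s \<noteq> 0" "s - 1 \<noteq> 0" using s by auto
      have "laplace (\<lambda>v. E (exp v)) s = beurling_zeta N s / s - of_real a / (s - 1)"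
        unfolding eq by (subst laplace_diff) (use s laplace_N[OF gns] laplace_exp in auto)
      also have "\<dots> = (zeta_remainder N a s + (- of_real a)) * (1 / s)"
        using nz by (simp add: zeta_remainder_def divide_simps) (simp add: algebra_simps)
      finally show ?thesis .
    qed
    show ?thesis
    proof
      assume "tempered (zeta_remainder N a)"
      hence "tempered (\<lambda>s. (zeta_remainder N a s + (- of_real a)) * (1 / s))"
        by (intro tempered_mult tempered_add tempered_const tempered_reciprocal)
      thus "tempered (laplace (\<lambda>v. E (exp v)))" by (rule tempered_cong) (simp add: L)
    next
      assume "tempered (laplace (\<lambda>v. E (exp v)))"
      hence "tempered (\<lambda>s. laplace (\<lambda>v. E (exp v)) s * (s + 0) + of_real a)"
        by (intro tempered_mult tempered_add tempered_const tempered_linear)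
      thus "tempered (zeta_remainder N a)"
      proof (rule tempered_cong)
        fix s :: complex assume s: "Re s > 1"
        hence "s \<noteq> 0" by auto
        thus "laplace (\<lambda>v. E (exp v)) s * (s + 0) + of_real a = zeta_remainder N a s" by (simp add: L[OF s])
      qed
    qed
  qed
  finally show ?thesis .
qed

lemma log_zeta_regularized_holomorphic: "log_zeta_regularized P holomorphic_on {s. Re s > 1}"
  unfolding log_zeta_regularized_def[abs_def]
  by (intro holomorphic_intros prime_dirichlet_holomorphic[OF gns]) (auto simp: complex_nonpos_Reals_iff)

lemma exp_log_zeta_regularized:
  assumes "Re s > 1" shows "exp (log_zeta_regularized P s) = (s - 1) * beurling_zeta N s"
proof -
  have "s - 1 \<noteq> 0" using assms by auto
  thus ?thesis by (simp add: log_zeta_regularized_def exp_add zeta_eq_exp[OF gns assms])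
qed

lemma cesaro_P_iff_tempered:
  "(\<forall>n::nat. cesaro_approx (real n) P Li) \<longleftrightarrow> tempered (log_zeta_regularized P)"
proof -
  define E where "E = (\<lambda>x. if x \<ge> 1 then P x - Li x else 0)"
  have [measurable]: "P \<in> borel_measurable borel" by (rule borel_measurable_mono[OF gns_mono(2)[OF gns]])
  note [measurable] = Li_measurable
  have "E = (\<lambda>x. (if x \<ge> 1 then P x else 0) - (if x \<ge> 1 then Li x else 0))"
    by (auto simp: E_def fun_eq_iff)
  also have "\<dots> \<in> borel_measurable borel" by measurable
  finally have m: "E \<in> borel_measurable borel" .
  have eq: "(\<lambda>v. E (exp v)) = (\<lambda>v. P (exp v) - (if v \<ge> 0 then Li (exp v) else 0))"
    using gns_zero(2)[OF gns] by (auto simp: E_def fun_eq_iff)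
  have e: "laplace_class (\<lambda>v. E (exp v))"
    unfolding eq by (intro laplace_class_diff laplace_P[OF gns] laplace_class_Li)
  obtain c where c: "\<And>s. Re s > 1 \<Longrightarrow> laplace (\<lambda>v. if v \<ge> 0 then Li (exp v) else 0) s = (c - Ln (s - 1)) / s"
    using laplace_Li by blast
  have "(\<forall>n::nat. cesaro_approx (real n) P Li) \<longleftrightarrow> tempered (laplace (\<lambda>v. E (exp v)))"
    unfolding cesaro_approx_def E_def[symmetric]
    by (rule cesaro_bigo_iff_tempered[OF m _ e]) (simp add: E_def)
  also have "\<dots> \<longleftrightarrow> tempered (log_zeta_regularized P)"
  proof -
    have L: "laplace (\<lambda>v. E (exp v)) s = (log_zeta_regularized P s + (- c)) * (1 / s)" if s: "Re s > 1" for s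
    proof -
      have "laplace (\<lambda>v. E (exp v)) s = prime_dirichlet P s / s - (c - Ln (s - 1)) / s"
        unfolding eq by (subst laplace_diff) (use s laplace_P[OF gns] laplace_class_Li c in auto)
      thus ?thesis by (simp add: log_zeta_regularized_def diff_divide_distrib add_divide_distrib)
    qed
    show ?thesis
    proof
      assume "tempered (log_zeta_regularized P)"
      hence "tempered (\<lambda>s. (log_zeta_regularized P s + (- c)) * (1 / s))"
        by (intro tempered_mult tempered_add tempered_const tempered_reciprocal)
      thus "tempered (laplace (\<lambda>v. E (exp v)))" by (rule tempered_cong) (simp add: L)
    next
      assume "tempered (laplace (\<lambda>v. E (exp v)))"
      hence "tempered (\<lambda>s. laplace (\<lambda>v. E (exp v)) s * (s + 0) + c)"
        by (intro tempered_mult tempered_add tempered_const tempered_linear)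
      thus "tempered (log_zeta_regularized P)"
      proof (rule tempered_cong)
        fix s :: complex assume s: "Re s > 1"
        hence "s \<noteq> 0" by auto
        thus "laplace (\<lambda>v. E (exp v)) s * (s + 0) + c = log_zeta_regularized P s" by (simp add: L[OF s])
      qed
    qed
  qed
  finally show ?thesis .
qed

lemma norm_zeta_le: "Re s > 1 \<Longrightarrow> norm (beurling_zeta N s) \<le> exp (prime_real P (Re s))"
  using norm_prime_dirichlet_le[OF gns, of s] complex_Re_le_cmod[of "prime_dirichlet P s"]
  by (simp add: zeta_eq_exp[OF gns])

lemma norm_zeta_ge: "Re s > 1 \<Longrightarrow> norm (beurling_zeta N s) \<ge> exp (- prime_real P (Re s))"
  using norm_prime_dirichlet_le[OF gns, of s] abs_Re_le_cmod[of "prime_dirichlet P s"]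
  by (simp add: zeta_eq_exp[OF gns])

lemma zeta_real: "\<sigma> > 1 \<Longrightarrow> beurling_zeta N (of_real \<sigma>) = of_real (exp (prime_real P \<sigma>))"
  by (simp add: zeta_eq_exp[OF gns] prime_dirichlet_real[OF gns] exp_of_real)

text \<open>Polynomial growth of \<open>J = log ((s - 1) \<zeta>)\<close> says nothing about \<open>exp J\<close>, but \<open>J' = O((1 + |s|)\<^sup>\<beta>)\<close> lets \<open>J\<close>
change only by a constant when \<open>s\<close> is shifted by \<open>\<eta> = (1 + |s|)\<^sup>-\<^sup>\<beta>\<close>. At the shifted point \<open>|\<zeta>|\<close> is at most
\<open>\<zeta>(1 + \<eta>) = O(1 / \<eta>)\<close>, which is a polynomial bound.\<close>
lemma exp_log_zeta_poly_bound:
  assumes J: "tempered (log_zeta_regularized P)"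
  shows "\<exists>\<beta>. poly_bound \<beta> (\<lambda>s. exp (log_zeta_regularized P s))"
proof -
  let ?J = "log_zeta_regularized P"
  obtain C1 \<beta> where C1: "C1 > 0" "\<beta> \<ge> 0" "\<And>s. Re s > 1 \<Longrightarrow> norm (deriv ?J s) \<le> C1 * (1 + norm s) powr \<beta>"
    using tempered_derivE[OF J, of 1] by auto
  obtain C0 \<gamma> where C0: "C0 > 0" "\<gamma> \<ge> 0" "\<And>s. Re s > 1 \<Longrightarrow> norm (?J s) \<le> C0 * (1 + norm s) powr \<gamma>"
    using tempered_derivE[OF J, of 0] by auto
  define K where "K = exp (C0 * 3 powr \<gamma>)"
  have zeta_near_1: "exp (prime_real P (1 + \<eta>)) \<le> K / \<eta>" if h: "0 < \<eta>" "\<eta> \<le> 1" for \<eta>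
  proof -
    have re: "Re (of_real (1 + \<eta>)) > 1" using h by simp
    have "exp (?J (of_real (1 + \<eta>))) = of_real (\<eta> * exp (prime_real P (1 + \<eta>)))"
      using h unfolding exp_log_zeta_regularized[OF re] by (subst zeta_real) auto
    hence "\<eta> * exp (prime_real P (1 + \<eta>)) = norm (exp (?J (of_real (1 + \<eta>))))" using h by (simp add: norm_mult del: norm_exp_eq_Re)
    also have "\<dots> \<le> exp (norm (?J (of_real (1 + \<eta>))))" using complex_Re_le_cmod by simp
    also have "norm (?J (of_real (1 + \<eta>))) \<le> C0 * (1 + norm (complex_of_real (1 + \<eta>))) powr \<gamma>" by (rule C0(3)[OF re])
    also have "\<dots> \<le> C0 * 3 powr \<gamma>"
      using C0 h unfolding norm_of_real by (intro mult_left_mono powr_mono2) auto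
    finally have "\<eta> * exp (prime_real P (1 + \<eta>)) \<le> K" by (simp add: K_def)
    thus ?thesis using h by (simp add: field_simps)
  qed
  have "poly_bound (1 + \<beta>) (\<lambda>s. exp (?J s))"
  proof (rule poly_boundI[where C = "exp (C1 * 2 powr \<beta>) * 2 * K"])
    fix s :: complex assume s: "Re s > 1"
    define X where "X = 1 + norm s"
    have X: "X > 1" using complex_Re_le_cmod[of s] s unfolding X_def by linarith
    define \<eta> where "\<eta> = X powr (- \<beta>)"
    have h: "\<eta> > 0" "\<eta> \<le> 1" using X C1(2) by (auto simp: \<eta>_def powr_minus divide_simps ge_one_powr_ge_zero)
    define s' where "s' = s + of_real \<eta>"
    have s': "Re s' > 1" "1 + \<eta> \<le> Re s'" using s h by (auto simp: s'_def)
    have "norm (?J s - ?J s') \<le> \<eta> * (C1 * 2 powr \<beta> * X powr \<beta>)"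
      unfolding s'_def X_def
      by (rule derivative_shift_bound[OF log_zeta_regularized_holomorphic _ C1(2,3) s]) (use h C1 in auto)
    also have "\<dots> = C1 * 2 powr \<beta>" using X by (simp add: \<eta>_def powr_minus)
    finally have d: "norm (?J s - ?J s') \<le> C1 * 2 powr \<beta>" .
    have "Re (?J s) \<le> C1 * 2 powr \<beta> + Re (?J s')"
      using d complex_Re_le_cmod[of "?J s - ?J s'"] by simp
    hence "norm (exp (?J s)) \<le> exp (C1 * 2 powr \<beta>) * norm (exp (?J s'))" by (simp flip: exp_add)
    also have "norm (exp (?J s')) = norm (s' - 1) * norm (beurling_zeta N s')"
      unfolding exp_log_zeta_regularized[OF s'(1)] by (simp add: norm_mult)
    also have "norm (s' - 1) * norm (beurling_zeta N s') \<le> (2 * X) * (K * X powr \<beta>)"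
    proof (intro mult_mono)
      have "norm (s' - 1) \<le> norm s + norm (complex_of_real \<eta> - 1)"
        unfolding s'_def by (rule order_trans[OF _ norm_triangle_ineq]) (simp add: algebra_simps)
      also have "norm (complex_of_real \<eta> - 1) = \<bar>\<eta> - 1\<bar>" by (metis norm_of_real of_real_1 of_real_diff)
      also have "norm s + \<bar>\<eta> - 1\<bar> \<le> 2 * X" using h norm_ge_zero[of s] unfolding X_def distrib_left by linarith
      finally show "norm (s' - 1) \<le> 2 * X" .
      have "norm (beurling_zeta N s') \<le> exp (prime_real P (Re s'))" by (rule norm_zeta_le[OF s'(1)])
      also have "\<dots> \<le> exp (prime_real P (1 + \<eta>))" using prime_real_antimono[OF gns, of "1 + \<eta>" "Re s'"] s' h by simp
      also have "\<dots> \<le> K / \<eta>" by (rule zeta_near_1[OF h])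
      also have "\<dots> = K * X powr \<beta>" by (simp add: \<eta>_def powr_minus divide_simps)
      finally show "norm (beurling_zeta N s') \<le> K * X powr \<beta>" .
    qed (use X in auto)
    also have "exp (C1 * 2 powr \<beta>) * (2 * X * (K * X powr \<beta>)) = exp (C1 * 2 powr \<beta>) * 2 * K * X powr (1 + \<beta>)"
      using X by (simp add: powr_add)
    finally show "norm (exp (?J s)) \<le> exp (C1 * 2 powr \<beta>) * 2 * K * (1 + norm s) powr (1 + \<beta>)"
      by (simp add: X_def)
  qed
  thus ?thesis by blast
qed

text \<open>The constant \<open>a\<close> is the value at \<open>1\<close> of the continuous extension of \<open>exp J = (s - 1) \<zeta>\<close>. It is positive
because \<open>J\<close> is real on the real axis.\<close>
lemma tempered_zeta_remainder_of_log:
  assumes J: "tempered (log_zeta_regularized P)"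
  shows "\<exists>a>0. tempered (zeta_remainder N a)"
proof -
  let ?J = "log_zeta_regularized P"
  obtain H where H: "continuous_on {s. Re s \<ge> 1} H" "\<And>s. Re s > 1 \<Longrightarrow> H s = ?J s"
    using tempered_continuous_extension[OF J] by blast
  have real: "?J (of_real \<sigma>) \<in> \<real>" if "\<sigma> > 1" for \<sigma>
  proof -
    have "Ln (of_real \<sigma> - 1) = of_real (ln (\<sigma> - 1))" using that Ln_of_real[of "\<sigma> - 1"] by simp
    thus ?thesis using that by (simp add: log_zeta_regularized_def prime_dirichlet_real[OF gns])
  qed
  have "H 1 \<in> \<real>"
  proof (rule closed_sequentially)
    show "closed (\<real> :: complex set)" by (rule closed_complex_Reals)
    show "(\<lambda>j. H (1 + of_real (1 / real (Suc j)))) \<longlonglongrightarrow> H 1" by (rule shift_right_tendsto[OF H(1)]) simp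
    fix j
    define q where "q = 1 / real (Suc j)"
    have q: "q > 0" by (simp add: q_def)
    have "H (1 + of_real q) = ?J (1 + of_real q)"
      unfolding q_def by (rule H(2)[OF shift_right_in_rhp]) simp
    moreover have "?J (1 + of_real q) \<in> \<real>" using real[of "1 + q"] q by simp
    ultimately show "H (1 + of_real (1 / real (Suc j))) \<in> \<real>" by (simp only: q_def)
  qed
  then obtain c where c: "H 1 = of_real c" by (auto elim: Reals_cases)
  define a where "a = exp c"
  have "((\<lambda>s. exp (H s)) \<longlongrightarrow> exp (H 1)) (at 1 within {s. Re s \<ge> 1})"
    using H(1) by (auto simp: continuous_on_def intro!: tendsto_exp)
  hence "((\<lambda>s. exp (H s)) \<longlongrightarrow> of_real a) (at 1 within {s. Re s > 1})"
    unfolding c a_def exp_of_real[symmetric] by (rule tendsto_within_subset) auto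
  hence "((\<lambda>s. exp (H s) + (- of_real a)) \<longlongrightarrow> of_real a + (- of_real a)) (at 1 within {s. Re s > 1})"
    by (intro tendsto_add tendsto_const)
  hence "((\<lambda>s. exp (H s) + (- of_real a)) \<longlongrightarrow> 0) (at 1 within {s. Re s > 1})" by simp
  hence lim: "((\<lambda>s. exp (?J s) + (- of_real a)) \<longlongrightarrow> 0) (at 1 within {s. Re s > 1})"
    by (rule Lim_transform_eventually) (auto simp: eventually_at_filter H(2) intro!: always_eventually)
  obtain \<beta> where "poly_bound \<beta> (\<lambda>s. exp (?J s))" using exp_log_zeta_poly_bound[OF J] by blast
  hence "tempered (\<lambda>s. exp (?J s) + (- of_real a))" by (intro tempered_add tempered_const tempered_exp J)
  from tempered_divide_by_zero_at_1[OF this lim]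
  have "tempered (zeta_remainder N a)"
  proof (rule tempered_cong)
    fix s :: complex assume s: "Re s > 1"
    hence "s - 1 \<noteq> 0" by auto
    thus "(exp (?J s) + (- of_real a)) / (s - 1) = zeta_remainder N a s"
      by (simp add: exp_log_zeta_regularized[OF s] zeta_remainder_def field_simps)
  qed
  moreover have "a > 0" by (simp add: a_def)
  ultimately show ?thesis by blast
qed

lemma zeta_three_four_one:
  assumes "\<sigma> > 1"
  shows "1 \<le> exp (prime_real P \<sigma>) ^ 3 * norm (beurling_zeta N (Complex \<sigma> t)) ^ 4 * norm (beurling_zeta N (Complex \<sigma> (2 * t)))"
proof -
  have "exp (prime_real P \<sigma>) ^ 3 * norm (beurling_zeta N (Complex \<sigma> t)) ^ 4 * norm (beurling_zeta N (Complex \<sigma> (2 * t)))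
    = exp (3 * prime_real P \<sigma> + 4 * Re (prime_dirichlet P (Complex \<sigma> t)) + Re (prime_dirichlet P (Complex \<sigma> (2 * t))))"
    using assms by (simp add: zeta_eq_exp[OF gns] exp_add flip: exp_of_nat_mult)
  thus ?thesis using prime_three_four_one[OF gns assms, of t] by simp
qed

lemma exp_log_eq_zeta_remainder:
  assumes "Re s > 1"
  shows "exp (log_zeta_regularized P s) = zeta_remainder N a s * (s + (-1)) + of_real a"
proof -
  have "s - 1 \<noteq> 0" using assms by auto
  thus ?thesis by (simp add: exp_log_zeta_regularized[OF assms] zeta_remainder_def field_simps)
qed

lemma tempered_exp_log:
  assumes "tempered (zeta_remainder N a)"
  shows "tempered (\<lambda>s. exp (log_zeta_regularized P s))"
proof -
  have "tempered (\<lambda>s. zeta_remainder N a s * (s + (-1)) + of_real a)"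
    by (intro tempered_add tempered_mult tempered_linear tempered_const assms)
  thus ?thesis by (rule tempered_cong) (rule exp_log_eq_zeta_remainder[symmetric])
qed

text \<open>Lower bound for \<open>Z = exp J = (s - 1) \<zeta>\<close>. Near \<open>1\<close> it holds since \<open>Z\<close> is close to \<open>a > 0\<close>, for \<open>Re s \<ge> 2\<close> it is
trivial. In between, the 3-4-1 inequality gives \<open>|Z(w)|\<^sup>4 \<ge> c (Re w - 1)\<^sup>3 (1 + |w|)\<^sup>-\<^sup>\<beta>\<close>, so that
at the distance \<open>\<eta>\<close> from the line \<open>Re s = 1\<close> the value of \<open>|Z|\<close> is at least of order \<open>\<eta>\<^sup>3\<^sup>/\<^sup>4\<close>,
whereas shifting by \<open>\<eta>\<close> costs only the order \<open>\<eta>\<close>. A suitable negative power of \<open>1 + |s|\<close> for \<open>\<eta>\<close> makes the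
cost at most half of the value.\<close>
lemma inverse_exp_log_zeta_poly_bound:
  fixes a :: real
  assumes G: "tempered (zeta_remainder N a)" and a: "a > 0"
  shows "\<exists>\<beta>. poly_bound \<beta> (\<lambda>s. 1 / exp (log_zeta_regularized P s))"
proof -
  define Z where "Z = (\<lambda>s. exp (log_zeta_regularized P s))"
  have Z_G: "Z s = zeta_remainder N a s * (s + (-1)) + of_real a" if "Re s > 1" for s
    unfolding Z_def by (rule exp_log_eq_zeta_remainder[OF that])
  have tZ: "tempered Z" unfolding Z_def by (rule tempered_exp_log[OF G])
  have nZ: "norm (Z s) = norm (s - 1) * norm (beurling_zeta N s)" if "Re s > 1" for s
    unfolding Z_def exp_log_zeta_regularized[OF that] by (simp add: norm_mult)
  obtain C \<beta> where C: "C > 0" "\<beta> \<ge> 0" "\<And>s. Re s > 1 \<Longrightarrow> norm (Z s) \<le> C * (1 + norm s) powr \<beta>"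
    using tempered_derivE[OF tZ, of 0] by auto
  obtain C1 \<gamma> where C1: "C1 > 0" "\<gamma> \<ge> 0" "\<And>s. Re s > 1 \<Longrightarrow> norm (deriv Z s) \<le> C1 * (1 + norm s) powr \<gamma>"
    using tempered_derivE[OF tZ, of 1] by auto
  obtain Cg g where Cg: "Cg > 0" "g \<ge> 0" "\<And>s. Re s > 1 \<Longrightarrow> norm (zeta_remainder N a s) \<le> Cg * (1 + norm s) powr g"
    using tempered_derivE[OF G, of 0] by auto
  \<comment> \<open>the exponent forced by requiring \<open>(\<eta> X powr \<gamma>) ^ 4\<close> to be at most of order \<open>\<eta> ^ 3 X powr (- \<beta>)\<close>\<close>
  define \<kappa> where "\<kappa> = 4 * \<gamma> + \<beta>"
  have \<kappa>: "\<kappa> \<ge> 0" using C C1 by (simp add: \<kappa>_def)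
  define M where "M = Cg * 3 powr g"
  have M: "M > 0" using Cg by (simp add: M_def)
  define \<delta> where "\<delta> = min 1 (a / (2 * M))"
  have d: "0 < \<delta>" "\<delta> \<le> 1" "M * \<delta> \<le> a / 2" 
    using a M by (auto simp: \<delta>_def min_def field_simps)
  have near: "norm (Z s) \<ge> a / 2" if s: "Re s > 1" "norm (s - 1) \<le> \<delta>" for s
  proof -
    have "norm s \<le> norm (s - 1) + norm (1::complex)" by (rule order_trans[OF _ norm_triangle_ineq]) simp
    hence "norm s \<le> 2" using s(2) d(2) by simp
    hence "Cg * (1 + norm s) powr g \<le> M"
      unfolding M_def using Cg by (intro mult_left_mono powr_mono2) (auto intro: add_nonneg_nonneg)
    hence gM: "norm (zeta_remainder N a s) \<le> M" using Cg(3)[OF s(1)] by linarith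
    have "norm (zeta_remainder N a s * (s + (-1))) \<le> M * \<delta>"
      unfolding norm_mult using gM s(2) M by (intro mult_mono) auto
    moreover have "norm (complex_of_real a) - norm (zeta_remainder N a s * (s + (-1))) \<le> norm (Z s)"
      unfolding Z_G[OF s(1)] by (metis add.commute norm_diff_ineq)
    ultimately show ?thesis using d(3) a by simp
  qed
  define c0 where "c0 = \<delta> ^ 5 / ((C * 4 powr \<beta>) ^ 3 * (C * 2 powr \<beta>))"
  have c0: "c0 > 0" using C d by (auto simp: c0_def)
  have far: "norm (Z w) ^ 4 \<ge> c0 * (Re w - 1) ^ 3 * (1 + norm w) powr (- \<beta>)"
    if w: "1 < Re w" "Re w \<le> 3" "norm (w - 1) \<ge> \<delta>" for w
  proof -
    define \<sigma> t where "\<sigma> = Re w" and "t = Im w"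
    define w2 where "w2 = Complex \<sigma> (2 * t)"
    define X where "X = (1 + norm w) powr \<beta>"
    have wt: "w = Complex \<sigma> t" by (simp add: \<sigma>_def t_def)
    have w2: "Re w2 > 1" using w by (simp add: w2_def \<sigma>_def)
    have \<sigma>: "1 < \<sigma>" "\<sigma> \<le> 3" using w by (auto simp: \<sigma>_def)
    have X: "X > 0" using norm_ge_zero[of w] unfolding X_def by (subst powr_gt_zero) linarith
    have e1: "exp (prime_real P \<sigma>) \<le> C * 4 powr \<beta> / (\<sigma> - 1)"
    proof -
      have re: "Re (of_real \<sigma>) > 1" using \<sigma> by simp
      have "norm (complex_of_real \<sigma> - 1) = \<bar>\<sigma> - 1\<bar>" by (metis norm_of_real of_real_1 of_real_diff)
      hence "(\<sigma> - 1) * exp (prime_real P \<sigma>) = norm (Z (of_real \<sigma>))"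
        using \<sigma> by (simp add: nZ[OF re] zeta_real)
      also have "\<dots> \<le> C * (1 + norm (complex_of_real \<sigma>)) powr \<beta>" by (rule C(3)[OF re])
      also have "\<dots> \<le> C * 4 powr \<beta>" unfolding norm_of_real using C \<sigma> by (intro mult_left_mono powr_mono2) auto
      finally show ?thesis using \<sigma> by (simp add: field_simps)
    qed
    have e2: "norm (beurling_zeta N w2) \<le> C * 2 powr \<beta> * X / \<delta>"
    proof -
      have "\<delta> \<le> norm (w2 - 1)"
      proof -
        have "norm (w - 1) \<le> norm (w2 - 1)"
          unfolding cmod_def by (intro real_sqrt_le_mono) (simp add: wt w2_def power_mult_distrib)
        thus ?thesis using w by simp
      qed
      hence "\<delta> * norm (beurling_zeta N w2) \<le> norm (Z w2)" unfolding nZ[OF w2] by (intro mult_right_mono) auto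
      also have "\<dots> \<le> C * (1 + norm w2) powr \<beta>" by (rule C(3)[OF w2])
      also have "\<dots> \<le> C * (2 * (1 + norm w)) powr \<beta>"
      proof -
        have "norm w2 \<le> 2 * norm w"
          unfolding cmod_def real_sqrt_four[symmetric] real_sqrt_mult[symmetric]
          by (intro real_sqrt_le_mono) (simp add: wt w2_def power_mult_distrib)
        thus ?thesis using C by (intro mult_left_mono powr_mono2) (auto intro: add_nonneg_nonneg)
      qed
      also have "(2 * (1 + norm w)) powr \<beta> = 2 powr \<beta> * X" unfolding X_def by (subst powr_mult) (auto intro: add_nonneg_nonneg)
      finally show ?thesis using d by (simp add: field_simps)
    qed
    have "1 \<le> exp (prime_real P \<sigma>) ^ 3 * norm (beurling_zeta N w) ^ 4 * norm (beurling_zeta N w2)"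
      using zeta_three_four_one[OF \<sigma>(1), of t] by (simp add: wt w2_def)
    also have "\<dots> \<le> (C * 4 powr \<beta> / (\<sigma> - 1)) ^ 3 * norm (beurling_zeta N w) ^ 4 * (C * 2 powr \<beta> * X / \<delta>)"
      using e1 e2 C \<sigma> by (intro mult_mono power_mono) auto
    finally have "\<delta> * (\<sigma> - 1) ^ 3 / ((C * 4 powr \<beta>) ^ 3 * (C * 2 powr \<beta>)) / X \<le> norm (beurling_zeta N w) ^ 4"
      using C \<sigma> d X by (simp add: field_simps power_divide)
    hence "\<delta> ^ 4 * (\<delta> * (\<sigma> - 1) ^ 3 / ((C * 4 powr \<beta>) ^ 3 * (C * 2 powr \<beta>)) / X) \<le> norm (w - 1) ^ 4 * norm (beurling_zeta N w) ^ 4"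
      using w d C X \<sigma> by (intro mult_mono power_mono) auto
    also have "\<dots> = norm (Z w) ^ 4" using nZ[OF w(1)] by (simp add: power_mult_distrib)
    also have "\<delta> ^ 4 * (\<delta> * (\<sigma> - 1) ^ 3 / ((C * 4 powr \<beta>) ^ 3 * (C * 2 powr \<beta>)) / X) = c0 * (Re w - 1) ^ 3 * (1 + norm w) powr (- \<beta>)"
      by (simp add: c0_def X_def \<sigma>_def powr_minus divide_inverse eval_nat_numeral)
    finally show ?thesis .
  qed
  define c1 where "c1 = c0 * 2 powr (- \<beta>)"
  define C2 where "C2 = C1 * 2 powr \<gamma>"
  define \<theta> where "\<theta> = min 1 (c1 / (16 * C2 ^ 4))"
  have c1: "c1 > 0" and C2: "C2 > 0" using c0 C1 by (auto simp: c1_def C2_def)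
  have th: "0 < \<theta>" "\<theta> \<le> 1" "\<theta> * (16 * C2 ^ 4) \<le> c1"
    using c1 C2 by (auto simp: \<theta>_def min_def field_simps)
  have mid: "norm (Z s) \<ge> \<theta> * C2 * (1 + norm s) powr (- \<kappa>)"
    if s: "1 < Re s" "Re s \<le> 2" "norm (s - 1) \<ge> \<delta>" for s
  proof -
    define X where "X = 1 + norm s"
    have X: "X \<ge> 1" by (simp add: X_def)
    define \<eta> where "\<eta> = \<theta> * X powr (- \<kappa>)"
    have "X powr (- \<kappa>) \<le> 1" using X \<kappa> by (simp add: powr_minus divide_simps ge_one_powr_ge_zero)
    hence h: "0 < \<eta>" "\<eta> \<le> 1" using th X by (auto simp: \<eta>_def intro!: mult_le_one mult_pos_pos)
    define w where "w = s + of_real \<eta>"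
    have w: "1 < Re w" "Re w \<le> 3" "Re w - 1 \<ge> \<eta>" using s h by (auto simp: w_def)
    have "norm (s - 1) \<le> norm (w - 1)"
      unfolding cmod_def using s h by (intro real_sqrt_le_mono) (auto simp: w_def intro!: power_mono)
    hence w1: "norm (w - 1) \<ge> \<delta>" using s by simp
    have nw: "1 + norm w \<le> 2 * X"
    proof -
      have "norm w \<le> norm s + \<eta>" unfolding w_def using h by (intro norm_triangle_le) auto
      thus ?thesis using h X unfolding X_def distrib_left by linarith
    qed
    have "(2 * \<eta> * C2 * X powr \<gamma>) ^ 4 \<le> c1 * \<eta> ^ 3 * X powr (- \<beta>)"
    proof -
      have "(X powr \<gamma>) ^ 4 = X powr (4 * \<gamma>)" using X by (simp add: powr_power mult.commute)
      hence "(2 * \<eta> * C2 * X powr \<gamma>) ^ 4 = \<eta> ^ 3 * (\<theta> * (16 * C2 ^ 4)) * (X powr (- \<kappa>) * X powr (4 * \<gamma>))"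
        by (simp add: power_mult_distrib eval_nat_numeral \<eta>_def)
      also have "X powr (- \<kappa>) * X powr (4 * \<gamma>) = X powr (- \<beta>)"
        by (simp add: \<kappa>_def flip: powr_add)
      also have "\<eta> ^ 3 * (\<theta> * (16 * C2 ^ 4)) * X powr (- \<beta>) \<le> \<eta> ^ 3 * c1 * X powr (- \<beta>)"
        using th(3) h by (intro mult_right_mono mult_left_mono) auto
      finally show ?thesis by (simp add: mult_ac)
    qed
    also have "c1 * \<eta> ^ 3 * X powr (- \<beta>) = c0 * \<eta> ^ 3 * (2 * X) powr (- \<beta>)"
      using X by (simp add: c1_def powr_mult)
    also have "\<dots> \<le> c0 * (Re w - 1) ^ 3 * (1 + norm w) powr (- \<beta>)"
    proof (intro mult_mono power_mono)
      show "(2 * X) powr (- \<beta>) \<le> (1 + norm w) powr (- \<beta>)"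
        using nw C(2) norm_ge_zero[of w] by (intro powr_mono2') (auto intro: add_pos_nonneg)
    qed (use c0 h w in auto)
    also have "\<dots> \<le> norm (Z w) ^ 4" by (rule far[OF w(1,2) w1])
    finally have "2 * \<eta> * C2 * X powr \<gamma> \<le> norm (Z w)"
      using h C2 by (subst (asm) power_mono_iff) auto
    moreover have "norm (Z s - Z w) \<le> \<eta> * (C2 * X powr \<gamma>)"
      unfolding w_def X_def C2_def
      by (rule derivative_shift_bound[OF tempered_holomorphic[OF tZ] _ C1(2,3) s(1)]) (use h C1 in auto)
    moreover have "norm (Z w) \<le> norm (Z s) + norm (Z s - Z w)"
      by (metis norm_triangle_sub norm_minus_commute)
    ultimately have "\<eta> * C2 * X powr \<gamma> \<le> norm (Z s)" by (simp add: algebra_simps)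
    moreover have "\<eta> * C2 * 1 \<le> \<eta> * C2 * X powr \<gamma>"
      using h C2 X C1 by (intro mult_left_mono ge_one_powr_ge_zero) auto
    ultimately show ?thesis by (simp add: \<eta>_def X_def mult_ac)
  qed
  have right: "norm (Z s) \<ge> exp (- prime_real P 2)" if s: "Re s \<ge> 2" for s
  proof -
    have s1: "Re s > 1" using s by simp
    have "1 \<le> norm (s - 1)" using complex_Re_le_cmod[of "s - 1"] s by simp
    moreover have "exp (- prime_real P 2) \<le> norm (beurling_zeta N s)"
      using norm_zeta_ge[OF s1] prime_real_antimono[OF gns, of 2 "Re s"] s by (simp add: order_trans[rotated])
    ultimately have "1 * exp (- prime_real P 2) \<le> norm (s - 1) * norm (beurling_zeta N s)"
      by (intro mult_mono) auto
    thus ?thesis using nZ[OF s1] by simp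
  qed
  define c where "c = min (exp (- prime_real P 2)) (min (a / 2) (\<theta> * C2))"
  have c: "c > 0" using a th C2 by (simp add: c_def)
  have "poly_bound \<kappa> (\<lambda>s. 1 / Z s)"
  proof (rule poly_boundI[where C = "1 / c"])
    fix s :: complex assume s: "Re s > 1"
    define Y where "Y = (1 + norm s) powr (- \<kappa>)"
    have X0: "1 + norm s > 0" using norm_ge_zero[of s] by linarith
    have Y: "0 < Y" "Y \<le> 1"
      using X0 \<kappa> by (auto simp: Y_def powr_minus divide_simps ge_one_powr_ge_zero)
    have le: "c * Y \<le> norm (Z s)"
    proof -
      consider "Re s \<ge> 2" | "norm (s - 1) \<le> \<delta>" | "Re s \<le> 2" "norm (s - 1) \<ge> \<delta>" by linarith
      thus ?thesis
      proof cases
        case 1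
        have "c * Y \<le> exp (- prime_real P 2) * 1" using Y c by (intro mult_mono) (auto simp: c_def)
        thus ?thesis using right[OF 1] by simp
      next
        case 2
        have "c * Y \<le> (a / 2) * 1" using Y c a by (intro mult_mono) (auto simp: c_def)
        thus ?thesis using near[OF s 2] by simp
      next
        case 3
        have "c * Y \<le> \<theta> * C2 * Y" using Y by (intro mult_right_mono) (auto simp: c_def)
        thus ?thesis using mid[OF s 3] by (simp add: Y_def)
      qed
    qed
    have "c * Y > 0" using c Y by simp
    hence "1 / norm (Z s) \<le> 1 / (c * Y)" by (rule frac_le[OF zero_le_one order_refl _ le])
    also have "\<dots> = 1 / c * (1 + norm s) powr \<kappa>" using c by (simp add: Y_def powr_minus divide_simps)
    finally show "norm (1 / Z s) \<le> 1 / c * (1 + norm s) powr \<kappa>" by (simp add: norm_divide)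
  qed
  thus ?thesis by (auto simp: Z_def)
qed

text \<open>The derivative \<open>J' = (exp J)' / exp J\<close> is tempered by the lower bound for \<open>exp J\<close>. The growth of \<open>J\<close> itself
follows by comparison with \<open>J (s + 1)\<close>, where \<open>Re (s + 1) > 2\<close>.\<close>
lemma tempered_log_of_zeta_remainder:
  fixes a :: real
  assumes G: "tempered (zeta_remainder N a)" and a: "a > 0"
  shows "tempered (log_zeta_regularized P)"
proof -
  let ?J = "log_zeta_regularized P"
  have tZ: "tempered (\<lambda>s. exp (?J s))" by (rule tempered_exp_log[OF G])
  obtain \<beta> where "poly_bound \<beta> (\<lambda>s. 1 / exp (?J s))" using inverse_exp_log_zeta_poly_bound[OF G a] by blast
  hence tI: "tempered (\<lambda>s. 1 / exp (?J s))" by (rule tempered_inverse[OF tZ]) simp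
  have dJ: "(?J has_field_derivative deriv ?J s) (at s)" if "Re s > 1" for s
    using holomorphic_derivI[OF log_zeta_regularized_holomorphic open_rhp] that by auto
  have "tempered (\<lambda>s. deriv (\<lambda>s. exp (?J s)) s * (1 / exp (?J s)))"
    by (intro tempered_mult tempered_deriv tZ tI)
  hence tD: "tempered (deriv ?J)"
  proof (rule tempered_cong)
    fix s :: complex assume "Re s > 1"
    from DERIV_chain2[OF DERIV_exp dJ[OF this]] have "deriv (\<lambda>s. exp (?J s)) s = exp (?J s) * deriv ?J s"
      by (rule DERIV_imp_deriv)
    thus "deriv (\<lambda>s. exp (?J s)) s * (1 / exp (?J s)) = deriv ?J s" by simp
  qed
  obtain C \<gamma> where C: "C > 0" "\<gamma> \<ge> 0" "\<And>s. Re s > 1 \<Longrightarrow> norm (deriv ?J s) \<le> C * (1 + norm s) powr \<gamma>"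
    using tempered_derivE[OF tD, of 0] by auto
  have "poly_bound (1 + \<gamma>) ?J"
  proof (rule poly_boundI[where C = "prime_real P 2 + 1 + pi + C * 2 powr \<gamma>"])
    fix s :: complex assume s: "Re s > 1"
    define X where "X = 1 + norm s"
    have X: "X \<ge> 1" by (simp add: X_def)
    have re: "Re (s + 1) > 1" using s by simp
    have "norm (?J s - ?J (s + of_real 1)) \<le> 1 * (C * 2 powr \<gamma> * X powr \<gamma>)"
      unfolding X_def by (rule derivative_shift_bound[OF log_zeta_regularized_holomorphic _ C(2,3) s]) (use C in auto)
    hence d: "norm (?J s) \<le> norm (?J (s + 1)) + C * 2 powr \<gamma> * X powr \<gamma>"
      using norm_triangle_sub[of "?J s" "?J (s + 1)"] by simp
    have "norm (prime_dirichlet P (s + 1)) \<le> prime_real P 2"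
      using norm_prime_dirichlet_le[OF gns re] prime_real_antimono[OF gns, of 2 "Re (s + 1)"] s by simp
    moreover have "norm (Ln s) \<le> X + pi"
    proof -
      have s1: "norm s > 1" using complex_Re_le_cmod[of s] s by linarith
      have "norm (Ln s) \<le> \<bar>Re (Ln s)\<bar> + \<bar>Im (Ln s)\<bar>" by (rule cmod_le)
      also have "\<bar>Re (Ln s)\<bar> \<le> X"
      proof -
        have "s \<noteq> 0" using s by auto
        hence "\<bar>Re (Ln s)\<bar> = ln (norm s)" using s1 by (simp add: Re_Ln)
        also have "\<dots> \<le> X" using s1 ln_le_minus_one[of "norm s"] unfolding X_def by linarith
        finally show ?thesis .
      qed
      also have "\<bar>Im (Ln s)\<bar> \<le> pi"
        using s mpi_less_Im_Ln[of s] Im_Ln_le_pi[of s] by (cases "s = 0") auto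
      finally show ?thesis by simp
    qed
    ultimately have "norm (?J (s + 1)) \<le> prime_real P 2 + (X + pi)"
      unfolding log_zeta_regularized_def by (intro norm_triangle_le add_mono) simp_all
    hence "norm (?J s) \<le> prime_real P 2 * 1 + 1 * X + pi * 1 + C * 2 powr \<gamma> * X powr \<gamma>" using d by simp
    also have "\<dots> \<le> prime_real P 2 * X powr (1 + \<gamma>) + 1 * X powr (1 + \<gamma>) + pi * X powr (1 + \<gamma>) + C * 2 powr \<gamma> * X powr (1 + \<gamma>)"
    proof (intro add_mono mult_left_mono)
      show "1 \<le> X powr (1 + \<gamma>)" "1 \<le> X powr (1 + \<gamma>)" using X C by (auto intro!: ge_one_powr_ge_zero)
      have "X powr 1 \<le> X powr (1 + \<gamma>)" using X C by (intro powr_mono) auto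
      thus "X \<le> X powr (1 + \<gamma>)" using X by simp
      show "X powr \<gamma> \<le> X powr (1 + \<gamma>)" using X by (intro powr_mono) auto
    qed (use C prime_real_nonneg[OF gns] in auto)
    finally show "norm (?J s) \<le> (prime_real P 2 + 1 + pi + C * 2 powr \<gamma>) * (1 + norm s) powr (1 + \<gamma>)"
      by (simp add: X_def algebra_simps)
  qed
  from tempered_of_deriv[OF log_zeta_regularized_holomorphic this tD] show ?thesis .
qed

text \<open>On the real axis, continuity of the extension at \<open>1\<close> gives \<open>\<zeta>(\<sigma>) = O(1 / (\<sigma> - 1))\<close>, and \<open>|\<zeta>(s)| \<le> \<zeta>(Re s)\<close>
transfers this to the strip.\<close>
lemma zeta_remainder_bounds_of_boundary_continuity:
  fixes a :: real
  assumes a: "a > 0" and H: "continuous_on {s. Re s \<ge> 1} H" "\<And>s. Re s > 1 \<Longrightarrow> H s = zeta_remainder N a s"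
  obtains C where "\<And>s. 1 < Re s \<Longrightarrow> Re s \<le> 3 \<Longrightarrow> norm (zeta_remainder N a s) \<le> C / (Re s - 1)"
    and "\<And>s. Re s \<ge> 3 / 2 \<Longrightarrow> norm (zeta_remainder N a s) \<le> exp (prime_real P (3 / 2)) + 2 * a"
proof -
  have rem: "norm (zeta_remainder N a s) \<le> exp (prime_real P (Re s)) + a / (Re s - 1)" if s: "Re s > 1" for s
  proof -
    have "norm (zeta_remainder N a s) \<le> norm (beurling_zeta N s) + norm (of_real a / (s - 1))"
      unfolding zeta_remainder_def by (rule norm_triangle_ineq4)
    also have "norm (beurling_zeta N s) \<le> exp (prime_real P (Re s))" by (rule norm_zeta_le[OF s])
    also have "norm (of_real a / (s - 1)) \<le> a / (Re s - 1)"
      unfolding norm_divide using a s complex_Re_le_cmod[of "s - 1"] by (auto intro!: divide_left_mono mult_pos_pos)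
    finally show ?thesis by simp
  qed
  have "compact ((\<lambda>\<sigma>. H (of_real \<sigma>)) ` {1..3::real})"
    by (intro compact_continuous_image continuous_on_compose2[OF H(1)]) (auto intro!: continuous_intros)
  hence "bounded ((\<lambda>\<sigma>. H (of_real \<sigma>)) ` {1..3::real})" by (rule compact_imp_bounded)
  then obtain K where K: "\<And>\<sigma>. \<sigma> \<in> {1..3::real} \<Longrightarrow> norm (H (of_real \<sigma>)) \<le> K"
    unfolding bounded_iff ball_simps(9) by metis
  have K0: "K \<ge> 0" by (rule order_trans[OF norm_ge_zero K[of 1]]) simp
  show ?thesis
  proof (rule that[of "2 * K + 2 * a"])
    fix s :: complex assume s: "1 < Re s" "Re s \<le> 3"
    define \<sigma> where "\<sigma> = Re s"
    have \<sigma>: "1 < \<sigma>" "\<sigma> \<le> 3" using s by (auto simp: \<sigma>_def)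
    have "complex_of_real (exp (prime_real P \<sigma>)) = H (of_real \<sigma>) + of_real (a / (\<sigma> - 1))"
      using \<sigma> by (simp add: H(2) zeta_remainder_def zeta_real)
    hence "norm (complex_of_real (exp (prime_real P \<sigma>))) = norm (H (of_real \<sigma>) + of_real (a / (\<sigma> - 1)))" by (simp only:)
    also have "\<dots> \<le> norm (H (of_real \<sigma>)) + norm (complex_of_real (a / (\<sigma> - 1)))" by (rule norm_triangle_ineq)
    also have "\<dots> \<le> K + a / (\<sigma> - 1)" using K[of \<sigma>] \<sigma> a unfolding norm_of_real by (intro add_mono) auto
    finally have "exp (prime_real P \<sigma>) \<le> K + a / (\<sigma> - 1)" unfolding norm_of_real by simp
    hence "norm (zeta_remainder N a s) \<le> K + 2 * (a / (\<sigma> - 1))"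
      using rem[OF s(1)] by (simp add: \<sigma>_def)
    also have "K \<le> 2 * K / (\<sigma> - 1)"
    proof -
      have "K * (\<sigma> - 1) \<le> K * 2" using \<sigma> K0 by (intro mult_left_mono) auto
      thus ?thesis using \<sigma> by (simp add: pos_le_divide_eq)
    qed
    finally show "norm (zeta_remainder N a s) \<le> (2 * K + 2 * a) / (Re s - 1)" by (simp add: \<sigma>_def add_divide_distrib)
  next
    fix s :: complex assume s: "Re s \<ge> 3 / 2"
    have "norm (zeta_remainder N a s) \<le> exp (prime_real P (Re s)) + a / (Re s - 1)" by (rule rem) (use s in simp)
    also have "prime_real P (Re s) \<le> prime_real P (3 / 2)" by (rule prime_real_antimono[OF gns]) (use s in auto)
    also have "a / (Re s - 1) \<le> a / (1 / 2)" using a s by (intro divide_left_mono) auto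
    finally show "norm (zeta_remainder N a s) \<le> exp (prime_real P (3 / 2)) + 2 * a" by simp
  qed
qed

lemma smooth_extension_iff_tempered:
  fixes a :: real
  assumes a: "a > 0"
  shows "(\<exists>H. smooth_extension (zeta_remainder N a) H \<and> (\<lambda>t. H (1 + \<i> * complex_of_real t)) \<in> O_M)
           \<longleftrightarrow> tempered (zeta_remainder N a)"
proof
  assume "\<exists>H. smooth_extension (zeta_remainder N a) H \<and> (\<lambda>t. H (1 + \<i> * complex_of_real t)) \<in> O_M"
  then obtain H where ext: "smooth_extension (zeta_remainder N a) H"
    and OM: "(\<lambda>t. H (1 + \<i> * complex_of_real t)) \<in> O_M" by blast
  obtain F where F: "F (0::nat) = H" "\<And>n. continuous_on {s. Re s \<ge> 1} (F n)"
    "\<And>n s. Re s > 1 \<Longrightarrow> F n s = (deriv ^^ n) (zeta_remainder N a) s"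
    using ext unfolding smooth_extension_def by blast
  have H: "continuous_on {s. Re s \<ge> 1} H" "\<And>s. Re s > 1 \<Longrightarrow> H s = zeta_remainder N a s"
    using F(2)[of 0] F(3)[of _ 0] by (simp_all add: F(1))
  from zeta_remainder_bounds_of_boundary_continuity[OF a H]
  obtain C where C: "\<And>s. 1 < Re s \<Longrightarrow> Re s \<le> 3 \<Longrightarrow> norm (zeta_remainder N a s) \<le> C / (Re s - 1)"
    and D: "\<And>s. Re s \<ge> 3 / 2 \<Longrightarrow> norm (zeta_remainder N a s) \<le> exp (prime_real P (3 / 2)) + 2 * a" by blast
  show "tempered (zeta_remainder N a)" by (rule tempered_of_smooth_extension[OF ext OM C D])
qed (rule smooth_extension_of_tempered)

end

theorem theorem4:
  fixes N P :: "real \<Rightarrow> real"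
  assumes "generalized_number_system N P"
  shows "((\<exists>a>0. \<forall>n::nat. cesaro_approx (real n) N (\<lambda>x. a * x)) \<longleftrightarrow>
          (\<exists>a>0. \<exists>H. smooth_extension (zeta_remainder N a) H \<and>
                     (\<lambda>t::real. H (1 + \<i> * complex_of_real t)) \<in> O_M))
       \<and> ((\<exists>a>0. \<forall>n::nat. cesaro_approx (real n) N (\<lambda>x. a * x)) \<longleftrightarrow>
          (\<exists>a>0. \<exists>\<beta>::nat \<Rightarrow> real. (\<forall>n. \<beta> n > 0) \<and>
             (\<forall>n. \<exists>C::real. \<forall>s. Re s > 1 \<longrightarrow>
                norm ((deriv ^^ n) (zeta_remainder N a) s) \<le> C * (1 + norm s) powr \<beta> n)))
       \<and> ((\<exists>a>0. \<forall>n::nat. cesaro_approx (real n) N (\<lambda>x. a * x)) \<longleftrightarrow>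
          (\<forall>n::nat. cesaro_approx (real n) P Li))"
proof -
  note cesaro_N = cesaro_N_iff_tempered[OF assms]
  have "(\<exists>a>0. tempered (zeta_remainder N a)) \<longleftrightarrow> tempered (log_zeta_regularized P)"
    using tempered_zeta_remainder_of_log[OF assms] tempered_log_of_zeta_remainder[OF assms] by blast
  moreover have tempered_growth: "(\<exists>\<beta>::nat \<Rightarrow> real. (\<forall>n. \<beta> n > 0) \<and>
             (\<forall>n. \<exists>C::real. \<forall>s. Re s > 1 \<longrightarrow>
                norm ((deriv ^^ n) (zeta_remainder N a) s) \<le> C * (1 + norm s) powr \<beta> n))
        \<longleftrightarrow> tempered (zeta_remainder N a)" for a
    using tempered_iff[of "zeta_remainder N a"] zeta_remainder_holomorphic[OF assms, of a] by blast
  ultimately show ?thesis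
    unfolding cesaro_N cesaro_P_iff_tempered[OF assms] tempered_growth
    using smooth_extension_iff_tempered[OF assms] by blast
qed

end
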